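(* Let $\alpha>1$, let $b>0$ be a constant, and let $G(x,y)=G(y)$ be an $L$-periodic function with $\min_{y\in\mathbb R}G(y)=0$. Let $\Omega^\epsilon$, $f^\epsilon$, $\hat f^\epsilon$, $\hat f$ and $u^\epsilon$ be as in the context, and put $f=\hat f/p$ with the constant $p=b+\frac1L\int_0^LG(y)\,dy$ (so that $f$ is the common value of $f^\epsilon$ if $f^\epsilon(x_1,x_2)=f(x_1)$). Then the homogenized limit of $u^\epsilon$ is given by the equation with constant coefficients $$ \begin{cases} -d\,u''+u=f & \text{in }(0,1),\\ u'(0)=u'(1)=0, \end{cases} $$ that is, $\|u^\epsilon-u\|_{L^2(\Omega^\epsilon)}\to0$ as $\epsilon\to0$, where $u\in H^1(0,1)$ is the unique weak solution of this problem and the diffusion coefficient is $$ d=\frac{b}{b+\frac1L\int_0^LG(y)\,dy}=\frac{Lb}{Lb+\int_0^LG(y)\,dy}, $$ i.e. $d$ is the ratio of the area of the non-oscillating part $\{0<y_1<L,\ -b<y_2<0\}$ of the unit cell to the total area of the unit cell $\{0<y_1<L,\ -b<y_2<G(y_1)\}$.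
   Context: Setting. For $\epsilon\in(0,\epsilon_0)$ let $G_\epsilon(x)=G(x/\epsilon^\alpha)$ and $$\Omega^\epsilon=\{(x_1,x_2)\in\mathbb R^2 : x_1\in(0,1),\ -b<x_2<G_\epsilon(x_1)\},$$ which is assumed to be a domain (in particular open). Here $L>0$ is a period of $G:\mathbb R\to[0,\infty)$. The data $f^\epsilon\in L^2(\Omega^\epsilon)$ satisfy $\|f^\epsilon\|_{L^2(\Omega^\epsilon)}\le C$ with $C$ independent of $\epsilon$, and $\hat f^\epsilon(x)=\int_{-b}^{G_\epsilon(x)}f^\epsilon(x,y)\,dy$ satisfies $\hat f^\epsilon\rightharpoonup\hat f$ weakly in $L^2(0,1)$ as $\epsilon\to0$, for some $\hat f\in L^2(0,1)$. $u^\epsilon\in H^1(\Omega^\epsilon)$ is the unique weak solution of $-\partial_{x_1}^2u^\epsilon-\epsilon^{-2}\partial_{x_2}^2u^\epsilon+u^\epsilon=f^\epsilon$ in $\Omega^\epsilon$ with $\partial_{x_1}u^\epsilon\,\nu_1^\epsilon+\epsilon^{-2}\partial_{x_2}u^\epsilon\,\nu_2^\epsilon=0$ on $\partial\Omega^\epsilon$ ($\nu^\epsilon$ the outward unit normal), i.e. $$\int_{\Omega^\epsilon}\Big\{\frac{\partial u^\epsilon}{\partial x_1}\frac{\partial\varphi}{\partial x_1}+\frac1{\epsilon^2}\frac{\partial u^\epsilon}{\partial x_2}\frac{\partial\varphi}{\partial x_2}+u^\epsilon\varphi\Big\}dx_1dx_2=\int_{\Omega^\epsilon}f^\epsilon\varphi\,dx_1dx_2\quad\forall\varphi\in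 H^1(\Omega^\epsilon).$$ A function of $x_1$ alone is regarded as a function on $\Omega^\epsilon$ that is constant in $x_2$.
   Formalization: The function G is additionally assumed bounded; without this the claim fails, e.g. for L = 1 and G(y) = dist(y,Z)^(-1/4) off the integers, G = 0 on the integers, with suitable f^ε concentrated at heights between 1/ε and 2/ε. *)

theory Defs
  imports "HOL-Analysis.Analysis"
begin

text \<open>Elements of \<open>L\<^sup>2\<close> and \<open>H\<^sup>1\<close> are represented by functions on the ambient space; only the values on
  the domain matter, and equality of elements is almost-everywhere equality on it.\<close>

definition L2 :: "'a::euclidean_space set \<Rightarrow> ('a \<Rightarrow> real) set" where
  "L2 \<Omega> = {u \<in> borel_measurable (lebesgue_on \<Omega>). integrable (lebesgue_on \<Omega>) (\<lambda>x. (u x)\<^sup>2)}"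

definition L2_norm :: "'a::euclidean_space set \<Rightarrow> ('a \<Rightarrow> real) \<Rightarrow> real" where
  "L2_norm \<Omega> u = sqrt (LINT x|lebesgue_on \<Omega>. (u x)\<^sup>2)"

definition L2_weakly_converges ::
  "'a::euclidean_space set \<Rightarrow> ('i \<Rightarrow> 'a \<Rightarrow> real) \<Rightarrow> ('a \<Rightarrow> real) \<Rightarrow> 'i filter \<Rightarrow> bool" where
  "L2_weakly_converges \<Omega> g g0 F \<longleftrightarrow>
     (\<forall>\<^sub>F i in F. g i \<in> L2 \<Omega>) \<and> g0 \<in> L2 \<Omega> \<and>
     (\<forall>\<phi>\<in>L2 \<Omega>. ((\<lambda>i. LINT x|lebesgue_on \<Omega>. g i x * \<phi> x) \<longlongrightarrow>
                     (LINT x|lebesgue_on \<Omega>. g0 x * \<phi> x)) F)"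

abbreviation dir_deriv :: "'a::euclidean_space \<Rightarrow> ('a \<Rightarrow> real) \<Rightarrow> 'a \<Rightarrow> real" where
  "dir_deriv e \<phi> x \<equiv> frechet_derivative \<phi> (at x) e"

primrec Ck :: "nat \<Rightarrow> ('a::euclidean_space \<Rightarrow> real) \<Rightarrow> bool" where
  "Ck 0 \<phi> \<longleftrightarrow> continuous_on UNIV \<phi>"
| "Ck (Suc k) \<phi> \<longleftrightarrow> (\<forall>x. \<phi> differentiable at x) \<and> (\<forall>e\<in>Basis. Ck k (dir_deriv e \<phi>))"

definition test_functions :: "'a::euclidean_space set \<Rightarrow> ('a \<Rightarrow> real) set" where
  "test_functions \<Omega> =
     {\<phi>. (\<forall>k. Ck k \<phi>) \<and> compact (closure {x. \<phi> x \<noteq> 0}) \<and> closure {x. \<phi> x \<noteq> 0} \<subseteq> \<Omega>}"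

text \<open>\<open>v\<close> is, on the open set \<open>\<Omega>\<close>, the weak derivative of \<open>u\<close> in the direction \<open>e\<close>, both being in
  \<open>L\<^sup>2\<close>. This determines \<open>v\<close> almost everywhere, so in the weak formulations below it is immaterial
  which representative of a weak derivative is used.\<close>

definition L2_weak_deriv ::
  "'a::euclidean_space set \<Rightarrow> 'a \<Rightarrow> ('a \<Rightarrow> real) \<Rightarrow> ('a \<Rightarrow> real) \<Rightarrow> bool" where
  "L2_weak_deriv \<Omega> e u v \<longleftrightarrow> u \<in> L2 \<Omega> \<and> v \<in> L2 \<Omega> \<and>
     (\<forall>\<phi>\<in>test_functions \<Omega>.
        (LINT x|lebesgue_on \<Omega>. u x * dir_deriv e \<phi> x) = - (LINT x|lebesgue_on \<Omega>. v x * \<phi> x))"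

definition H1 :: "'a::euclidean_space set \<Rightarrow> ('a \<Rightarrow> real) set" where
  "H1 \<Omega> = {u \<in> L2 \<Omega>. \<forall>e\<in>Basis. \<exists>v. L2_weak_deriv \<Omega> e u v}"

definition osc :: "(real \<Rightarrow> real) \<Rightarrow> real \<Rightarrow> real \<Rightarrow> real \<Rightarrow> real" where
  "osc G \<alpha> \<epsilon> x = G (x / \<epsilon> powr \<alpha>)"

definition osc_domain :: "real \<Rightarrow> (real \<Rightarrow> real) \<Rightarrow> real \<Rightarrow> real \<Rightarrow> (real \<times> real) set" where
  "osc_domain b G \<alpha> \<epsilon> = {(x1, x2). 0 < x1 \<and> x1 < 1 \<and> -b < x2 \<and> x2 < osc G \<alpha> \<epsilon> x1}"

definition vertical_integral ::
  "real \<Rightarrow> (real \<Rightarrow> real) \<Rightarrow> real \<Rightarrow> real \<Rightarrow> (real \<times> real \<Rightarrow> real) \<Rightarrow> real \<Rightarrow> real" where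
  "vertical_integral b G \<alpha> \<epsilon> F x = (LINT y|lebesgue_on {-b<..<osc G \<alpha> \<epsilon> x}. F (x, y))"

text \<open>Weak solutions of \<open>-\<partial>\<^sub>1\<^sub>1 u - \<epsilon>\<^sup>-\<^sup>2 \<partial>\<^sub>2\<^sub>2 u + u = f\<close> in \<open>\<Omega>\<close> with the (natural) conormal condition
  \<open>\<partial>\<^sub>1 u \<nu>\<^sub>1 + \<epsilon>\<^sup>-\<^sup>2 \<partial>\<^sub>2 u \<nu>\<^sub>2 = 0\<close> on the boundary.\<close>

definition weak_solution_2D ::
  "(real \<times> real) set \<Rightarrow> real \<Rightarrow> (real \<times> real \<Rightarrow> real) \<Rightarrow> (real \<times> real \<Rightarrow> real) \<Rightarrow> bool" where
  "weak_solution_2D \<Omega> \<epsilon> f u \<longleftrightarrow> u \<in> H1 \<Omega> \<and>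
     (\<exists>u1 u2. L2_weak_deriv \<Omega> (1, 0) u u1 \<and> L2_weak_deriv \<Omega> (0, 1) u u2 \<and>
       (\<forall>\<phi>\<in>H1 \<Omega>. \<forall>\<phi>1 \<phi>2. L2_weak_deriv \<Omega> (1, 0) \<phi> \<phi>1 \<longrightarrow> L2_weak_deriv \<Omega> (0, 1) \<phi> \<phi>2 \<longrightarrow>
          (LINT x|lebesgue_on \<Omega>. u1 x * \<phi>1 x + 1 / \<epsilon>\<^sup>2 * (u2 x * \<phi>2 x) + u x * \<phi> x)
            = (LINT x|lebesgue_on \<Omega>. f x * \<phi> x)))"

text \<open>Weak solutions of \<open>-d u'' + u = f\<close> in \<open>(0,1)\<close>, \<open>u'(0) = u'(1) = 0\<close>.\<close>

definition weak_solution_1D :: "real \<Rightarrow> (real \<Rightarrow> real) \<Rightarrow> (real \<Rightarrow> real) \<Rightarrow> bool" where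
  "weak_solution_1D d f u \<longleftrightarrow> u \<in> H1 {0<..<1} \<and>
     (\<exists>u'. L2_weak_deriv {0<..<1} 1 u u' \<and>
       (\<forall>\<phi>\<in>H1 {0<..<1}. \<forall>\<phi>'. L2_weak_deriv {0<..<1} 1 \<phi> \<phi>' \<longrightarrow>
          (LINT x|lebesgue_on {0<..<1}. d * (u' x * \<phi>' x) + u x * \<phi> x)
            = (LINT x|lebesgue_on {0<..<1}. f x * \<phi> x)))"

end

theory Submission
  imports Defs
begin

text \<open>
  The mean \<open>w\<close> of \<open>u\<^sup>\<epsilon>\<close> over the vertical segment from \<open>-b\<close> to \<open>0\<close> lies in \<open>H\<^sup>1(0,1)\<close>, and, as
  \<open>\<partial>\<^sub>2 u\<^sup>\<epsilon>\<close> is of order \<open>\<epsilon>\<close>, the Poincare inequality on columns shows that \<open>u\<^sup>\<epsilon> - w\<close> is of order \<open>\<epsilon>\<close> in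
  \<open>L\<^sup>2\<close>. Since \<open>G\<close> vanishes somewhere in each period, the part of the domain above \<open>x\<^sub>2 = 0\<close> falls apart
  into teeth of width \<open>l = \<epsilon>\<^sup>\<alpha> L\<close>. Given \<open>\<phi>\<close> in \<open>H\<^sup>1(0,1)\<close>, test the equation with the function that equals
  \<open>\<phi>(x\<^sub>1)\<close> for \<open>x\<^sub>2 \<le> 0\<close>, is constant on each tooth above height \<open>\<delta>\<close>, and interpolates linearly in between.
  The teeth then contribute to the first derivative term only up to height \<open>\<delta>\<close>, which costs \<open>\<surd>\<delta>\<close>, while
  the second derivative term is of order \<open>l / (\<epsilon> \<surd>\<delta>)\<close>. Both errors tend to \<open>0\<close> for \<open>\<delta> = \<epsilon>\<^sup>\<alpha>\<^sup>-\<^sup>1\<close>; this is where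
  \<open>\<alpha> > 1\<close> enters. Hence \<open>b \<integral>w'\<phi>' + \<integral>(b + G\<^sub>\<epsilon>) w \<phi> = \<integral>f\<^sub>\<epsilon> \<phi>\<close> up to an error that is small relative to
  the \<open>H\<^sup>1\<close> norm of \<open>\<phi>\<close>, where \<open>f\<^sub>\<epsilon>\<close> is the vertical integral of the source.

  Subtract the limit equation and take \<open>\<phi> = w - u\<close>. The data that remain converge weakly to \<open>0\<close>. Integrating
  by parts moves the derivative to \<open>\<phi>\<close> and replaces these data by their primitives, which converge to \<open>0\<close>
  strongly. So \<open>w\<close> converges to \<open>u\<close> in \<open>H\<^sup>1\<close>, and no compactness theorem is needed.
\<close>

section \<open>Smooth functions\<close>

text \<open>Openness of the domains is the only regularity of the boundary, so the estimates run
  along columns: every point is joined by its column to the strip below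
  \<open>x\<^sub>2 = 0\<close>, and a function is its strip mean up to vertical primitives.
  Horizontal flux survives only in the strip, while the whole column, of mean height p, carries the
  zero-order term and the source; dividing by p gives d = b / p. The error must be linear in the H1
  norm of \<phi> with constants free of \<phi>, since the \<phi> inserted at the end depends on
  \<epsilon>. The value of \<delta> balances the two tooth errors: for l = L \<epsilon>^\<alpha>
  both become multiples of the square root of \<epsilon>^(\<alpha>-1). In the zero-order term two
  factors, \<open>G\<^sub>\<epsilon>\<close> and w, vary with \<epsilon>. Writing w = u + (w - u)
  avoids a limit of such a product: \<open>G\<^sub>\<epsilon>\<close> times u has a fixed second
  factor and is treated as data, while (b + \<open>G\<^sub>\<epsilon>\<close>)(w - u)^2 >= b (w -
  u)^2 stays on the coercive side.\<close>

lemma Ck_SucI: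
  assumes "\<And>x. (\<phi> has_derivative D x) (at x)" and "\<And>e. e \<in> Basis \<Longrightarrow> Ck k (\<lambda>x. D x e)"
  shows "Ck (Suc k) \<phi>"
proof -
  have "frechet_derivative \<phi> (at x) = D x" for x
    using frechet_derivative_at[OF assms(1)] by simp
  then show ?thesis
    using assms by (auto simp: differentiable_def)
qed

lemma Ck_SucD:
  assumes "Ck (Suc k) \<phi>"
  shows "(\<phi> has_derivative frechet_derivative \<phi> (at x)) (at x)"
  using assms by (simp add: frechet_derivative_works)

lemma Ck_Suc_imp:
  assumes "Ck (Suc k) \<phi>"
  shows "Ck k \<phi>"
  using assms
proof (induction k arbitrary: \<phi>)
  case 0
  then have "\<phi> differentiable at x" for x
    by simp
  then show ?case
    by (auto intro!: continuous_at_imp_continuous_on differentiable_imp_continuous_within)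
next
  case (Suc k)
  have "Ck k (dir_deriv e \<phi>)" if "e \<in> Basis" for e
    using Suc.prems that by (intro Suc.IH) (simp only: Ck.simps, blast)
  moreover have "\<phi> differentiable at x" for x
    using Suc.prems by (simp only: Ck.simps)
  ultimately show ?case
    by (simp only: Ck.simps) blast
qed

lemma Ck_const: "Ck k (\<lambda>x. c)"
proof (induction k arbitrary: c)
  case (Suc k)
  show ?case
    by (rule Ck_SucI[where D = "\<lambda>_ _. 0"]) (auto simp: Suc)
qed simp

lemma Ck_add:
  assumes "Ck k \<phi>" "Ck k \<psi>"
  shows "Ck k (\<lambda>x. \<phi> x + \<psi> x)"
  using assms
proof (induction k arbitrary: \<phi> \<psi>)
  case (Suc k)
  show ?case
    using Suc.prems
    by (intro Ck_SucI[OF has_derivative_add[OF Suc.prems[THEN Ck_SucD]]] Suc.IH) auto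
qed (auto intro: continuous_intros)

lemma Ck_mult:
  assumes "Ck k \<phi>" "Ck k \<psi>"
  shows "Ck k (\<lambda>x. \<phi> x * \<psi> x)"
  using assms
proof (induction k arbitrary: \<phi> \<psi>)
  case (Suc k)
  show ?case
  proof (rule Ck_SucI[where D = "\<lambda>x e. \<phi> x * dir_deriv e \<psi> x + dir_deriv e \<phi> x * \<psi> x"])
    show "((\<lambda>x. \<phi> x * \<psi> x) has_derivative (\<lambda>e. \<phi> x * dir_deriv e \<psi> x + dir_deriv e \<phi> x * \<psi> x)) (at x)" for x
      using Suc.prems by (intro has_derivative_mult Ck_SucD)
    show "Ck k (\<lambda>x. \<phi> x * dir_deriv e \<psi> x + dir_deriv e \<phi> x * \<psi> x)" if "e \<in> Basis" for e
      using Suc.prems that by (intro Ck_add Suc.IH Ck_Suc_imp[OF Suc.prems(1)] Ck_Suc_imp[OF Suc.prems(2)]) auto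
  qed
qed (auto intro: continuous_intros)

lemma Ck_power:
  assumes "Ck k \<phi>"
  shows "Ck k (\<lambda>x. \<phi> x ^ n)"
  by (induction n) (simp_all add: Ck_const Ck_mult assms)

lemma Ck_diff:
  assumes "Ck k \<phi>" "Ck k \<psi>"
  shows "Ck k (\<lambda>x. \<phi> x - \<psi> x)"
  using Ck_add[OF assms(1) Ck_mult[OF Ck_const[of k "-1"] assms(2)]] by simp

lemma Ck_real_SucI:
  fixes \<phi> :: "real \<Rightarrow> real"
  assumes "\<And>x. (\<phi> has_real_derivative \<phi>' x) (at x)" "Ck k \<phi>'"
  shows "Ck (Suc k) \<phi>"
  by (rule Ck_SucI[where D = "\<lambda>x e. \<phi>' x * e"])
     (use assms in \<open>auto simp: has_field_derivative_def\<close>)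

lemma Ck_real_SucD:
  fixes \<phi> :: "real \<Rightarrow> real"
  assumes "Ck (Suc k) \<phi>"
  shows "(\<phi> has_real_derivative dir_deriv 1 \<phi> x) (at x)" "Ck k (dir_deriv 1 \<phi>)"
proof -
  interpret bounded_linear "frechet_derivative \<phi> (at x)"
    using Ck_SucD[OF assms] by (rule has_derivative_bounded_linear)
  have "frechet_derivative \<phi> (at x) = (*) (dir_deriv 1 \<phi> x)"
  proof
    show "frechet_derivative \<phi> (at x) e = dir_deriv 1 \<phi> x * e" for e
      using scale[of e 1] by (simp add: mult.commute)
  qed
  then show "(\<phi> has_real_derivative dir_deriv 1 \<phi> x) (at x)"
    unfolding has_field_derivative_def by (rule has_derivative_eq_rhs[OF Ck_SucD[OF assms]])
  show "Ck k (dir_deriv 1 \<phi>)"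
    using assms by (simp only: Ck.simps Basis_real_def ball_simps)
qed

lemma Ck_affine:
  fixes \<phi> :: "real \<Rightarrow> real"
  assumes "Ck k \<phi>"
  shows "Ck k (\<lambda>x. \<phi> (c * x + a))"
  using assms
proof (induction k arbitrary: \<phi>)
  case 0
  then show ?case
    by (auto intro!: continuous_on_compose2[of UNIV \<phi>] continuous_intros)
next
  case (Suc k)
  note D = Ck_real_SucD[OF Suc.prems]
  show ?case
  proof (rule Ck_real_SucI)
    show "((\<lambda>x. \<phi> (c * x + a)) has_real_derivative dir_deriv 1 \<phi> (c * x + a) * c) (at x)" for x
      by (rule DERIV_chain2[OF D(1)]) (auto intro!: derivative_eq_intros)
    show "Ck k (\<lambda>x. dir_deriv 1 \<phi> (c * x + a) * c)"
      by (intro Ck_mult Ck_const Suc.IH D(2))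
  qed
qed

lemma Basis_real_pair: "Basis = {(1, 0), (0, 1) :: real \<times> real}"
  by (auto simp: Basis_prod_def)

lemma has_derivative_fst_comp:
  fixes \<phi> :: "real \<Rightarrow> real"
  assumes "(\<phi> has_real_derivative d) (at (fst z))"
  shows "((\<lambda>z. \<phi> (fst z)) has_derivative (\<lambda>e. d * fst e)) (at (z :: real \<times> real))"
  using has_derivative_compose[OF has_derivative_fst[OF has_derivative_ident]] assms
  unfolding has_field_derivative_def by blast

lemma has_derivative_snd_comp:
  fixes \<phi> :: "real \<Rightarrow> real"
  assumes "(\<phi> has_real_derivative d) (at (snd z))"
  shows "((\<lambda>z. \<phi> (snd z)) has_derivative (\<lambda>e. d * snd e)) (at (z :: real \<times> real))"
  using has_derivative_compose[OF has_derivative_snd[OF has_derivative_ident]] assms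
  unfolding has_field_derivative_def by blast

lemma Ck_fst:
  fixes \<phi> :: "real \<Rightarrow> real"
  assumes "Ck k \<phi>"
  shows "Ck k (\<lambda>z :: real \<times> real. \<phi> (fst z))"
  using assms
proof (induction k arbitrary: \<phi>)
  case 0
  then show ?case
    by (auto intro!: continuous_on_compose2[of UNIV \<phi>] continuous_intros)
next
  case (Suc k)
  note D = Ck_real_SucD[OF Suc.prems]
  show ?case
    by (rule Ck_SucI[OF has_derivative_fst_comp[OF D(1)]])
       (auto simp: Basis_real_pair Ck_const Suc.IH[OF D(2)])
qed

lemma Ck_snd:
  fixes \<phi> :: "real \<Rightarrow> real"
  assumes "Ck k \<phi>"
  shows "Ck k (\<lambda>z :: real \<times> real. \<phi> (snd z))"
  using assms
proof (induction k arbitrary: \<phi>)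
  case 0
  then show ?case
    by (auto intro!: continuous_on_compose2[of UNIV \<phi>] continuous_intros)
next
  case (Suc k)
  note D = Ck_real_SucD[OF Suc.prems]
  show ?case
    by (rule Ck_SucI[OF has_derivative_snd_comp[OF D(1)]])
       (auto simp: Basis_real_pair Ck_const Suc.IH[OF D(2)])
qed

section \<open>Smooth cut-off functions on the line\<close>

definition flat :: "nat \<Rightarrow> real \<Rightarrow> real" where
  "flat n x = (if x > 0 then (1 / x) ^ n * exp (- (1 / x)) else 0)"

lemma flat_tendsto: "(flat n \<longlongrightarrow> 0) (at 0)"
proof -
  have "((\<lambda>x. (1 / x) ^ n / exp (1 / x)) \<longlongrightarrow> 0) (at_right (0::real))"
    using filterlim_compose[OF tendsto_power_div_exp_0 filterlim_inverse_at_top_right, of n]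
    by (simp add: divide_inverse)
  then have "(flat n \<longlongrightarrow> 0) (at_right 0)"
    by (rule Lim_transform_eventually)
       (auto simp: flat_def eventually_at_filter exp_minus divide_inverse)
  moreover have "(flat n \<longlongrightarrow> 0) (at_left 0)"
    by (rule tendsto_eventually) (auto simp: flat_def eventually_at_filter)
  ultimately show ?thesis
    by (simp add: filterlim_split_at)
qed

text \<open>The powers of 1/x are carried along because the family is then closed under
  differentiation up to linear combinations, so that smoothness of all orders follows by one
  induction on k, for all n at once. The cut-offs use only \<open>flat 0\<close>, that is
  exp(-1/x).\<close>

lemma flat_deriv: "(flat n has_real_derivative flat (n + 2) x - real n * flat (n + 1) x) (at x)"
proof (cases "x = 0")
  case True
  \<comment> \<open>At the origin the difference quotient is again a member of the family, so
    \<open>flat_tendsto\<close> gives the derivative 0.\<close>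
  have "(\<lambda>h. (flat n (0 + h) - flat n 0) / h) = flat (n + 1)"
    by (auto simp: flat_def fun_eq_iff)
  then show ?thesis
    using True flat_tendsto[of "n + 1"] by (simp add: DERIV_def flat_def)
next
  case False
  show ?thesis
  proof (cases "x > 0")
    case True
    have "((\<lambda>x. (1 / x) ^ n * exp (- (1 / x))) has_real_derivative
            flat (n + 2) x - real n * flat (n + 1) x) (at x)"
    proof -
      have D: "((\<lambda>x. 1 / x) has_real_derivative - ((1 / x)\<^sup>2)) (at x)"
        using True by (auto intro!: derivative_eq_intros simp: power2_eq_square)
      show ?thesis
        by (rule DERIV_cong[OF DERIV_mult[OF DERIV_power[OF D, of n] DERIV_fun_exp[OF DERIV_minus[OF D]]]])
           (use True in \<open>cases n; simp add: flat_def algebra_simps power2_eq_square\<close>)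
    qed
    then show ?thesis
      by (rule has_field_derivative_transform_within[where d = x]) (use True in \<open>auto simp: flat_def dist_real_def\<close>)
  next
    case neg: False
    have "((\<lambda>x. 0) has_real_derivative flat (n + 2) x - real n * flat (n + 1) x) (at x)"
      using neg by (auto simp: flat_def)
    then show ?thesis
      by (rule has_field_derivative_transform_within[where d = "- x"]) (use False neg in \<open>auto simp: flat_def dist_real_def\<close>)
  qed
qed

lemma Ck_flat: "Ck k (flat n)"
proof (induction k arbitrary: n)
  case 0
  show ?case
    using flat_deriv by (auto intro!: continuous_at_imp_continuous_on DERIV_isCont)
next
  case (Suc k)
  show ?case
    by (rule Ck_real_SucI[OF flat_deriv]) (intro Ck_diff Ck_mult Ck_const Suc)
qed

lemma flat_0_bounds: "0 \<le> flat 0 x" "flat 0 x < 1" "x > 0 \<Longrightarrow> flat 0 x > 0"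
  by (auto simp: flat_def)

lemma flat_0_mono: "x \<le> y \<Longrightarrow> flat 0 x \<le> flat 0 y"
  by (auto simp: flat_def field_simps)

lemma test_function_I:
  assumes "compact K" "K \<subseteq> \<Omega>" "\<And>x. x \<notin> K \<Longrightarrow> \<phi> x = 0" "\<And>k. Ck k \<phi>"
  shows "\<phi> \<in> test_functions \<Omega>"
proof -
  have "{x. \<phi> x \<noteq> 0} \<subseteq> K"
    using assms(3) by blast
  then have sub: "closure {x. \<phi> x \<noteq> 0} \<subseteq> K"
    by (rule closure_minimal[OF _ compact_imp_closed[OF assms(1)]])
  moreover have "compact (closure {x. \<phi> x \<noteq> 0})"
    using bounded_subset[OF compact_imp_bounded[OF assms(1)] sub]
    by (simp only: compact_eq_bounded_closed closed_closure simp_thms)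
  ultimately show ?thesis
    using assms(2,4) by (auto simp: test_functions_def)
qed

lemma test_function_real_I:
  fixes \<phi> :: "real \<Rightarrow> real"
  assumes "\<And>k. Ck k \<phi>" and "\<And>x. x \<notin> {a..b} \<Longrightarrow> \<phi> x = 0" and "{a..b} \<subseteq> \<Omega>"
  shows "\<phi> \<in> test_functions \<Omega>"
  using assms by (intro test_function_I[of "{a..b}"]) auto

lemma test_function_supp:
  assumes "\<phi> \<in> test_functions \<Omega>"
  obtains K where "compact K" "K \<subseteq> \<Omega>" "\<phi> \<in> test_functions K"
  using assms that[of "closure {x. \<phi> x \<noteq> 0}"] by (auto simp: test_functions_def)

text \<open>A product of two shifted copies of \<open>flat 0\<close>, one of them reflected, is
  smooth, has values in [0, 1] and is positive exactly on an interval slightly inside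
  \<open>{s<..<t}\<close>. The map y |-> 1 - (1 - y)^n fixes 0 and drives values bounded away from 0
  to 1, which produces the plateau.\<close>

lemma test_functions_approx_indicator:
  fixes s t :: real
  obtains \<theta> :: "nat \<Rightarrow> real \<Rightarrow> real" where
    "\<And>n. \<theta> n \<in> test_functions {s<..<t}" "\<And>n x. 0 \<le> \<theta> n x" "\<And>n x. \<theta> n x \<le> 1"
    "\<And>x. (\<lambda>n. \<theta> n x) \<longlonglongrightarrow> indicator {s<..<t} x"
proof -
  \<comment> \<open>The margin keeps the support a compact subset of the open interval; it shrinks
    to 0, so every inner point is eventually reached.\<close>
  define \<delta> :: "nat \<Rightarrow> real" where "\<delta> n = inverse (real (Suc n))" for n
  define y where "y n x = flat 0 (1 * x + (- s - \<delta> n)) * flat 0 ((-1) * x + (t - \<delta> n))" for n x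
  define \<theta> where "\<theta> n x = 1 - (1 - y n x) ^ n" for n x
  have y: "0 \<le> y n x" "y n x \<le> 1" for n x
    using flat_0_bounds[of "1 * x + (- s - \<delta> n)"] flat_0_bounds[of "(-1) * x + (t - \<delta> n)"]
    by (auto simp: y_def intro!: mult_le_one)
  have zero: "y n x = 0" if "x \<notin> {s + \<delta> n..t - \<delta> n}" for n x
    using that by (auto simp: y_def flat_def)
  have \<delta>: "\<delta> n > 0" for n
    by (auto simp: \<delta>_def)
  show ?thesis
  proof
    show "\<theta> n \<in> test_functions {s<..<t}" for n
    proof (rule test_function_real_I)
      show "Ck k (\<theta> n)" for k
        unfolding \<theta>_def y_def by (intro Ck_diff Ck_power Ck_mult Ck_const Ck_affine Ck_flat)
      show "\<theta> n x = 0" if "x \<notin> {s + \<delta> n..t - \<delta> n}" for x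
        using zero[OF that] by (simp add: \<theta>_def)
      show "{s + \<delta> n..t - \<delta> n} \<subseteq> {s<..<t}"
        using \<delta>[of n] by auto
    qed
    show "0 \<le> \<theta> n x" "\<theta> n x \<le> 1" for n x
      using y[of n x] by (auto simp: \<theta>_def power_le_one)
    show "(\<lambda>n. \<theta> n x) \<longlonglongrightarrow> indicator {s<..<t} x" for x
    proof (cases "x \<in> {s<..<t}")
      case False
      then have "y n x = 0" for n
        using \<delta>[of n] by (intro zero) auto
      then show ?thesis
        using False by (simp add: \<theta>_def)
    next
      case True
      \<comment> \<open>Once the margin is below half the distance of x to either end, monotonicity
        of \<open>flat 0\<close> bounds \<open>y n x\<close> from below by this constant, and the
        convergence is geometric.\<close>
      define c where "c = flat 0 ((x - s) / 2) * flat 0 ((t - x) / 2)"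
      have c: "0 < c" "c \<le> 1"
        using True flat_0_bounds[of "(x - s) / 2"] flat_0_bounds[of "(t - x) / 2"]
        by (auto simp: c_def intro!: mult_le_one)
      have "\<delta> \<longlonglongrightarrow> 0"
        unfolding \<delta>_def by (rule LIMSEQ_inverse_real_of_nat)
      then have "\<forall>\<^sub>F n in sequentially. \<delta> n < (x - s) / 2" "\<forall>\<^sub>F n in sequentially. \<delta> n < (t - x) / 2"
        using True by (auto intro!: order_tendstoD(2) simp del: less_divide_eq_numeral1)
      then have "\<forall>\<^sub>F n in sequentially. norm (1 - \<theta> n x) \<le> (1 - c) ^ n"
      proof eventually_elim
        case (elim n)
        have "c \<le> y n x"
          unfolding c_def y_def using elim
          by (intro mult_mono flat_0_mono flat_0_bounds) (auto simp: field_simps)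
        then show ?case
          using y[of n x] by (auto simp: \<theta>_def power_le_one intro!: power_mono)
      qed
      moreover have "(\<lambda>n. (1 - c) ^ n) \<longlonglongrightarrow> 0"
        using c by (intro LIMSEQ_power_zero) auto
      ultimately have "(\<lambda>n. 1 - \<theta> n x) \<longlonglongrightarrow> 0"
        by (rule Lim_null_comparison)
      from tendsto_diff[OF tendsto_const[of 1] this] show ?thesis
        using True by simp
    qed
  qed
qed

lemma test_functionD:
  assumes "\<phi> \<in> test_functions \<Omega>"
  shows test_function_Ck: "Ck k \<phi>"
    and test_function_continuous: "continuous_on UNIV \<phi>"
    and test_function_zero: "x \<notin> \<Omega> \<Longrightarrow> \<phi> x = 0"
    and test_function_dir_deriv_zero: "x \<notin> \<Omega> \<Longrightarrow> dir_deriv e \<phi> x = 0"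
    and test_function_bounded: "\<exists>B. \<forall>x. \<bar>\<phi> x\<bar> \<le> B"
proof -
  define K where "K = closure {x. \<phi> x \<noteq> 0}"
  have K: "compact K" "K \<subseteq> \<Omega>" and Ck: "Ck k \<phi>" for k
    using assms by (auto simp: test_functions_def K_def)
  show "Ck k \<phi>" by fact
  show cont: "continuous_on UNIV \<phi>"
    using Ck[of 0] by simp
  have 0: "\<phi> x = 0" if "x \<notin> K" for x
    using that closure_subset[of "{x. \<phi> x \<noteq> 0}"] by (auto simp: K_def)
  then show "x \<notin> \<Omega> \<Longrightarrow> \<phi> x = 0"
    using K by auto
  show "dir_deriv e \<phi> x = 0" if "x \<notin> \<Omega>"
  proof -
    have "(\<phi> has_derivative (\<lambda>_. 0)) (at x)"
      by (rule has_derivative_transform_within_open[of "\<lambda>_. 0" _ _ _ "- K"])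
         (use that K 0 in \<open>auto intro: compact_imp_closed\<close>)
    from frechet_derivative_at[OF this] show ?thesis
      by metis
  qed
  have "bounded (\<phi> ` K)"
    using K cont by (intro compact_imp_bounded compact_continuous_image continuous_on_subset[OF cont]) auto
  then obtain B where "\<forall>x\<in>K. \<bar>\<phi> x\<bar> \<le> B"
    by (auto simp: bounded_iff)
  then have "\<forall>x. \<bar>\<phi> x\<bar> \<le> max B 0"
    using 0 by (metis abs_zero max.cobounded2 max.coboundedI1)
  then show "\<exists>B. \<forall>x. \<bar>\<phi> x\<bar> \<le> B" ..
qed

lemma test_function_dir_deriv:
  assumes "\<phi> \<in> test_functions \<Omega>" "e \<in> Basis"
  shows "dir_deriv e \<phi> \<in> test_functions \<Omega>"
proof -
  obtain K where K: "compact K" "K \<subseteq> \<Omega>" "\<phi> \<in> test_functions K"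
    using assms(1) by (rule test_function_supp)
  show ?thesis
  proof (rule test_function_I[OF K(1,2)])
    show "dir_deriv e \<phi> x = 0" if "x \<notin> K" for x
      using test_function_dir_deriv_zero[OF K(3) that] .
    show "Ck k (dir_deriv e \<phi>)" for k
      using test_function_Ck[OF assms(1), of "Suc k"] assms(2) by simp
  qed
qed

lemma test_function_measurable: "\<phi> \<in> test_functions \<Omega> \<Longrightarrow> \<phi> \<in> borel_measurable borel"
  by (intro borel_measurable_continuous_onI test_function_continuous)

lemma test_functions_mono: "\<phi> \<in> test_functions \<Omega> \<Longrightarrow> \<Omega> \<subseteq> \<Omega>' \<Longrightarrow> \<phi> \<in> test_functions \<Omega>'"
  by (auto simp: test_functions_def)

lemma test_function_pair:
  fixes \<phi> \<psi> :: "real \<Rightarrow> real"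
  assumes "\<phi> \<in> test_functions A" "\<psi> \<in> test_functions B" "A \<times> B \<subseteq> \<Omega>"
  shows "(\<lambda>z. \<phi> (fst z) * \<psi> (snd z)) \<in> test_functions \<Omega>"
    and "dir_deriv (1, 0) (\<lambda>z. \<phi> (fst z) * \<psi> (snd z)) z = dir_deriv 1 \<phi> (fst z) * \<psi> (snd z)"
    and "dir_deriv (0, 1) (\<lambda>z. \<phi> (fst z) * \<psi> (snd z)) z = \<phi> (fst z) * dir_deriv 1 \<psi> (snd z)"
proof -
  obtain K K' where K: "compact K" "K \<subseteq> A" "\<phi> \<in> test_functions K" "compact K'" "K' \<subseteq> B" "\<psi> \<in> test_functions K'"
    using test_function_supp[OF assms(1)] test_function_supp[OF assms(2)] by metis
  show "(\<lambda>z. \<phi> (fst z) * \<psi> (snd z)) \<in> test_functions \<Omega>"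
  proof (rule test_function_I)
    show "compact (K \<times> K')"
      by (rule compact_Times[OF K(1,4)])
    show "K \<times> K' \<subseteq> \<Omega>"
      using K(2,5) assms(3) by blast
    show "\<phi> (fst z) * \<psi> (snd z) = 0" if "z \<notin> K \<times> K'" for z
      using that test_function_zero[OF K(3), of "fst z"] test_function_zero[OF K(6), of "snd z"]
      by (cases "fst z \<in> K") (auto simp: mem_Times_iff)
    show "Ck k (\<lambda>z. \<phi> (fst z) * \<psi> (snd z))" for k
      by (rule Ck_mult[OF Ck_fst[OF test_function_Ck[OF assms(1)]] Ck_snd[OF test_function_Ck[OF assms(2)]]])
  qed
  have "((\<lambda>z. \<phi> (fst z) * \<psi> (snd z)) has_derivative
      (\<lambda>e. \<phi> (fst z) * (dir_deriv 1 \<psi> (snd z) * snd e) + dir_deriv 1 \<phi> (fst z) * fst e * \<psi> (snd z))) (at z)"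
    by (rule has_derivative_mult[OF
        has_derivative_fst_comp[OF Ck_real_SucD(1)[OF test_function_Ck[OF assms(1)]]]
        has_derivative_snd_comp[OF Ck_real_SucD(1)[OF test_function_Ck[OF assms(2)]]]])
  note D = frechet_derivative_at[OF this, symmetric]
  show "dir_deriv (1, 0) (\<lambda>z. \<phi> (fst z) * \<psi> (snd z)) z = dir_deriv 1 \<phi> (fst z) * \<psi> (snd z)"
    "dir_deriv (0, 1) (\<lambda>z. \<phi> (fst z) * \<psi> (snd z)) z = \<phi> (fst z) * dir_deriv 1 \<psi> (snd z)"
    unfolding D by simp_all
qed

section \<open>Square-integrable functions\<close>

text \<open>Elements of \<open>L2\<close> are measurable for the completed measure and matter only
  on the domain. The proof works with Borel functions on the whole space, set to zero off the
  domain, so that Fubini and slicing apply to \<open>lborel\<close> directly;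
  \<open>borel_rep\<close> is the link between the two.\<close>

definition sq_int :: "('a::euclidean_space \<Rightarrow> real) \<Rightarrow> bool" where
  "sq_int f \<longleftrightarrow> f \<in> borel_measurable borel \<and> integrable lborel (\<lambda>x. (f x)\<^sup>2)"

definition l2 :: "('a::euclidean_space \<Rightarrow> real) \<Rightarrow> real" where
  "l2 f = sqrt (LBINT x. (f x)\<^sup>2)"

lemma sq_intD:
  assumes "sq_int f"
  shows "f \<in> borel_measurable borel" "f \<in> borel_measurable lborel" "integrable lborel (\<lambda>x. (f x)\<^sup>2)"
  using assms by (auto simp: sq_int_def)

lemma integrable_bounded_by:
  fixes f :: "'a::euclidean_space \<Rightarrow> real"
  assumes "integrable lborel g" "f \<in> borel_measurable borel" "\<And>x. \<bar>f x\<bar> \<le> g x"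
  shows "integrable lborel f"
  by (rule Bochner_Integration.integrable_bound[OF assms(1)])
     (use assms in \<open>auto intro: order_trans[OF assms(3) abs_ge_self]\<close>)

lemma integrable_mult_bounded:
  fixes h m :: "'a::euclidean_space \<Rightarrow> real"
  assumes "integrable lborel h" "m \<in> borel_measurable borel" "\<And>x. \<bar>m x\<bar> \<le> B"
  shows "integrable lborel (\<lambda>x. h x * m x)"
proof (rule integrable_bounded_by)
  show "integrable lborel (\<lambda>x. B * \<bar>h x\<bar>)"
    using assms(1) by auto
  show "\<bar>h x * m x\<bar> \<le> B * \<bar>h x\<bar>" for x
    using mult_left_mono[OF assms(3)[of x], of "\<bar>h x\<bar>"] by (simp add: abs_mult mult.commute)
qed (use assms in auto)

lemma sq_int_mult_integrable:
  assumes "sq_int f" "sq_int g"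
  shows "integrable lborel (\<lambda>x. f x * g x)"
proof (rule integrable_bounded_by)
  show "integrable lborel (\<lambda>x. (f x)\<^sup>2 + (g x)\<^sup>2)"
    using assms by (auto simp: sq_int_def)
  show "(\<lambda>x. f x * g x) \<in> borel_measurable borel"
    using assms by (auto simp: sq_int_def)
  show "\<bar>f x * g x\<bar> \<le> (f x)\<^sup>2 + (g x)\<^sup>2" for x
    using sum_squares_bound[of "\<bar>f x\<bar>" "\<bar>g x\<bar>"] mult_nonneg_nonneg[of "\<bar>f x\<bar>" "\<bar>g x\<bar>"]
    unfolding abs_mult power2_abs by linarith
qed

lemma sq_int_bounded_mult:
  assumes "sq_int f" "h \<in> borel_measurable borel" "\<And>x. \<bar>h x\<bar> \<le> B"
  shows "sq_int (\<lambda>x. h x * f x)"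
  unfolding sq_int_def
proof
  have [measurable]: "f \<in> borel_measurable borel" "h \<in> borel_measurable borel"
    using assms by (auto simp: sq_int_def)
  show "(\<lambda>x. h x * f x) \<in> borel_measurable borel"
    by measurable
  show "integrable lborel (\<lambda>x. (h x * f x)\<^sup>2)"
  proof (rule integrable_bounded_by)
    show "integrable lborel (\<lambda>x. B\<^sup>2 * (f x)\<^sup>2)"
      using assms by (simp add: sq_int_def)
    show "\<bar>(h x * f x)\<^sup>2\<bar> \<le> B\<^sup>2 * (f x)\<^sup>2" for x
      using power_mono[OF assms(3) abs_ge_zero, of x 2]
      by (simp add: power_mult_distrib mult_right_mono)
  qed measurable
qed

lemma sq_int_cmult: "sq_int f \<Longrightarrow> sq_int (\<lambda>x. c * f x)"
  by (rule sq_int_bounded_mult[where B = "\<bar>c\<bar>"]) auto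

lemma sq_int_add:
  assumes "sq_int f" "sq_int g"
  shows "sq_int (\<lambda>x. f x + g x)"
proof -
  have "integrable lborel (\<lambda>x. (f x)\<^sup>2 + 2 * (f x * g x) + (g x)\<^sup>2)"
    using sq_int_mult_integrable[OF assms] assms by (auto simp: sq_int_def)
  then show ?thesis
    using assms by (auto simp: sq_int_def power2_sum algebra_simps)
qed

lemma sq_int_diff: "sq_int f \<Longrightarrow> sq_int g \<Longrightarrow> sq_int (\<lambda>x. f x - g x)"
  using sq_int_add[of f "\<lambda>x. - 1 * g x"] sq_int_cmult[of g "- 1"] by simp

lemma sq_int_bounded_supp:
  assumes "h \<in> borel_measurable borel" "\<And>x. \<bar>h x\<bar> \<le> B * indicator A x" "A \<in> fmeasurable lborel"
  shows "sq_int h"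
  unfolding sq_int_def
proof
  show "integrable lborel (\<lambda>x. (h x)\<^sup>2)"
  proof (rule integrable_bounded_by)
    show "integrable lborel (\<lambda>x. B\<^sup>2 * indicator A x)"
      using assms(3) by (simp add: fmeasurable_def)
    show "\<bar>(h x)\<^sup>2\<bar> \<le> B\<^sup>2 * indicator A x" for x
      using power_mono[OF assms(2) abs_ge_zero, of x 2]
      by (auto simp: power_mult_distrib indicator_def split: if_splits)
  qed (use assms in auto)
qed (use assms in auto)

lemma sq_int_indicator: "A \<in> fmeasurable lborel \<Longrightarrow> sq_int (indicator A)"
  by (rule sq_int_bounded_supp[where B = 1]) (auto simp: fmeasurable_def)

lemma l2_nonneg: "0 \<le> l2 f"
  by (simp add: l2_def integral_nonneg_AE)

lemma l2_square: "(l2 f)\<^sup>2 = (LBINT x. (f x)\<^sup>2)"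
  by (simp add: l2_def integral_nonneg_AE)

text \<open>The integral of the square of f - t g is a quadratic polynomial in t without negative
  values.\<close>

lemma Cauchy_Schwarz_l2:
  assumes "sq_int f" "sq_int g"
  shows "\<bar>LBINT x. f x * g x\<bar> \<le> l2 f * l2 g"
proof -
  define A B C where "A = (LBINT x. (f x)\<^sup>2)" and "B = (LBINT x. f x * g x)"
    and "C = (LBINT x. (g x)\<^sup>2)"
  have "0 \<le> A - 2 * t * B + t\<^sup>2 * C" for t
  proof -
    have "0 \<le> (LBINT x. (f x - t * g x)\<^sup>2)"
      by (simp add: integral_nonneg_AE)
    also have "\<dots> = (LBINT x. (f x)\<^sup>2 - 2 * t * (f x * g x) + t\<^sup>2 * (g x)\<^sup>2)"
      by (simp add: power2_diff power_mult_distrib algebra_simps)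
    also have "\<dots> = A - 2 * t * B + t\<^sup>2 * C"
      using sq_int_mult_integrable[OF assms] assms by (simp add: sq_int_def A_def B_def C_def)
    finally show ?thesis .
  qed
  note quad = this
  have "B\<^sup>2 \<le> A * C"
  proof (cases "C = 0")
    case True
    have "B = 0"
    proof (rule ccontr)
      assume "B \<noteq> 0"
      \<comment> \<open>With C = 0 the polynomial is affine, and this t would give it the value
        -1.\<close>
      then show False
        using quad[of "(A + 1) / (2 * B)"] True by (simp add: field_simps)
    qed
    then show ?thesis
      using True by simp
  next
    case False
    then have "C > 0"
      by (simp add: C_def order_less_le integral_nonneg_AE)
    then show ?thesis
      using quad[of "B / C"] by (simp add: field_simps power2_eq_square)
  qed
  then have "sqrt (B\<^sup>2) \<le> sqrt (A * C)"
    by (rule real_sqrt_le_mono)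
  then show ?thesis
    by (simp add: l2_def A_def B_def C_def real_sqrt_mult)
qed

lemma l2_mono:
  assumes "sq_int g" "f \<in> borel_measurable borel" "\<And>x. \<bar>f x\<bar> \<le> \<bar>g x\<bar>"
  shows "sq_int f" "l2 f \<le> l2 g"
proof -
  have le: "(f x)\<^sup>2 \<le> (g x)\<^sup>2" for x
    using assms(3)[of x] by (simp add: abs_le_square_iff)
  show "sq_int f"
    unfolding sq_int_def
    by (intro conjI assms integrable_bounded_by[OF sq_intD(3)[OF assms(1)]]) (use assms le in auto)
  then show "l2 f \<le> l2 g"
    unfolding l2_def using le assms by (intro real_sqrt_le_mono integral_mono) (auto simp: sq_int_def)
qed

lemma l2_cmult: "l2 (\<lambda>x. c * f x) = \<bar>c\<bar> * l2 f"
  by (simp add: l2_def power_mult_distrib real_sqrt_mult)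

lemma l2_triangle:
  assumes "sq_int f" "sq_int g"
  shows "l2 (\<lambda>x. f x + g x) \<le> l2 f + l2 g"
proof (rule power2_le_imp_le)
  have "(l2 (\<lambda>x. f x + g x))\<^sup>2 = (LBINT x. (f x)\<^sup>2 + 2 * (f x * g x) + (g x)\<^sup>2)"
    unfolding l2_square by (simp add: power2_sum algebra_simps)
  also have "\<dots> = (l2 f)\<^sup>2 + 2 * (LBINT x. f x * g x) + (l2 g)\<^sup>2"
    using sq_int_mult_integrable[OF assms] assms by (simp add: sq_int_def l2_square)
  also have "\<dots> \<le> (l2 f + l2 g)\<^sup>2"
    using Cauchy_Schwarz_l2[OF assms] by (simp add: power2_sum)
  finally show "(l2 (\<lambda>x. f x + g x))\<^sup>2 \<le> (l2 f + l2 g)\<^sup>2" .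
qed (simp add: l2_nonneg)

lemma sq_int_integrable:
  assumes "sq_int f" "\<And>x. x \<notin> A \<Longrightarrow> f x = 0" "A \<in> fmeasurable lborel"
  shows "integrable lborel f"
proof -
  have "f = (\<lambda>x. f x * indicator A x)"
    using assms(2) by (auto simp: fun_eq_iff indicator_def)
  then show ?thesis
    using sq_int_mult_integrable[OF assms(1) sq_int_indicator[OF assms(3)]] by simp
qed

subsection \<open>Borel representatives\<close>

definition borel_rep :: "'a::euclidean_space set \<Rightarrow> ('a \<Rightarrow> real) \<Rightarrow> ('a \<Rightarrow> real) \<Rightarrow> bool" where
  "borel_rep \<Omega> u v \<longleftrightarrow> sq_int v \<and> (\<forall>x. x \<notin> \<Omega> \<longrightarrow> v x = 0) \<and> (AE x in lborel. x \<in> \<Omega> \<longrightarrow> u x = v x)"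

lemma AE_lebesgue_on_iff:
  assumes "\<Omega> \<in> sets borel"
  shows "(AE x in lebesgue_on \<Omega>. P x) \<longleftrightarrow> (AE x in lborel. x \<in> \<Omega> \<longrightarrow> P x)"
  using assms by (subst AE_restrict_space_iff) (simp_all only: AE_completion_iff, auto)

lemma lebesgue_on_AE_eq:
  fixes F F' :: "'a::euclidean_space \<Rightarrow> real"
  assumes "\<Omega> \<in> sets borel" "F' \<in> borel_measurable borel" "\<And>x. x \<notin> \<Omega> \<Longrightarrow> F' x = 0"
    and ae: "AE x in lborel. x \<in> \<Omega> \<longrightarrow> F x = F' x"
  shows measurable_lebesgue_on_AE_eq: "F \<in> borel_measurable (lebesgue_on \<Omega>)"
    and integrable_lebesgue_on_AE_eq: "integrable (lebesgue_on \<Omega>) F \<longleftrightarrow> integrable lborel F'"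
    and integral_lebesgue_on_AE_eq: "(LINT x|lebesgue_on \<Omega>. F x) = (LBINT x. F' x)"
proof -
  let ?F = "\<lambda>x. if x \<in> \<Omega> then F x else 0"
  have \<Omega>: "\<Omega> \<in> sets lebesgue"
    using assms(1) by simp
  have F': "F' \<in> borel_measurable lebesgue"
    using assms(2) by (simp add: measurable_completion)
  have ae': "AE x in lebesgue. F' x = ?F x"
    unfolding AE_completion_iff using ae by eventually_elim (use assms(3) in auto)
  from borel_measurable_AE[OF F' ae'] have F: "?F \<in> borel_measurable lebesgue" .
  then show "F \<in> borel_measurable (lebesgue_on \<Omega>)"
    using borel_measurable_if[OF \<Omega>] by blast
  have "integrable lebesgue ?F \<longleftrightarrow> integrable lebesgue F'"
    using F F' ae' by (intro integrable_cong_AE) auto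
  then show "integrable (lebesgue_on \<Omega>) F \<longleftrightarrow> integrable lborel F'"
    using assms(2) by (simp add: Lebesgue_Measure.integrable_restrict_UNIV[OF \<Omega>] integrable_completion)
  have "(LINT x|lebesgue. ?F x) = (LINT x|lebesgue. F' x)"
    using F F' ae' by (intro integral_cong_AE) auto
  then show "(LINT x|lebesgue_on \<Omega>. F x) = (LBINT x. F' x)"
    using assms(2) by (simp add: Lebesgue_Measure.integral_restrict_UNIV[OF \<Omega>] integral_completion)
qed

lemma borel_repD:
  assumes "borel_rep \<Omega> u v"
  shows "sq_int v" "x \<notin> \<Omega> \<Longrightarrow> v x = 0" "AE x in lborel. x \<in> \<Omega> \<longrightarrow> u x = v x"
  using assms by (auto simp: borel_rep_def)

lemma borel_rep_self: "sq_int v \<Longrightarrow> (\<And>x. x \<notin> \<Omega> \<Longrightarrow> v x = 0) \<Longrightarrow> borel_rep \<Omega> v v"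
  by (simp add: borel_rep_def)

lemma borel_rep_imp_L2:
  assumes "\<Omega> \<in> sets borel" "borel_rep \<Omega> u v"
  shows "u \<in> L2 \<Omega>" "L2_norm \<Omega> u = l2 v"
proof -
  have v: "v \<in> borel_measurable borel" "(\<lambda>x. (v x)\<^sup>2) \<in> borel_measurable borel"
    using borel_repD(1)[OF assms(2)] by (auto simp: sq_int_def)
  have ae: "AE x in lborel. x \<in> \<Omega> \<longrightarrow> (u x)\<^sup>2 = (v x)\<^sup>2"
    using borel_repD(3)[OF assms(2)] by eventually_elim auto
  show "u \<in> L2 \<Omega>"
    using measurable_lebesgue_on_AE_eq[OF assms(1) v(1) _ borel_repD(3)[OF assms(2)]]
      integrable_lebesgue_on_AE_eq[OF assms(1) v(2) _ ae] borel_repD(1,2)[OF assms(2)]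
    by (auto simp: L2_def sq_int_def)
  show "L2_norm \<Omega> u = l2 v"
    using integral_lebesgue_on_AE_eq[OF assms(1) v(2) _ ae] borel_repD(2)[OF assms(2)]
    by (auto simp: L2_norm_def l2_def)
qed

lemma L2_borel_rep:
  assumes "\<Omega> \<in> sets borel" "u \<in> L2 \<Omega>"
  obtains v where "borel_rep \<Omega> u v"
proof -
  let ?u = "\<lambda>x. if x \<in> \<Omega> then u x else 0"
  have "?u \<in> borel_measurable lebesgue"
    using assms by (subst borel_measurable_if) (auto simp: L2_def)
  then obtain w where w: "w \<in> borel_measurable lborel" "AE x in lborel. ?u x = w x"
    using completion_ex_borel_measurable_real by blast
  define v where "v = (\<lambda>x. indicator \<Omega> x * w x)"
  have v: "v \<in> borel_measurable borel" "\<And>x. x \<notin> \<Omega> \<Longrightarrow> v x = 0"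
    using w assms(1) by (auto simp: v_def)
  have ae: "AE x in lborel. x \<in> \<Omega> \<longrightarrow> u x = v x"
    using w(2) by eventually_elim (auto simp: v_def)
  then have ae2: "AE x in lborel. x \<in> \<Omega> \<longrightarrow> (u x)\<^sup>2 = (v x)\<^sup>2"
    by eventually_elim auto
  have "integrable lborel (\<lambda>x. (v x)\<^sup>2)"
    using assms(2) integrable_lebesgue_on_AE_eq[OF assms(1) _ _ ae2] v by (auto simp: L2_def)
  then show ?thesis
    using that[of v] v ae by (auto simp: borel_rep_def sq_int_def)
qed

lemma L2_weak_deriv_borel_rep:
  assumes "\<Omega> \<in> sets borel" "borel_rep \<Omega> u u'" "borel_rep \<Omega> v v'" "e \<in> Basis"
  shows "L2_weak_deriv \<Omega> e u v \<longleftrightarrow>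
    (\<forall>\<phi>\<in>test_functions \<Omega>. (LBINT x. u' x * dir_deriv e \<phi> x) = - (LBINT x. v' x * \<phi> x))"
proof -
  have *: "(LINT x|lebesgue_on \<Omega>. u x * \<phi> x) = (LBINT x. u' x * \<phi> x)"
    if "\<phi> \<in> borel_measurable borel" "borel_rep \<Omega> u u'" for \<phi> u u'
  proof (rule integral_lebesgue_on_AE_eq[OF assms(1)])
    show "AE x in lborel. x \<in> \<Omega> \<longrightarrow> u x * \<phi> x = u' x * \<phi> x"
      using borel_repD(3)[OF that(2)] by eventually_elim auto
  qed (use that borel_repD[OF that(2)] in \<open>auto simp: sq_int_def\<close>)
  have "(LINT x|lebesgue_on \<Omega>. u x * dir_deriv e \<phi> x) = (LBINT x. u' x * dir_deriv e \<phi> x)"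
    "(LINT x|lebesgue_on \<Omega>. v x * \<phi> x) = (LBINT x. v' x * \<phi> x)"
    if "\<phi> \<in> test_functions \<Omega>" for \<phi>
    using * assms that test_function_measurable test_function_dir_deriv by blast+
  then show ?thesis
    using borel_rep_imp_L2(1)[OF assms(1)] assms by (auto simp: L2_weak_deriv_def)
qed

subsection \<open>Integrals over boxes determine a function\<close>

text \<open>The positive and the negative part of h are densities of two measures that agree on
  boxes. Boxes form an intersection-stable generator, so the measures agree, and with them the
  densities almost everywhere.\<close>

lemma AE_zero_if_box_integrals_zero:
  fixes h :: "'a::euclidean_space \<Rightarrow> real"
  assumes h: "integrable lborel h"
    and zero: "\<And>a b. (LBINT x. h x * indicator (box a b) x) = 0"
  shows "AE x in lborel. h x = 0"
proof -
  have [measurable]: "h \<in> borel_measurable borel"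
    using h by auto
  define p n where "p x = max (h x) 0" and "n x = max (- h x) 0" for x
  have hpn: "h x = p x - n x" for x
    by (auto simp: p_def n_def)
  have [measurable]: "p \<in> borel_measurable borel" "n \<in> borel_measurable borel"
    by (auto simp: p_def[abs_def] n_def[abs_def])
  have p: "integrable lborel p" and n: "integrable lborel n"
    using h by (auto simp: p_def[abs_def] n_def[abs_def])
  have pA: "integrable lborel (\<lambda>x. p x * indicator A x)" and nA: "integrable lborel (\<lambda>x. n x * indicator A x)"
    if "A \<in> sets borel" for A
    using that integrable_mult_indicator[OF _ p, of A] integrable_mult_indicator[OF _ n, of A]
    by (simp_all add: mult.commute)
  have em: "emeasure (density lborel (\<lambda>x. ennreal (p x))) A = ennreal (LBINT x. p x * indicator A x)"
    "emeasure (density lborel (\<lambda>x. ennreal (n x))) A = ennreal (LBINT x. n x * indicator A x)"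
    if "A \<in> sets borel" for A
    using that pA[OF that] nA[OF that]
    by (subst emeasure_density, auto simp: p_def n_def nn_integral_eq_integral[symmetric] ennreal_mult'' ennreal_indicator[symmetric])+
  have eq: "density lborel (\<lambda>x. ennreal (p x)) = density lborel (\<lambda>x. ennreal (n x))"
  proof (rule measure_eqI_generator_eq)
    let ?E = "range (\<lambda>(a, b). box a b :: 'a set)"
    show "Int_stable ?E"
      by (auto simp: Int_stable_def box_Int_box)
    show "?E \<subseteq> Pow UNIV" "sets (density lborel (\<lambda>x. ennreal (p x))) = sigma_sets UNIV ?E"
      "sets (density lborel (\<lambda>x. ennreal (n x))) = sigma_sets UNIV ?E"
      by (simp_all add: borel_eq_box)
    let ?A = "\<lambda>n::nat. box (- (real n *\<^sub>R One)) (real n *\<^sub>R One) :: 'a set"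
    show "range ?A \<subseteq> ?E" "(\<Union>i. ?A i) = UNIV"
      unfolding UN_box_eq_UNIV by auto
    show "emeasure (density lborel (\<lambda>x. ennreal (p x))) (?A i) \<noteq> \<infinity>" for i
      by (simp add: em)
    show "emeasure (density lborel (\<lambda>x. ennreal (p x))) X = emeasure (density lborel (\<lambda>x. ennreal (n x))) X"
      if "X \<in> ?E" for X
    proof -
      from that obtain a b where X: "X = box a b"
        by auto
      have "(LBINT x. p x * indicator X x) - (LBINT x. n x * indicator X x) = 0"
        using zero[of a b] pA[of X] nA[of X]
        by (simp add: X hpn left_diff_distrib flip: Bochner_Integration.integral_diff)
      then show ?thesis
        by (simp add: em X)
    qed
  qed
  have "AE x in lborel. ennreal (p x) = ennreal (n x)"
    by (rule sigma_finite_measure.density_unique[OF sigma_finite_lborel]) (auto simp: eq)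
  then show ?thesis
    by eventually_elim (auto simp: p_def n_def max_def split: if_splits)
qed

section \<open>Primitives and weak derivatives on the line\<close>

text \<open>Starting at minus infinity removes the choice of a base point. The functions concerned
  vanish off a bounded set, so the primitive is 0 to the left of it; on the unit interval it starts
  with the value 0 at 0.\<close>

definition prim :: "(real \<Rightarrow> real) \<Rightarrow> real \<Rightarrow> real" where
  "prim f x = (LBINT t. indicator {..x} t * f t)"

lemma integrable_indicator_mult:
  fixes f :: "'a::euclidean_space \<Rightarrow> real"
  assumes "integrable lborel f" "A \<in> sets borel"
  shows "integrable lborel (\<lambda>x. indicator A x * f x)"
  using integrable_mult_indicator[of A lborel f] assms by simp

lemma prim_measurable:
  assumes "f \<in> borel_measurable borel"
  shows "prim f \<in> borel_measurable borel"
proof -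
  have [measurable]: "f \<in> borel_measurable borel" by fact
  have "(\<lambda>x. LBINT t. (if t \<le> x then f t else 0)) \<in> borel_measurable borel"
    by measurable
  also have "(\<lambda>x. LBINT t. (if t \<le> x then f t else 0)) = prim f"
    unfolding prim_def by (intro ext Bochner_Integration.integral_cong) (auto simp: indicator_def)
  finally show ?thesis .
qed

lemma abs_prim_le:
  assumes "integrable lborel f"
  shows "\<bar>prim f x\<bar> \<le> (LBINT t. \<bar>f t\<bar>)"
proof -
  have "\<bar>prim f x\<bar> \<le> (LBINT t. \<bar>indicator {..x} t * f t\<bar>)"
    unfolding prim_def by (rule integral_abs_bound)
  also have "\<dots> \<le> (LBINT t. \<bar>f t\<bar>)"
    by (intro integral_mono integrable_abs integrable_indicator_mult assms) (auto simp: indicator_def)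
  finally show ?thesis .
qed

lemma prim_add:
  assumes "integrable lborel f" "integrable lborel g"
  shows "prim (\<lambda>t. f t + g t) x = prim f x + prim g x"
  using integrable_indicator_mult[OF assms(1), of "{..x}"] integrable_indicator_mult[OF assms(2), of "{..x}"]
  by (simp add: prim_def distrib_left)

lemma prim_cmult: "prim (\<lambda>t. c * f t) x = c * prim f x"
  by (simp add: prim_def mult.left_commute)

lemma prim_diff:
  assumes "integrable lborel f" "integrable lborel g"
  shows "prim (\<lambda>t. f t - g t) x = prim f x - prim g x"
  using prim_add[of f "\<lambda>t. - 1 * g t"] prim_cmult[of "- 1" g] assms by simp

lemma prim_cong_AE:
  assumes "f \<in> borel_measurable borel" "g \<in> borel_measurable borel" "AE t in lborel. f t = g t"
  shows "prim f x = prim g x"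
  unfolding prim_def using assms by (intro integral_cong_AE) auto

lemma prim_increment:
  assumes "integrable lborel f" "x \<le> y"
  shows "prim f y - prim f x = (LBINT t. indicator {x<..y} t * f t)"
proof -
  have "prim f y - prim f x = (LBINT t. indicator {..y} t * f t - indicator {..x} t * f t)"
    unfolding prim_def
    by (intro Bochner_Integration.integral_diff[symmetric] integrable_indicator_mult assms) auto
  also have "\<dots> = (LBINT t. indicator {x<..y} t * f t)"
    using assms(2) by (intro Bochner_Integration.integral_cong refl) (auto simp: indicator_def)
  finally show ?thesis .
qed

text \<open>Fubini on the triangle s <= t. Both factors are merely integrable, so this is at once
  the product rule for functions with integrable weak derivatives.\<close>

lemma prim_parts:
  assumes f: "integrable lborel f" and g: "integrable lborel g"
  shows "(LBINT x. prim f x * g x) + (LBINT x. f x * prim g x)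
      = (LBINT x. f x) * (LBINT x. g x)"
proof -
  have [measurable]: "f \<in> borel_measurable borel" "g \<in> borel_measurable borel"
    using f g by auto
  define H where "H = (\<lambda>(s, t). if s \<le> t then f s * g t else 0)"
  have H: "integrable (lborel \<Otimes>\<^sub>M lborel) H"
  proof (rule lborel_pair.Fubini_integrable)
    show "H \<in> borel_measurable (lborel \<Otimes>\<^sub>M lborel)"
      unfolding H_def by measurable
    have H_s: "(\<lambda>t. H (s, t)) = (\<lambda>t. f s * (indicator {s..} t * g t))" for s
      by (auto simp: H_def indicator_def)
    have H_int: "integrable lborel (\<lambda>t. H (s, t))" for s
      unfolding H_s by (intro integrable_mult_right integrable_indicator_mult g) auto
    then show "AE s in lborel. integrable lborel (\<lambda>t. H (s, t))"
      by simp
    show "integrable lborel (\<lambda>s. LBINT t. norm (H (s, t)))"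
    proof (rule integrable_bounded_by)
      show "integrable lborel (\<lambda>s. \<bar>f s\<bar> * (LBINT t. \<bar>g t\<bar>))"
        using f by auto
      show "(\<lambda>s. LBINT t. norm (H (s, t))) \<in> borel_measurable borel"
        unfolding H_def by measurable
      show "\<bar>LBINT t. norm (H (s, t))\<bar> \<le> \<bar>f s\<bar> * (LBINT t. \<bar>g t\<bar>)" for s
      proof -
        have "(LBINT t. norm (H (s, t))) \<le> (LBINT t. \<bar>f s\<bar> * \<bar>g t\<bar>)"
          by (intro integral_mono integrable_norm integrable_mult_right integrable_abs g H_int)
             (auto simp: H_def abs_mult)
        then show ?thesis
          by (simp add: integral_nonneg_AE)
      qed
    qed
  qed
  have "(LBINT x. prim f x * g x) = (LBINT t. LBINT s. H (s, t))"
    unfolding prim_def H_def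
    by (intro Bochner_Integration.integral_cong refl, subst integral_mult_left_zero[symmetric])
       (intro Bochner_Integration.integral_cong refl, auto simp: indicator_def)
  also have "\<dots> = (LBINT s. LBINT t. H (s, t))"
    using lborel_pair.Fubini_integral[of "\<lambda>s t. H (s, t)"] H by simp
  also have "\<dots> = (LBINT s. f s * (LBINT t. indicator {s..} t * g t))"
    unfolding H_def
    by (intro Bochner_Integration.integral_cong refl, subst integral_mult_right_zero[symmetric])
       (intro Bochner_Integration.integral_cong refl, auto simp: indicator_def)
  also have "\<dots> = (LBINT s. f s * ((LBINT t. g t) - prim g s))"
  proof (intro Bochner_Integration.integral_cong refl)
    fix s
    \<comment> \<open>The two half-lines overlap in the single point s, a null set.\<close>
    have "(LBINT t. g t) = (LBINT t. indicator {s..} t * g t + indicator {..s} t * g t)"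
      using AE_lborel_singleton[of s] by (intro integral_cong_AE) (auto simp: indicator_def)
    also have "\<dots> = (LBINT t. indicator {s..} t * g t) + prim g s"
      unfolding prim_def by (intro Bochner_Integration.integral_add integrable_indicator_mult g) auto
    finally show "f s * (LBINT t. indicator {s..} t * g t) = f s * ((LBINT t. g t) - prim g s)"
      by simp
  qed
  also have "\<dots> = (LBINT s. f s * (LBINT t. g t) - f s * prim g s)"
    by (simp add: right_diff_distrib)
  also have "\<dots> = (LBINT s. f s * (LBINT t. g t)) - (LBINT s. f s * prim g s)"
  proof (rule Bochner_Integration.integral_diff)
    show "integrable lborel (\<lambda>s. f s * prim g s)"
    proof (rule integrable_bounded_by)
      show "integrable lborel (\<lambda>s. \<bar>f s\<bar> * (LBINT t. \<bar>g t\<bar>))"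
        using f by auto
      show "\<bar>f s * prim g s\<bar> \<le> \<bar>f s\<bar> * (LBINT t. \<bar>g t\<bar>)" for s
        using abs_prim_le[OF g] by (simp add: abs_mult mult_left_mono)
    qed (use prim_measurable in measurable)
  qed (use f in auto)
  finally show ?thesis
    by simp
qed

lemma prim_truncate: "prim (\<lambda>t. indicator {..x} t * f t) y = prim f (min x y)"
  unfolding prim_def by (intro Bochner_Integration.integral_cong refl) (auto simp: indicator_def)

lemma prim_mult_integrable:
  assumes "integrable lborel f" "integrable lborel g"
  shows "integrable lborel (\<lambda>t. prim f t * g t)"
proof (rule integrable_bounded_by)
  show "integrable lborel (\<lambda>t. (LBINT s. \<bar>f s\<bar>) * \<bar>g t\<bar>)"
    using assms(2) by auto
  show "(\<lambda>t. prim f t * g t) \<in> borel_measurable borel"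
    using assms prim_measurable[of f] by auto
  show "\<bar>prim f t * g t\<bar> \<le> (LBINT s. \<bar>f s\<bar>) * \<bar>g t\<bar>" for t
    using abs_prim_le[OF assms(1)] by (simp add: abs_mult mult_right_mono)
qed

text \<open>\<open>prim_parts\<close> applied to both functions cut off at x; up to x the primitives
  of the cut-off functions agree with the original ones.\<close>

lemma prim_times_prim:
  assumes f: "integrable lborel f" and g: "integrable lborel g"
  shows "prim f x * prim g x = prim (\<lambda>t. prim f t * g t + f t * prim g t) x"
proof -
  let ?f = "\<lambda>t. indicator {..x} t * f t" and ?g = "\<lambda>t. indicator {..x} t * g t"
  have "prim f x * prim g x = (LBINT t. ?f t) * (LBINT t. ?g t)"
    by (simp add: prim_def)
  also have "\<dots> = (LBINT t. prim ?f t * ?g t) + (LBINT t. ?f t * prim ?g t)"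
    by (intro prim_parts[symmetric] integrable_indicator_mult f g) auto
  also have "(LBINT t. prim ?f t * ?g t) = prim (\<lambda>t. prim f t * g t) x"
    unfolding prim_def[of "\<lambda>t. prim f t * g t"] prim_truncate
    by (intro Bochner_Integration.integral_cong refl) (auto simp: indicator_def min_def)
  also have "(LBINT t. ?f t * prim ?g t) = prim (\<lambda>t. f t * prim g t) x"
    unfolding prim_def[of "\<lambda>t. f t * prim g t"] prim_truncate
    by (intro Bochner_Integration.integral_cong refl) (auto simp: indicator_def min_def)
  finally show ?thesis
    using prim_mult_integrable[OF f g] prim_mult_integrable[OF g f]
    by (subst prim_add) (auto simp: mult.commute)
qed

lemma prim_unit_interval:
  assumes "\<And>t. t \<notin> {0<..<1} \<Longrightarrow> f t = 0"
  shows "x \<le> 0 \<Longrightarrow> prim f x = 0" "1 \<le> x \<Longrightarrow> prim f x = (LBINT t. f t)"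
proof -
  assume "x \<le> 0"
  then have "(\<lambda>t. indicator {..x} t * f t) = (\<lambda>t. 0)"
    using assms by (auto simp: fun_eq_iff indicator_def)
  then show "prim f x = 0"
    by (simp only: prim_def lebesgue_integral_const) simp
next
  assume "1 \<le> x"
  then have "(\<lambda>t. indicator {..x} t * f t) = f"
    using assms by (auto simp: fun_eq_iff indicator_def)
  then show "prim f x = (LBINT t. f t)"
    by (simp only: prim_def)
qed

text \<open>Cauchy-Schwarz against the indicator of the interval. The integral on the right is kept
  local, which lets \<open>grid_difference_l2\<close> gain a full factor l instead of its square
  root.\<close>

lemma prim_increment_square_le:
  assumes f: "sq_int f" "integrable lborel f" and "x \<le> y"
  shows "(prim f y - prim f x)\<^sup>2 \<le> (y - x) * (LBINT t. indicator {x<..y} t * (f t)\<^sup>2)"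
proof -
  let ?I = "indicator {x<..y} :: real \<Rightarrow> real"
  have I: "sq_int ?I"
    using \<open>x \<le> y\<close> by (intro sq_int_indicator) (auto simp: fmeasurable_def)
  have If: "sq_int (\<lambda>t. ?I t * f t)"
    by (rule sq_int_bounded_mult[OF f(1), where B = 1]) auto
  have "\<bar>prim f y - prim f x\<bar> = \<bar>LBINT t. ?I t * (?I t * f t)\<bar>"
    unfolding prim_increment[OF f(2) \<open>x \<le> y\<close>]
    by (intro arg_cong[where f = abs] Bochner_Integration.integral_cong) (auto simp: indicator_def)
  also have "\<dots> \<le> l2 ?I * l2 (\<lambda>t. ?I t * f t)"
    by (rule Cauchy_Schwarz_l2[OF I If])
  finally have "\<bar>prim f y - prim f x\<bar>\<^sup>2 \<le> (l2 ?I * l2 (\<lambda>t. ?I t * f t))\<^sup>2"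
    by (rule power_mono) simp
  also have "\<dots> = (LBINT t. ?I t) * (LBINT t. ?I t * (f t)\<^sup>2)"
    unfolding power_mult_distrib l2_square
    by (intro arg_cong2[where f = "(*)"] Bochner_Integration.integral_cong) (auto simp: indicator_def)
  also have "(LBINT t. ?I t) = y - x"
    using \<open>x \<le> y\<close> by simp
  finally show ?thesis
    by simp
qed

subsection \<open>Test functions on the line\<close>

lemma test_function_sq_int:
  fixes \<phi> :: "'a::euclidean_space \<Rightarrow> real"
  assumes "\<phi> \<in> test_functions \<Omega>"
  shows "sq_int \<phi>" "integrable lborel \<phi>"
proof -
  obtain K where K: "compact K" "\<phi> \<in> test_functions K"
    using assms by (rule test_function_supp)
  obtain B where B: "\<forall>x. \<bar>\<phi> x\<bar> \<le> B"
    using test_function_bounded[OF K(2)] by blast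
  have fin: "K \<in> fmeasurable lborel"
    using K(1) emeasure_compact_finite[OF K(1)] by (auto simp: fmeasurable_def intro: borel_compact)
  show sq: "sq_int \<phi>"
  proof (rule sq_int_bounded_supp[OF _ _ fin])
    show "\<bar>\<phi> x\<bar> \<le> B * indicator K x" for x
      using B test_function_zero[OF K(2), of x] by (auto simp: indicator_def)
  qed (rule test_function_measurable[OF K(2)])
  show "integrable lborel \<phi>"
    by (rule sq_int_integrable[OF sq _ fin]) (rule test_function_zero[OF K(2)])
qed

lemma test_function_real_deriv:
  fixes \<psi> :: "real \<Rightarrow> real"
  assumes "\<psi> \<in> test_functions \<Omega>"
  shows "(\<psi> has_real_derivative dir_deriv 1 \<psi> x) (at x)"
  using Ck_real_SucD(1)[OF test_function_Ck[OF assms]] .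

lemma test_function_prim:
  fixes \<psi> :: "real \<Rightarrow> real"
  assumes "\<psi> \<in> test_functions \<Omega>"
  shows "prim (dir_deriv 1 \<psi>) x = \<psi> x" "(LBINT t. dir_deriv 1 \<psi> t) = 0"
    "integrable lborel (dir_deriv 1 \<psi>)"
proof -
  obtain K where K: "compact K" "\<psi> \<in> test_functions K"
    using assms by (rule test_function_supp)
  obtain N where N: "\<And>x. x \<in> K \<Longrightarrow> \<bar>x\<bar> < N"
    using compact_imp_bounded[OF K(1)] bounded_pos_less[of K] by (auto simp: bounded_pos_less)
  have D: "dir_deriv 1 \<psi> \<in> test_functions K"
    using test_function_dir_deriv[OF K(2), of 1] by simp
  then show int: "integrable lborel (dir_deriv 1 \<psi>)"
    by (rule test_function_sq_int)
  have zero: "\<psi> x = 0" "dir_deriv 1 \<psi> x = 0" if "\<bar>x\<bar> \<ge> N" for x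
    using N[of x] that test_function_zero[OF K(2), of x] test_function_zero[OF D, of x] by auto
  have FTC: "(LBINT t. dir_deriv 1 \<psi> t * indicator {a..b} t) = \<psi> b - \<psi> a" if "a \<le> b" for a b
    using test_function_continuous[OF D] that
    by (intro integral_FTC_Icc_real test_function_real_deriv[OF K(2)])
       (auto simp: continuous_on_eq_continuous_at)
  show "prim (dir_deriv 1 \<psi>) x = \<psi> x" for x
  proof -
    define a where "a = - \<bar>x\<bar> - \<bar>N\<bar>"
    have "prim (dir_deriv 1 \<psi>) x = (LBINT t. dir_deriv 1 \<psi> t * indicator {a..x} t)"
      unfolding prim_def
    proof (intro Bochner_Integration.integral_cong refl)
      fix t
      show "indicator {..x} t * dir_deriv 1 \<psi> t = dir_deriv 1 \<psi> t * indicator {a..x} t"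
        using zero(2)[of t] by (cases "t < a") (auto simp: indicator_def a_def)
    qed
    also have "\<dots> = \<psi> x"
      using zero(1)[of a] by (subst FTC) (auto simp: a_def)
    finally show ?thesis .
  qed
  have "(LBINT t. dir_deriv 1 \<psi> t) = (LBINT t. dir_deriv 1 \<psi> t * indicator {- \<bar>N\<bar>..\<bar>N\<bar>} t)"
  proof (intro Bochner_Integration.integral_cong refl)
    fix t
    show "dir_deriv 1 \<psi> t = dir_deriv 1 \<psi> t * indicator {- \<bar>N\<bar>..\<bar>N\<bar>} t"
      using zero(2)[of t] by (cases "\<bar>t\<bar> \<le> \<bar>N\<bar>") (auto simp: indicator_def)
  qed
  also have "\<dots> = 0"
    using zero(1)[of "\<bar>N\<bar>"] zero(1)[of "- \<bar>N\<bar>"] by (subst FTC) auto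
  finally show "(LBINT t. dir_deriv 1 \<psi> t) = 0" .
qed

text \<open>A primitive of a compactly supported function is constant on either side of the support.
  Started at 0 on the left, it is 0 on the right because the mean is zero.\<close>

lemma test_function_antiderivative:
  fixes \<zeta> :: "real \<Rightarrow> real"
  assumes \<zeta>: "\<zeta> \<in> test_functions {s<..<t}" and zero: "(LBINT x. \<zeta> x) = 0" and "s < t"
  obtains \<psi> where "\<psi> \<in> test_functions {s<..<t}" "dir_deriv 1 \<psi> = \<zeta>"
proof -
  obtain K where K: "compact K" "K \<subseteq> {s<..<t}" "\<zeta> \<in> test_functions K"
    using \<zeta> by (rule test_function_supp)
  \<comment> \<open>An interval strictly between the support and the ends s and t; midpoints leave
    room on both sides.\<close>
  obtain a b where ab: "s < a" "a \<le> b" "b < t" "K \<subseteq> {a<..<b}"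
  proof (cases "K = {}")
    case True
    then show ?thesis
      using that[of "(s + t) / 2" "(s + t) / 2"] \<open>s < t\<close> by simp
  next
    case False
    then have "Inf K \<in> K" "Sup K \<in> K"
      using K(1) by (auto simp: compact_imp_closed compact_imp_bounded bounded_imp_bdd_below bounded_imp_bdd_above
          intro: closed_contains_Inf closed_contains_Sup)
    moreover have "Inf K \<le> x" "x \<le> Sup K" if "x \<in> K" for x
      using that K(1) by (auto intro!: cInf_lower cSup_upper bounded_imp_bdd_below bounded_imp_bdd_above compact_imp_bounded)
    ultimately show ?thesis
      using that[of "(s + Inf K) / 2" "(Sup K + t) / 2"] K(2) False by fastforce
  qed
  have out: "\<zeta> x = 0" if "x \<notin> {a<..<b}" for x
    by (rule test_function_zero[OF K(3)]) (use ab(4) that in blast)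
  have cont: "isCont \<zeta> x" for x
    using test_function_continuous[OF \<zeta>] by (simp add: continuous_on_eq_continuous_at)
  obtain F where F: "\<And>x. (F has_real_derivative \<zeta> x) (at x)"
    using einterval_antiderivative[of "-\<infinity>" "\<infinity>" \<zeta>] cont
    by (auto simp: has_real_derivative_iff_has_vector_derivative)
  have FTC: "(LBINT t. \<zeta> t * indicator {x..y} t) = F y - F x" if "x \<le> y" for x y
    using that by (intro integral_FTC_Icc_real F cont)
  define \<psi> where "\<psi> x = F x - F a" for x
  have \<psi>: "(\<psi> has_real_derivative \<zeta> x) (at x)" for x
    unfolding \<psi>_def using F[of x] by (auto intro!: derivative_eq_intros)
  have "\<psi> \<in> test_functions {s<..<t}"
  proof (rule test_function_real_I)
    show "Ck k \<psi>" for k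
      using Ck_real_SucI[OF \<psi> test_function_Ck[OF \<zeta>], of k] Ck_Suc_imp by blast
    show "\<psi> x = 0" if "x \<notin> {a..b}" for x
    proof (cases "x < a")
      case True
      have "(\<lambda>t. \<zeta> t * indicator {x..a} t) = (\<lambda>t. 0)"
        using out by (auto simp: fun_eq_iff indicator_def)
      then have "F a - F x = 0"
        using FTC[of x a] True by (simp only:) simp
      then show ?thesis
        by (simp add: \<psi>_def)
    next
      case False
      have "(\<lambda>t. \<zeta> t * indicator {a..x} t) = \<zeta>"
      proof
        fix y
        show "\<zeta> y * indicator {a..x} y = \<zeta> y"
          using out[of y] that False by (cases "y \<in> {a<..<b}") (auto simp: indicator_def)
      qed
      then show ?thesis
        using FTC[of a x] False zero by (simp add: \<psi>_def)
    qed
    show "{a..b} \<subseteq> {s<..<t}"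
      using ab by auto
  qed
  moreover have "dir_deriv 1 \<psi> = \<zeta>"
  proof
    show "dir_deriv 1 \<psi> x = \<zeta> x" for x
      using fun_cong[OF frechet_derivative_at[OF \<psi>[of x, unfolded has_field_derivative_def]], of 1] by simp
  qed
  ultimately show ?thesis
    using that by blast
qed

lemma integral_approx_tendsto:
  fixes h :: "'a::euclidean_space \<Rightarrow> real" and \<theta> :: "nat \<Rightarrow> 'a \<Rightarrow> real"
  assumes h: "integrable lborel h" and m: "\<And>n. \<theta> n \<in> borel_measurable borel"
    and b: "\<And>n x. \<bar>\<theta> n x\<bar> \<le> 1" and lim: "\<And>x. (\<lambda>n. \<theta> n x) \<longlonglongrightarrow> \<theta>' x"
  shows "(\<lambda>n. LBINT x. h x * \<theta> n x) \<longlonglongrightarrow> (LBINT x. h x * \<theta>' x)"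
proof (rule integral_dominated_convergence[where w = "\<lambda>x. \<bar>h x\<bar>"])
  have [measurable]: "\<theta>' \<in> borel_measurable borel"
    by (rule borel_measurable_LIMSEQ_real[OF lim m])
  show "(\<lambda>x. h x * \<theta>' x) \<in> borel_measurable lborel" "(\<lambda>x. h x * \<theta> n x) \<in> borel_measurable lborel" for n
    using h m[of n] by auto
  show "AE x in lborel. norm (h x * \<theta> n x) \<le> \<bar>h x\<bar>" for n
    using b[of n] by (auto simp: abs_mult intro!: AE_I2 mult_left_le)
  show "AE x in lborel. (\<lambda>n. h x * \<theta> n x) \<longlonglongrightarrow> h x * \<theta>' x"
    using lim by (auto intro!: AE_I2 tendsto_mult)
qed (use h in auto)

lemma AE_zero_if_test_integrals_zero:
  fixes s t :: real
  assumes h: "integrable lborel h" and zero: "\<And>\<zeta>. \<zeta> \<in> test_functions {s<..<t} \<Longrightarrow> (LBINT x. h x * \<zeta> x) = 0"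
  shows "AE x in lborel. x \<in> {s<..<t} \<longrightarrow> h x = 0"
proof -
  have "AE x in lborel. indicator {s<..<t} x * h x = 0"
  proof (rule AE_zero_if_box_integrals_zero)
    show "integrable lborel (\<lambda>x. indicator {s<..<t} x * h x)"
      by (intro integrable_indicator_mult h) auto
    show "(LBINT x. indicator {s<..<t} x * h x * indicator (box a b) x) = 0" for a b
    proof -
      let ?I = "{max s a<..<min t b}"
      obtain \<theta> :: "nat \<Rightarrow> real \<Rightarrow> real" where \<theta>: "\<And>n. \<theta> n \<in> test_functions ?I"
        "\<And>n x. 0 \<le> \<theta> n x" "\<And>n x. \<theta> n x \<le> 1" "\<And>x. (\<lambda>n. \<theta> n x) \<longlonglongrightarrow> indicator ?I x"
        using test_functions_approx_indicator[of "max s a" "min t b"] by metis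
      have "(LBINT x. h x * \<theta> n x) = 0" for n
        by (intro zero test_functions_mono[OF \<theta>(1)]) auto
      moreover have "(\<lambda>n. LBINT x. h x * \<theta> n x) \<longlonglongrightarrow> (LBINT x. h x * indicator ?I x)"
        using \<theta> by (intro integral_approx_tendsto h test_function_measurable[OF \<theta>(1)]) (auto simp: abs_le_iff intro: order_trans[of _ 0])
      ultimately have "(LBINT x. h x * indicator ?I x) = 0"
        by (simp add: LIMSEQ_const_iff)
      then show ?thesis
        by (rule back_subst[where P = "\<lambda>z. z = 0"])
           (intro Bochner_Integration.integral_cong refl; auto simp: indicator_def)
    qed
  qed
  then show ?thesis
    by eventually_elim (auto simp: indicator_def)
qed

text \<open>A combination of \<zeta> and a cut-off with zero mean is a derivative, so h cannot tell
  \<zeta> from a multiple of the cut-off and acts as a constant. The constant is the mean of h over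
  any chosen subinterval from p to q. In \<open>vertical_structure\<close> that subinterval is the
  strip, whatever the height of the rectangle considered.\<close>

lemma du_Bois_Reymond:
  fixes s t :: real
  assumes h: "integrable lborel h" and "s < t" "s \<le> p" "p < q" "q \<le> t"
    and zero: "\<And>\<psi>. \<psi> \<in> test_functions {s<..<t} \<Longrightarrow> (LBINT x. h x * dir_deriv 1 \<psi> x) = 0"
    and \<zeta>: "\<zeta> \<in> test_functions {s<..<t}"
  shows "(LBINT x. h x * \<zeta> x)
    = (LBINT x. \<zeta> x) * ((LBINT x. h x * indicator {p<..<q} x) / (q - p))"
proof -
  obtain \<theta> :: "nat \<Rightarrow> real \<Rightarrow> real" where \<theta>: "\<And>n. \<theta> n \<in> test_functions {p<..<q}"
    "\<And>n x. 0 \<le> \<theta> n x" "\<And>n x. \<theta> n x \<le> 1" "\<And>x. (\<lambda>n. \<theta> n x) \<longlonglongrightarrow> indicator {p<..<q} x"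
    using test_functions_approx_indicator[of p q] by metis
  have \<theta>': "\<theta> n \<in> test_functions {s<..<t}" for n
    by (rule test_functions_mono[OF \<theta>(1)]) (use assms in auto)
  have abs: "\<bar>\<theta> n x\<bar> \<le> 1" for n x
    using \<theta>(2,3)[of n x] by auto
  have lim: "(\<lambda>n. LBINT x. g x * \<theta> n x) \<longlonglongrightarrow> (LBINT x. g x * indicator {p<..<q} x)"
    if "integrable lborel g" for g
    by (rule integral_approx_tendsto[OF that test_function_measurable[OF \<theta>(1)] abs \<theta>(4)])
  have "(\<lambda>n. LBINT x. indicator {p<..<q} x * \<theta> n x) \<longlonglongrightarrow> (LBINT x. indicator {p<..<q} x * indicator {p<..<q} x)"
    using \<open>p < q\<close> by (intro lim integrable_real_indicator) auto
  moreover have "(\<lambda>x. indicator {p<..<q} x * \<theta> n x) = \<theta> n" for n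
    using test_function_zero[OF \<theta>(1)[of n]] by (auto simp: fun_eq_iff indicator_def)
  moreover have "(LBINT x. indicator {p<..<q} x * indicator {p<..<q} x) = q - p"
    using \<open>p < q\<close> by (simp flip: indicator_inter_arith)
  ultimately have lim1: "(\<lambda>n. LBINT x. \<theta> n x) \<longlonglongrightarrow> q - p"
    by simp
  define m where "m = (LBINT x. \<zeta> x)"
  have "(LBINT x. h x * \<zeta> x) * (LBINT x. \<theta> n x) = m * (LBINT x. h x * \<theta> n x)" for n
  proof -
    define i where "i = (LBINT x. \<theta> n x)"
    \<comment> \<open>The weights make the two integrals cancel.\<close>
    let ?\<zeta> = "\<lambda>x. i * \<zeta> x - m * \<theta> n x"
    have "?\<zeta> \<in> test_functions {s<..<t}"
    proof -
      obtain K K' where K: "compact K" "K \<subseteq> {s<..<t}" "\<zeta> \<in> test_functions K"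
        "compact K'" "K' \<subseteq> {s<..<t}" "\<theta> n \<in> test_functions K'"
        using test_function_supp[OF \<zeta>] test_function_supp[OF \<theta>'] by metis
      show ?thesis
      proof (rule test_function_I)
        show "compact (K \<union> K')" "K \<union> K' \<subseteq> {s<..<t}"
          using K by auto
        show "?\<zeta> x = 0" if "x \<notin> K \<union> K'" for x
          using test_function_zero[OF K(3), of x] test_function_zero[OF K(6), of x] that by simp
        show "Ck k ?\<zeta>" for k
          by (intro Ck_diff Ck_mult[OF Ck_const] test_function_Ck[OF \<zeta>] test_function_Ck[OF \<theta>'])
      qed
    qed
    moreover have "(LBINT x. ?\<zeta> x) = 0"
      using test_function_sq_int(2)[OF \<zeta>] test_function_sq_int(2)[OF \<theta>'] by (simp add: m_def i_def)
    ultimately obtain \<psi> where \<psi>: "\<psi> \<in> test_functions {s<..<t}" "dir_deriv 1 \<psi> = ?\<zeta>"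
      using test_function_antiderivative[OF _ _ \<open>s < t\<close>] by blast
    have hint: "integrable lborel (\<lambda>x. h x * \<phi> x)" if \<phi>: "\<phi> \<in> test_functions {s<..<t}" for \<phi>
    proof -
      obtain B where B: "\<forall>x. \<bar>\<phi> x\<bar> \<le> B"
        using test_function_bounded[OF \<phi>] by blast
      show ?thesis
        by (rule integrable_mult_bounded[OF h test_function_measurable[OF \<phi>]]) (use B in blast)
    qed
    have "0 = (LBINT x. h x * ?\<zeta> x)"
      using zero[OF \<psi>(1)] \<psi>(2) by (simp add: fun_eq_iff)
    also have "\<dots> = (LBINT x. i * (h x * \<zeta> x) - m * (h x * \<theta> n x))"
      by (simp add: algebra_simps)
    also have "\<dots> = i * (LBINT x. h x * \<zeta> x) - m * (LBINT x. h x * \<theta> n x)"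
      using hint[OF \<zeta>] hint[OF \<theta>'] by simp
    finally show ?thesis
      by (simp add: i_def mult.commute)
  qed
  moreover have "(\<lambda>n. (LBINT x. h x * \<zeta> x) * (LBINT x. \<theta> n x)) \<longlonglongrightarrow> (LBINT x. h x * \<zeta> x) * (q - p)"
    by (intro tendsto_intros lim1)
  moreover have "(\<lambda>n. m * (LBINT x. h x * \<theta> n x)) \<longlonglongrightarrow> m * (LBINT x. h x * indicator {p<..<q} x)"
    by (intro tendsto_intros lim h)
  ultimately have "(LBINT x. h x * \<zeta> x) * (q - p) = m * (LBINT x. h x * indicator {p<..<q} x)"
    using LIMSEQ_unique by simp
  then show ?thesis
    using \<open>p < q\<close> by (simp add: m_def field_simps)
qed

subsection \<open>The Sobolev space of the unit interval\<close>

lemma unit_fmeasurable: "{0<..<1::real} \<in> fmeasurable lborel"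
  by (auto simp: fmeasurable_def)

text \<open>The function and the primitive of its weak derivative have the same weak derivative, so
  their difference annihilates all derivatives of test functions and is constant by
  \<open>du_Bois_Reymond\<close>.\<close>

lemma weak_deriv_imp_prim:
  assumes u: "borel_rep {0<..<1} u u'" and v: "borel_rep {0<..<1} v v'"
    and deriv: "L2_weak_deriv {0<..<1} 1 u v"
  obtains c where "AE x in lborel. x \<in> {0<..<1} \<longrightarrow> u' x = c + prim v' x"
proof -
  have v': "integrable lborel v'" and u': "integrable lborel u'"
    using sq_int_integrable[OF borel_repD(1)[OF v] borel_repD(2)[OF v] unit_fmeasurable]
      sq_int_integrable[OF borel_repD(1)[OF u] borel_repD(2)[OF u] unit_fmeasurable] by auto
  have P: "integrable lborel (\<lambda>x. prim v' x * indicator {0<..<1} x)"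
    by (rule prim_mult_integrable[OF v']) simp
  define h where "h x = u' x - prim v' x * indicator {0<..<1} x" for x
  have h: "integrable lborel h"
    unfolding h_def using u' P by simp
  have zero: "(LBINT x. h x * dir_deriv 1 \<psi> x) = 0" if \<psi>: "\<psi> \<in> test_functions {0<..<1}" for \<psi>
  proof -
    note D = test_function_prim[OF \<psi>]
    have "(LBINT x. u' x * dir_deriv 1 \<psi> x) = - (LBINT x. v' x * \<psi> x)"
      using deriv \<psi> by (simp add: L2_weak_deriv_borel_rep[OF _ u v])
    also have "\<dots> = (LBINT x. prim v' x * dir_deriv 1 \<psi> x)"
      using prim_parts[OF v' D(3)] D by (simp add: D(1)[abs_def])
    finally have eq: "(LBINT x. u' x * dir_deriv 1 \<psi> x) = (LBINT x. prim v' x * dir_deriv 1 \<psi> x)" .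
    have "h x * dir_deriv 1 \<psi> x = u' x * dir_deriv 1 \<psi> x - prim v' x * dir_deriv 1 \<psi> x" for x
      using test_function_dir_deriv_zero[OF \<psi>, of x 1] by (auto simp: h_def indicator_def algebra_simps)
    then have "(LBINT x. h x * dir_deriv 1 \<psi> x)
        = (LBINT x. u' x * dir_deriv 1 \<psi> x - prim v' x * dir_deriv 1 \<psi> x)"
      by simp
    also have "\<dots> = 0"
      using prim_mult_integrable[OF v' D(3)] eq
        sq_int_mult_integrable[OF borel_repD(1)[OF u] test_function_sq_int(1)[OF test_function_dir_deriv[OF \<psi>]]]
      by simp
    finally show ?thesis .
  qed
  define c where "c = (LBINT x. h x * indicator {0<..<1} x)"
  have "AE x in lborel. x \<in> {0<..<1} \<longrightarrow> h x - c * indicator {0<..<1} x = 0"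
  proof (rule AE_zero_if_test_integrals_zero)
    show "integrable lborel (\<lambda>x. h x - c * indicator {0<..<1} x)"
      using h by simp
    show "(LBINT x. (h x - c * indicator {0<..<1} x) * \<zeta> x) = 0" if \<zeta>: "\<zeta> \<in> test_functions {0<..<1}" for \<zeta>
    proof -
      have "(h x - c * indicator {0<..<1} x) * \<zeta> x = h x * \<zeta> x - c * \<zeta> x" for x
        using test_function_zero[OF \<zeta>, of x] by (auto simp: indicator_def algebra_simps)
      moreover have "h x * \<zeta> x = u' x * \<zeta> x - prim v' x * \<zeta> x" for x
        using test_function_zero[OF \<zeta>, of x] by (auto simp: h_def indicator_def algebra_simps)
      then have "integrable lborel (\<lambda>x. h x * \<zeta> x)"
        using sq_int_mult_integrable[OF borel_repD(1)[OF u] test_function_sq_int(1)[OF \<zeta>]]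
          prim_mult_integrable[OF v' test_function_sq_int(2)[OF \<zeta>]] by simp
      ultimately show ?thesis
        using du_Bois_Reymond[OF h _ _ _ _ zero \<zeta>, of 0 1] test_function_sq_int(2)[OF \<zeta>]
        by (simp add: c_def)
    qed
  qed
  then have "AE x in lborel. x \<in> {0<..<1} \<longrightarrow> u' x = c + prim v' x"
    by eventually_elim (auto simp: h_def)
  then show ?thesis
    using that by blast
qed

lemma prim_sq_int:
  assumes "integrable lborel v"
  shows "sq_int (\<lambda>x. indicator {0<..<1} x * (c + prim v x))"
proof (rule sq_int_bounded_supp[OF _ _ unit_fmeasurable])
  show "(\<lambda>x. indicator {0<..<1} x * (c + prim v x)) \<in> borel_measurable borel"
    using prim_measurable[of v] assms by auto
  show "\<bar>indicator {0<..<1} x * (c + prim v x)\<bar> \<le> (\<bar>c\<bar> + (LBINT t. \<bar>v t\<bar>)) * indicator {0<..<1} x" for x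
    using abs_prim_le[OF assms, of x] by (auto simp: indicator_def)
qed

lemma prim_borel_rep:
  assumes "sq_int v" "\<And>x. x \<notin> {0<..<1} \<Longrightarrow> v x = 0"
  shows "borel_rep {0<..<1} (\<lambda>x. c + prim v x) (\<lambda>x. indicator {0<..<1} x * (c + prim v x))"
  using prim_sq_int[OF sq_int_integrable[OF assms unit_fmeasurable]] by (auto simp: borel_rep_def)

lemma prim_weak_deriv:
  assumes v: "sq_int v" "\<And>x. x \<notin> {0<..<1} \<Longrightarrow> v x = 0"
  shows "L2_weak_deriv {0<..<1} 1 (\<lambda>x. c + prim v x) v"
proof -
  have int: "integrable lborel v"
    by (rule sq_int_integrable[OF v unit_fmeasurable])
  have "(LBINT x. indicator {0<..<1} x * (c + prim v x) * dir_deriv 1 \<psi> x) = - (LBINT x. v x * \<psi> x)"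
    if \<psi>: "\<psi> \<in> test_functions {0<..<1}" for \<psi>
  proof -
    note D = test_function_prim[OF \<psi>]
    have "indicator {0<..<1} x * (c + prim v x) * dir_deriv 1 \<psi> x = c * dir_deriv 1 \<psi> x + prim v x * dir_deriv 1 \<psi> x" for x
      using test_function_dir_deriv_zero[OF \<psi>, of x 1] by (auto simp: indicator_def algebra_simps)
    then show ?thesis
      using prim_parts[OF int D(3)] D prim_mult_integrable[OF int D(3)] by (simp add: D(1)[abs_def])
  qed
  then show ?thesis
    by (subst L2_weak_deriv_borel_rep[OF _ prim_borel_rep[OF v] borel_rep_self[OF v]]) auto
qed

text \<open>Up to null sets, the functions \<open>ac a w\<close> with \<open>w\<close> in \<open>L\<^sup>2\<close> and zero outside the unit interval are
  exactly the elements of \<open>H\<^sup>1(0,1)\<close>, and \<open>w\<close> is the weak derivative of \<open>ac a w\<close>.\<close>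

definition ac :: "real \<Rightarrow> (real \<Rightarrow> real) \<Rightarrow> real \<Rightarrow> real" where
  "ac a w x = indicator {0<..<1} x * (a + prim w x)"

lemma ac_sq_int: "integrable lborel w \<Longrightarrow> sq_int (ac a w)"
  using prim_sq_int[of w a] by (simp add: ac_def[abs_def])

lemma ac_zero: "x \<notin> {0<..<1} \<Longrightarrow> ac a w x = 0"
  by (simp add: ac_def)

lemma ac_diff:
  assumes "integrable lborel v" "integrable lborel w"
  shows "ac a v x - ac b w x = ac (a - b) (\<lambda>t. v t - w t) x"
  unfolding ac_def prim_diff[OF assms] by (simp add: algebra_simps)

lemma weak_deriv_imp_ac:
  assumes u: "u \<in> L2 {0<..<1}" and v: "borel_rep {0<..<1} v v'" and deriv: "L2_weak_deriv {0<..<1} 1 u v"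
  obtains c where "borel_rep {0<..<1} u (ac c v')"
proof -
  obtain u' where u': "borel_rep {0<..<1} u u'"
    using u by (rule L2_borel_rep[rotated]) auto
  obtain c where c: "AE x in lborel. x \<in> {0<..<1} \<longrightarrow> u' x = c + prim v' x"
    using weak_deriv_imp_prim[OF u' v deriv] by blast
  have "integrable lborel v'"
    using sq_int_integrable[OF borel_repD(1)[OF v] borel_repD(2)[OF v] unit_fmeasurable] .
  moreover have "AE x in lborel. x \<in> {0<..<1} \<longrightarrow> u x = ac c v' x"
    using c borel_repD(3)[OF u'] by eventually_elim (auto simp: ac_def)
  ultimately show ?thesis
    using that[of c] by (auto simp: borel_rep_def ac_sq_int ac_zero)
qed

section \<open>The limit problem\<close>

text \<open>Writes the exponential as a constant plus a primitive, so that the solution formula can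
  be verified by the algebra of \<open>prim\<close> alone.\<close>

lemma prim_exp:
  assumes "x \<in> {0..1}"
  shows "exp (k * x) = 1 + prim (\<lambda>t. k * indicator {0<..<1} t * exp (k * t)) x"
proof -
  have "prim (\<lambda>t. k * indicator {0<..<1} t * exp (k * t)) x = (LBINT t. (k * exp (k * t)) * indicator {0..x} t)"
    unfolding prim_def
  proof (rule integral_cong_AE)
    show "AE t in lborel. indicator {..x} t * (k * indicator {0<..<1} t * exp (k * t)) = k * exp (k * t) * indicator {0..x} t"
    proof -
      have "AE t in lborel. t \<noteq> 0 \<and> t \<noteq> (1::real)"
        using AE_lborel_singleton[of "0::real"] AE_lborel_singleton[of "1::real"] by eventually_elim auto
      then show ?thesis
        by eventually_elim (use assms in \<open>auto simp: indicator_def\<close>)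
    qed
  qed auto
  also have "\<dots> = exp (k * x) - exp (k * 0)"
    using assms by (intro integral_FTC_Icc_real) (auto intro!: derivative_eq_intros continuous_intros)
  finally show ?thesis
    by simp
qed

lemma integrable_indicator_unit_bounded:
  fixes h :: "real \<Rightarrow> real"
  assumes "h \<in> borel_measurable borel" "\<And>x. x \<in> {0<..<1} \<Longrightarrow> \<bar>h x\<bar> \<le> B"
  shows "integrable lborel (\<lambda>x. indicator {0<..<1} x * h x)"
proof (rule integrable_bounded_by)
  show "integrable lborel (\<lambda>x::real. B * indicator {0<..<1} x)"
    by (intro integrable_mult_right integrable_real_indicator) auto
  show "\<bar>indicator {0<..<1} x * h x\<bar> \<le> B * indicator {0<..<1} x" for x
    using assms(2)[of x] by (auto simp: indicator_def)
qed (use assms in auto)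

lemma abs_exp_unit_le:
  fixes x k :: real
  assumes "x \<in> {0<..<1}"
  shows "\<bar>exp (k * x)\<bar> \<le> exp \<bar>k\<bar>"
proof -
  have "k * x \<le> \<bar>k\<bar> * 1"
    using assms by (intro mult_mono) auto
  then show ?thesis
    by simp
qed

lemma integrable_exp_mult:
  fixes f :: "real \<Rightarrow> real"
  assumes f: "integrable lborel f" "\<And>t. t \<notin> {0<..<1} \<Longrightarrow> f t = 0"
  shows "integrable lborel (\<lambda>t. exp (k * t) * f t)"
proof (rule integrable_bounded_by)
  show "integrable lborel (\<lambda>t. exp \<bar>k\<bar> * \<bar>f t\<bar>)"
    using f by auto
  show "\<bar>exp (k * t) * f t\<bar> \<le> exp \<bar>k\<bar> * \<bar>f t\<bar>" for t
    using abs_exp_unit_le[of t k] f(2)[of t]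
    by (cases "t \<in> {0<..<1}") (auto simp: abs_mult intro!: mult_right_mono)
qed (use f in auto)

text \<open>Variation of constants: \<open>y = e\<^sup>k\<^sup>x \<integral>\<^sub>0\<^sup>x e\<^sup>-\<^sup>k\<^sup>t f dt\<close> solves \<open>y' = k y + f\<close>, \<open>y(0) = 0\<close>.\<close>

definition expconv :: "real \<Rightarrow> (real \<Rightarrow> real) \<Rightarrow> real \<Rightarrow> real" where
  "expconv k f x = exp (k * x) * prim (\<lambda>t. exp (- k * t) * f t) x"

lemma expconv_integrable:
  assumes f: "integrable lborel f" "\<And>t. t \<notin> {0<..<1} \<Longrightarrow> f t = 0"
  shows "integrable lborel (\<lambda>t. indicator {0<..<1} t * expconv k f t)"
proof -
  have int: "integrable lborel (\<lambda>t. exp (- k * t) * f t)"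
    by (rule integrable_exp_mult[OF f])
  show ?thesis
  proof (rule integrable_indicator_unit_bounded)
    show "expconv k f \<in> borel_measurable borel"
      unfolding expconv_def[abs_def] using prim_measurable[of "\<lambda>t. exp (- k * t) * f t"] int by auto
    show "\<bar>expconv k f x\<bar> \<le> exp \<bar>k\<bar> * (LBINT t. \<bar>exp (- k * t) * f t\<bar>)" if "x \<in> {0<..<1}" for x
      unfolding expconv_def abs_mult[of "exp (k * x)"]
      by (rule mult_mono[OF abs_exp_unit_le[OF that] abs_prim_le[OF int]]) auto
  qed
qed

text \<open>The product rule \<open>prim_times_prim\<close>, with the exponential as one of the two
  primitives.\<close>

lemma expconv_eq:
  assumes f: "integrable lborel f" "\<And>t. t \<notin> {0<..<1} \<Longrightarrow> f t = 0" and x: "x \<in> {0..1}"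
  shows "expconv k f x = prim (\<lambda>t. k * (indicator {0<..<1} t * expconv k f t) + f t) x"
proof -
  let ?e = "\<lambda>t. k * indicator {0<..<1} t * exp (k * t)" and ?f = "\<lambda>t. exp (- k * t) * f t"
  have e: "integrable lborel ?e"
    using integrable_indicator_unit_bounded[of "\<lambda>t. k * exp (k * t)" "\<bar>k\<bar> * exp \<bar>k\<bar>"] abs_exp_unit_le[of _ k]
    by (simp add: abs_mult mult_left_mono ac_simps)
  have f': "integrable lborel ?f"
    by (rule integrable_exp_mult[OF f])
  have int: "integrable lborel (\<lambda>t. prim ?e t * ?f t + ?e t * prim ?f t)"
    using prim_mult_integrable[OF e f'] prim_mult_integrable[OF f' e]
    by (intro Bochner_Integration.integrable_add) (simp_all add: mult.commute)
  have "expconv k f x = (1 + prim ?e x) * prim ?f x"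
    using prim_exp[OF x, of k] by (simp add: expconv_def)
  also have "\<dots> = prim ?f x + prim (\<lambda>t. prim ?e t * ?f t + ?e t * prim ?f t) x"
    by (simp only: distrib_right prim_times_prim[OF e f'] mult_1)
  also have "\<dots> = prim (\<lambda>t. ?f t + (prim ?e t * ?f t + ?e t * prim ?f t)) x"
    by (rule prim_add[OF f' int, symmetric])
  also have "(\<lambda>t. ?f t + (prim ?e t * ?f t + ?e t * prim ?f t)) = (\<lambda>t. k * (indicator {0<..<1} t * expconv k f t) + f t)"
  proof
    fix t
    show "?f t + (prim ?e t * ?f t + ?e t * prim ?f t) = k * (indicator {0<..<1} t * expconv k f t) + f t"
    proof (cases "t \<in> {0<..<1}")
      case True
      then have "exp (k * t) = 1 + prim ?e t"
        by (intro prim_exp) auto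
      then have "?f t + prim ?e t * ?f t = exp (k * t) * ?f t"
        by (simp add: algebra_simps)
      also have "\<dots> = f t"
        by (simp add: exp_minus)
      finally show ?thesis
        using True by (simp add: expconv_def)
    qed (simp add: f(2))
  qed
  finally show ?thesis .
qed

text \<open>The explicit solution is u = A C - (k/2)(Y - Z) with k = 1 / sqrt d: C is twice a
  hyperbolic cosine, and the second part solves the equation with zero Cauchy data at 0. The
  conclusion is the equation integrated once. The primitive starts at 0, which encodes u'(0) = 0,
  and the vanishing total integral encodes u'(1) = 0.\<close>

lemma neumann_solution_strong:
  fixes d :: real
  assumes "d > 0" and f: "integrable lborel f" "\<And>t. t \<notin> {0<..<1} \<Longrightarrow> f t = 0"
  shows "\<exists>c v. sq_int v \<and> (\<forall>x. x \<notin> {0<..<1} \<longrightarrow> v x = 0) \<and>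
    (\<forall>x\<in>{0<..<1}. d * v x = prim (\<lambda>t. ac c v t - f t) x) \<and> (LBINT t. ac c v t - f t) = 0"
proof -
  define k where "k = 1 / sqrt d"
  have k: "k > 0" "d * k\<^sup>2 = 1"
    using \<open>d > 0\<close> by (auto simp: k_def power_divide)
  let ?I = "indicator {0<..<1} :: real \<Rightarrow> real"
  define Y where "Y = expconv k f"
  define Z where "Z = expconv (- k) f"
  define S where "S x = exp (k * x) - exp (- k * x)" for x
  define C where "C x = exp (k * x) + exp (- k * x)" for x
  have S1: "S 1 > 0"
    using k by (simp add: S_def)
  \<comment> \<open>Determined by the condition u'(1) = 0, that is \<open>w 1 = 0\<close>.\<close>
  define A where "A = k / 2 * (Y 1 + Z 1) / S 1"
  define u where "u x = A * C x - k / 2 * (Y x - Z x)" for x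
  \<comment> \<open>The derivative of u, because Y' = k Y + f and Z' = - k Z + f.\<close>
  define w where "w x = k * A * S x - k\<^sup>2 / 2 * (Y x + Z x)" for x
  define v where "v x = ?I x * w x" for x
  have intY: "integrable lborel (\<lambda>t. ?I t * Y t)"
    unfolding Y_def by (rule expconv_integrable[OF f])
  have intZ: "integrable lborel (\<lambda>t. ?I t * Z t)"
    unfolding Z_def by (rule expconv_integrable[OF f])
  have intE: "integrable lborel (\<lambda>t. ?I t * exp (\<kappa> * t))" for \<kappa>
    using abs_exp_unit_le[of _ \<kappa>] by (intro integrable_indicator_unit_bounded[where B = "exp \<bar>\<kappa>\<bar>"]) auto
  have E: "exp (\<kappa> * x) = 1 + \<kappa> * prim (\<lambda>t. ?I t * exp (\<kappa> * t)) x" if "x \<in> {0..1}" for \<kappa> x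
    using prim_exp[OF that, of \<kappa>] by (simp add: mult.assoc prim_cmult)
  have conv: "expconv \<kappa> f x = \<kappa> * prim (\<lambda>t. ?I t * expconv \<kappa> f t) x + prim f x" if "x \<in> {0..1}" for \<kappa> x
  proof -
    have "integrable lborel (\<lambda>t. ?I t * expconv \<kappa> f t)"
      by (rule expconv_integrable[OF f])
    then have "prim (\<lambda>t. \<kappa> * (?I t * expconv \<kappa> f t) + f t) x = \<kappa> * prim (\<lambda>t. ?I t * expconv \<kappa> f t) x + prim f x"
      using f(1) by (simp only: prim_add prim_cmult integrable_mult_right)
    moreover have "expconv \<kappa> f x = prim (\<lambda>t. \<kappa> * (?I t * expconv \<kappa> f t) + f t) x"
      by (rule expconv_eq[OF f that])
    ultimately show ?thesis
      by simp
  qed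
  have Y: "Y x = k * prim (\<lambda>t. ?I t * Y t) x + prim f x"
    and Z: "Z x = - k * prim (\<lambda>t. ?I t * Z t) x + prim f x" if "x \<in> {0..1}" for x
    using conv[OF that, of k] conv[OF that, of "- k"] by (simp_all add: Y_def Z_def)
  have u: "u x = 2 * A + prim v x" if "x \<in> {0..1}" for x
  proof -
    have "v = (\<lambda>t. (k * A) * (?I t * exp (k * t)) - (k * A) * (?I t * exp (- k * t))
        - ((k\<^sup>2 / 2) * (?I t * Y t) + (k\<^sup>2 / 2) * (?I t * Z t)))"
      by (auto simp: v_def w_def S_def algebra_simps)
    then have "prim v x = k * A * prim (\<lambda>t. ?I t * exp (k * t)) x - k * A * prim (\<lambda>t. ?I t * exp (- k * t)) x
        - (k\<^sup>2 / 2 * prim (\<lambda>t. ?I t * Y t) x + k\<^sup>2 / 2 * prim (\<lambda>t. ?I t * Z t) x)"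
      by (simp only: prim_diff prim_add prim_cmult integrable_mult_right intY intZ intE
            Bochner_Integration.integrable_add Bochner_Integration.integrable_diff)
    then show ?thesis
      unfolding u_def C_def E[OF that, of k] E[OF that, of "- k"] Y[OF that] Z[OF that]
      by (simp add: algebra_simps power2_eq_square)
  qed
  define g where "g t = ac (2 * A) v t - f t" for t
  have ac_u: "ac (2 * A) v t = ?I t * u t" for t
    using u[of t] by (auto simp: ac_def indicator_def)
  have acI: "ac (2 * A) v = (\<lambda>t. A * (?I t * exp (k * t)) + A * (?I t * exp (- k * t))
       - (k / 2 * (?I t * Y t) - k / 2 * (?I t * Z t)))"
    by (rule ext, unfold ac_u u_def C_def) (simp add: field_simps)
  have int_ac: "integrable lborel (ac (2 * A) v)"
    unfolding acI by (simp only: integrable_mult_right intY intZ intE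
            Bochner_Integration.integrable_add Bochner_Integration.integrable_diff)
  have int_g: "integrable lborel g"
    unfolding g_def using int_ac f(1) by simp
  have w: "w x = k\<^sup>2 * prim g x" if "x \<in> {0..1}" for x
  proof -
    have "prim g x = prim (ac (2 * A) v) x - prim f x"
      unfolding g_def by (rule prim_diff[OF int_ac f(1)])
    also have "prim (ac (2 * A) v) x = A * prim (\<lambda>t. ?I t * exp (k * t)) x + A * prim (\<lambda>t. ?I t * exp (- k * t)) x
        - (k / 2 * prim (\<lambda>t. ?I t * Y t) x - k / 2 * prim (\<lambda>t. ?I t * Z t) x)"
      unfolding acI by (simp only: prim_diff prim_add prim_cmult integrable_mult_right intY intZ intE
            Bochner_Integration.integrable_add Bochner_Integration.integrable_diff)
    finally have pg: "prim g x = A * prim (\<lambda>t. ?I t * exp (k * t)) x + A * prim (\<lambda>t. ?I t * exp (- k * t)) x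
        - (k / 2 * prim (\<lambda>t. ?I t * Y t) x - k / 2 * prim (\<lambda>t. ?I t * Z t) x) - prim f x" .
    show ?thesis
      unfolding pg w_def S_def E[OF that, of k] E[OF that, of "- k"] Y[OF that] Z[OF that]
      by (simp add: algebra_simps power2_eq_square)
  qed
  have v: "v = ac 0 (\<lambda>t. k\<^sup>2 * g t)"
    using w by (auto simp: v_def ac_def prim_cmult indicator_def)
  show ?thesis
  proof (intro exI[of _ "2 * A"] exI[of _ v] conjI allI impI ballI)
    show "sq_int v"
      unfolding v using int_g by (intro ac_sq_int) simp
    show "v x = 0" if "x \<notin> {0<..<1}" for x
      using that by (simp add: v_def)
    show "d * v x = prim (\<lambda>t. ac (2 * A) v t - f t) x" if "x \<in> {0<..<1}" for x
      using that w[of x] k(2) by (simp add: v_def g_def[abs_def] mult.assoc[symmetric])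
    have "w 1 = 0"
      using S1 by (simp add: w_def A_def power2_eq_square)
    then have "prim g 1 = 0"
      using w[of 1] k by simp
    moreover have "prim g 1 = (LBINT t. g t)"
      by (rule prim_unit_interval) (auto simp: g_def ac_zero f(2))
    ultimately show "(LBINT t. ac (2 * A) v t - f t) = 0"
      by (simp add: g_def[abs_def])
  qed
qed

text \<open>One integration by parts turns the integrated equation into the weak one. The boundary
  term and the constant a drop out because \<open>ac c v - f\<close> has zero integral.\<close>

lemma neumann_solution:
  fixes d :: real
  assumes "d > 0" and f: "sq_int f" "\<And>t. t \<notin> {0<..<1} \<Longrightarrow> f t = 0"
  shows "\<exists>c v. sq_int v \<and> (\<forall>x. x \<notin> {0<..<1} \<longrightarrow> v x = 0) \<and>
    (\<forall>a w. sq_int w \<longrightarrow> (\<forall>x. x \<notin> {0<..<1} \<longrightarrow> w x = 0) \<longrightarrow>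
       d * (LBINT x. v x * w x) + (LBINT x. ac c v x * ac a w x) = (LBINT x. f x * ac a w x))"
proof -
  have fint: "integrable lborel f"
    by (rule sq_int_integrable[OF f unit_fmeasurable])
  obtain c v where v: "sq_int v" "\<And>x. x \<notin> {0<..<1} \<Longrightarrow> v x = 0"
    "\<And>x. x \<in> {0<..<1} \<Longrightarrow> d * v x = prim (\<lambda>t. ac c v t - f t) x"
    "(LBINT t. ac c v t - f t) = 0"
    using neumann_solution_strong[OF \<open>d > 0\<close> fint f(2)] by blast
  have vint: "integrable lborel v"
    by (rule sq_int_integrable[OF v(1,2) unit_fmeasurable])
  have acv: "sq_int (ac c v)"
    by (rule ac_sq_int[OF vint])
  let ?g = "\<lambda>t. ac c v t - f t"
  have g: "sq_int ?g"
    by (rule sq_int_diff[OF acv f(1)])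
  have gint: "integrable lborel ?g"
    by (rule sq_int_integrable[OF g _ unit_fmeasurable]) (simp add: ac_zero f(2))
  show ?thesis
  proof (intro exI[of _ c] exI[of _ v] conjI allI impI)
    show "sq_int v"
      by fact
    show "v x = 0" if "x \<notin> {0<..<1}" for x
      by (rule v(2)[OF that])
    fix a and w :: "real \<Rightarrow> real"
    assume "sq_int w" "\<forall>x. x \<notin> {0<..<1} \<longrightarrow> w x = 0"
    then have w: "sq_int w" "\<And>x. x \<notin> {0<..<1} \<Longrightarrow> w x = 0"
      by auto
    have wint: "integrable lborel w"
      by (rule sq_int_integrable[OF w unit_fmeasurable])
    have acw: "sq_int (ac a w)"
      by (rule ac_sq_int[OF wint])
    have "d * (LBINT x. v x * w x) = (LBINT x. prim ?g x * w x)"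
      unfolding integral_mult_right_zero[symmetric]
    proof (intro Bochner_Integration.integral_cong refl)
      fix x
      show "d * (v x * w x) = prim ?g x * w x"
        using v(3)[of x] w(2)[of x] by (cases "x \<in> {0<..<1}") (auto simp: mult.assoc[symmetric])
    qed
    also have "\<dots> = - (LBINT x. ?g x * prim w x)"
      using prim_parts[OF gint wint] v(4) by simp
    also have "\<dots> = - (LBINT x. ?g x * ac a w x)"
    proof -
      have "?g x * ac a w x = a * ?g x + ?g x * prim w x" for x
        using ac_zero[of x c v] f(2)[of x] by (cases "x \<in> {0<..<1}") (auto simp: ac_def algebra_simps)
      then have "(LBINT x. ?g x * ac a w x) = (LBINT x. a * ?g x + ?g x * prim w x)"
        by simp
      also have "\<dots> = a * (LBINT x. ?g x) + (LBINT x. ?g x * prim w x)"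
        using gint prim_mult_integrable[OF wint gint]
        by (subst Bochner_Integration.integral_add) (auto simp: mult.commute)
      finally show ?thesis
        using v(4) by simp
    qed
    also have "(LBINT x. ?g x * ac a w x) = (LBINT x. ac c v x * ac a w x) - (LBINT x. f x * ac a w x)"
      unfolding left_diff_distrib
      by (intro Bochner_Integration.integral_diff sq_int_mult_integrable acv acw f(1))
    finally show "d * (LBINT x. v x * w x) + (LBINT x. ac c v x * ac a w x) = (LBINT x. f x * ac a w x)"
      by simp
  qed
qed

lemma integral_energy_rep:
  assumes "borel_rep \<Omega> v v'" "borel_rep \<Omega> w w'" "borel_rep \<Omega> u u'" "borel_rep \<Omega> \<phi> \<phi>'" "\<Omega> \<in> sets borel"
  shows "(LINT x|lebesgue_on \<Omega>. d * (v x * w x) + u x * \<phi> x)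
    = d * (LBINT x. v' x * w' x) + (LBINT x. u' x * \<phi>' x)"
proof -
  note sq = assms(1-4)[THEN borel_repD(1)]
  have [measurable]: "v' \<in> borel_measurable borel" "w' \<in> borel_measurable borel" "u' \<in> borel_measurable borel"
    "\<phi>' \<in> borel_measurable borel"
    using sq by (auto simp: sq_int_def)
  have "(LINT x|lebesgue_on \<Omega>. d * (v x * w x) + u x * \<phi> x) = (LBINT x. d * (v' x * w' x) + u' x * \<phi>' x)"
  proof (rule integral_lebesgue_on_AE_eq[OF assms(5)])
    show "AE x in lborel. x \<in> \<Omega> \<longrightarrow> d * (v x * w x) + u x * \<phi> x = d * (v' x * w' x) + u' x * \<phi>' x"
      using assms(1-4)[THEN borel_repD(3)] by eventually_elim auto
  qed (use borel_repD(2)[OF assms(1)] borel_repD(2)[OF assms(3)] in auto)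
  also have "\<dots> = d * (LBINT x. v' x * w' x) + (LBINT x. u' x * \<phi>' x)"
    using sq by (simp add: sq_int_mult_integrable)
  finally show ?thesis .
qed

lemma integral_mult_rep:
  assumes "borel_rep \<Omega> u u'" "borel_rep \<Omega> \<phi> \<phi>'" "\<Omega> \<in> sets borel"
  shows "(LINT x|lebesgue_on \<Omega>. u x * \<phi> x) = (LBINT x. u' x * \<phi>' x)"
  using integral_energy_rep[OF assms(1,1,1,2,3), of 0] by simp

text \<open>Every test function is of the form \<open>ac a w\<close> up to a null set, so the
  hypothesis is the full weak formulation. For uniqueness the difference of two solutions is
  inserted as its own test function; as d > 0, a sum of two nonnegative terms is then 0.\<close>

lemma weak_solution_1D_ac:
  fixes d :: real
  assumes "d > 0" and f: "borel_rep {0<..<1} f f'"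
    and v: "sq_int v" "\<And>x. x \<notin> {0<..<1} \<Longrightarrow> v x = 0"
    and eq: "\<And>a w. sq_int w \<Longrightarrow> (\<And>x. x \<notin> {0<..<1} \<Longrightarrow> w x = 0) \<Longrightarrow>
       d * (LBINT x. v x * w x) + (LBINT x. ac c v x * ac a w x) = (LBINT x. f' x * ac a w x)"
  shows "weak_solution_1D d f (\<lambda>x. c + prim v x)"
    and "weak_solution_1D d f y \<Longrightarrow> AE x in lebesgue_on {0<..<1}. y x = c + prim v x"
proof -
  let ?J = "{0<..<1} :: real set"
  have J: "?J \<in> sets borel"
    by simp
  have vrep: "borel_rep ?J v v"
    by (rule borel_rep_self[OF v])
  have urep: "borel_rep ?J (\<lambda>x. c + prim v x) (ac c v)"
    using prim_borel_rep[OF v] by (simp add: ac_def[abs_def])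
  have deriv: "L2_weak_deriv ?J 1 (\<lambda>x. c + prim v x) v"
    by (rule prim_weak_deriv[OF v])
  show "weak_solution_1D d f (\<lambda>x. c + prim v x)"
    unfolding weak_solution_1D_def
  proof (intro conjI exI[of _ v] ballI allI impI deriv)
    show "(\<lambda>x. c + prim v x) \<in> H1 ?J"
      using deriv borel_rep_imp_L2(1)[OF J urep] by (auto simp: H1_def)
    fix \<phi> \<phi>'
    assume \<phi>: "\<phi> \<in> H1 ?J" "L2_weak_deriv ?J 1 \<phi> \<phi>'"
    obtain w where w: "borel_rep ?J \<phi>' w"
      using \<phi>(2) by (auto simp: L2_weak_deriv_def intro: L2_borel_rep[OF J])
    obtain a where a: "borel_rep ?J \<phi> (ac a w)"
      using weak_deriv_imp_ac[OF _ w \<phi>(2)] \<phi>(1) by (auto simp: H1_def)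
    show "(LINT x|lebesgue_on ?J. d * (v x * \<phi>' x) + (c + prim v x) * \<phi> x) = (LINT x|lebesgue_on ?J. f x * \<phi> x)"
      using eq[OF borel_repD(1)[OF w] borel_repD(2)[OF w]]
      by (simp add: integral_energy_rep[OF vrep w urep a J] integral_mult_rep[OF f a J])
  qed
  assume "weak_solution_1D d f y"
  then obtain z where y: "y \<in> H1 ?J" and z: "L2_weak_deriv ?J 1 y z"
    and yeq: "\<And>\<phi> \<phi>'. \<phi> \<in> H1 ?J \<Longrightarrow> L2_weak_deriv ?J 1 \<phi> \<phi>' \<Longrightarrow>
      (LINT x|lebesgue_on ?J. d * (z x * \<phi>' x) + y x * \<phi> x) = (LINT x|lebesgue_on ?J. f x * \<phi> x)"
    unfolding weak_solution_1D_def by blast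
  obtain z' where z': "borel_rep ?J z z'"
    using z by (auto simp: L2_weak_deriv_def intro: L2_borel_rep[OF J])
  obtain a where a: "borel_rep ?J y (ac a z')"
    using weak_deriv_imp_ac[OF _ z' z] y by (auto simp: H1_def)
  define w where "w x = z' x - v x" for x
  have w: "sq_int w" "\<And>x. x \<notin> ?J \<Longrightarrow> w x = 0"
    using sq_int_diff[OF borel_repD(1)[OF z'] v(1)] borel_repD(2)[OF z'] v(2) by (auto simp: w_def[abs_def])
  have int: "integrable lborel z'" "integrable lborel v" "integrable lborel w"
    using sq_int_integrable[OF _ _ unit_fmeasurable] borel_repD(1,2)[OF z'] v w by blast+
  let ?\<phi> = "\<lambda>x. (a - c) + prim w x"
  have \<phi>: "borel_rep ?J ?\<phi> (ac (a - c) w)"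
    using prim_borel_rep[OF w] by (simp add: ac_def[abs_def])
  have wrep: "borel_rep ?J w w"
    by (rule borel_rep_self[OF w])
  have \<phi>_H1: "?\<phi> \<in> H1 ?J" and \<phi>_deriv: "L2_weak_deriv ?J 1 ?\<phi> w"
    using prim_weak_deriv[OF w] borel_rep_imp_L2(1)[OF J \<phi>] by (auto simp: H1_def)
  have diff: "ac a z' x - ac c v x = ac (a - c) w x" for x
    using ac_diff[OF int(1,2)] by (simp add: w_def[abs_def])
  have sq: "sq_int (ac a z')" "sq_int (ac c v)" "sq_int (ac (a - c) w)"
    by (rule ac_sq_int[OF int(1)] ac_sq_int[OF int(2)] ac_sq_int[OF int(3)])+
  have "d * (LBINT x. z' x * w x) + (LBINT x. ac a z' x * ac (a - c) w x)
      = d * (LBINT x. v x * w x) + (LBINT x. ac c v x * ac (a - c) w x)"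
    using yeq[OF \<phi>_H1 \<phi>_deriv] eq[OF w]
    by (simp add: integral_energy_rep[OF z' wrep a \<phi> J] integral_mult_rep[OF f \<phi> J])
  moreover have "(LBINT x. z' x * w x) - (LBINT x. v x * w x) = (LBINT x. (w x)\<^sup>2)"
    using sq_int_mult_integrable[OF borel_repD(1)[OF z'] w(1)] sq_int_mult_integrable[OF v(1) w(1)]
    by (subst Bochner_Integration.integral_diff[symmetric]) (auto simp: w_def power2_eq_square algebra_simps)
  moreover have "(LBINT x. ac a z' x * ac (a - c) w x) - (LBINT x. ac c v x * ac (a - c) w x)
      = (LBINT x. (ac (a - c) w x)\<^sup>2)"
    using sq_int_mult_integrable[OF sq(1,3)] sq_int_mult_integrable[OF sq(2,3)]
    by (subst Bochner_Integration.integral_diff[symmetric]) (auto simp: diff power2_eq_square simp flip: left_diff_distrib)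
  ultimately have "d * (LBINT x. (w x)\<^sup>2) + (LBINT x. (ac (a - c) w x)\<^sup>2) = 0"
    by (simp add: algebra_simps)
  moreover have "0 \<le> d * (LBINT x. (w x)\<^sup>2)" "0 \<le> (LBINT x. (ac (a - c) w x)\<^sup>2)"
    using \<open>d > 0\<close> by (auto simp: integral_nonneg_AE)
  ultimately have "(LBINT x. (ac (a - c) w x)\<^sup>2) = 0"
    by linarith
  then have "AE x in lborel. (ac (a - c) w x)\<^sup>2 = 0"
    using sq_intD(3)[OF sq(3)] by (subst (asm) integral_nonneg_eq_0_iff_AE) auto
  then have "AE x in lborel. x \<in> ?J \<longrightarrow> y x = c + prim v x"
    using borel_repD(3)[OF a]
  proof eventually_elim
    case (elim x)
    then show ?case
      using diff[of x] by (auto simp: ac_def)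
  qed
  then show "AE x in lebesgue_on ?J. y x = c + prim v x"
    by (simp add: AE_lebesgue_on_iff[OF J])
qed

section \<open>Fubini in the plane\<close>

lemma lborel2_integral:
  fixes F :: "real \<times> real \<Rightarrow> real"
  assumes F: "integrable lborel F"
  shows lborel2_fst: "(LBINT z. F z) = (LBINT x. LBINT y. F (x, y))"
    and lborel2_snd: "(LBINT z. F z) = (LBINT y. LBINT x. F (x, y))"
    and lborel2_AE: "AE x in lborel. integrable lborel (\<lambda>y. F (x, y))"
    and lborel2_integrable: "integrable lborel (\<lambda>x. LBINT y. F (x, y))"
    and lborel2_integrable_snd: "integrable lborel (\<lambda>y. LBINT x. F (x, y))"
proof -
  have F': "integrable (lborel \<Otimes>\<^sub>M lborel) F"
    using F by (simp add: lborel_prod)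
  have F'': "integrable (lborel \<Otimes>\<^sub>M lborel) (\<lambda>(x, y). F (x, y))"
    using F' by simp
  show "(LBINT z. F z) = (LBINT x. LBINT y. F (x, y))"
    using lborel_pair.integral_fst'[OF F'] by (simp add: lborel_prod)
  then show "(LBINT z. F z) = (LBINT y. LBINT x. F (x, y))"
    using lborel_pair.Fubini_integral[of "\<lambda>x y. F (x, y)", OF F''] by simp
  show "AE x in lborel. integrable lborel (\<lambda>y. F (x, y))"
    by (rule lborel_pair.AE_integrable_fst'[OF F'])
  show "integrable lborel (\<lambda>x. LBINT y. F (x, y))"
    by (rule lborel_pair.integrable_fst'[OF F'])
  show "integrable lborel (\<lambda>y. LBINT x. F (x, y))"
    by (rule lborel_pair.integrable_snd[OF F''])
qed

lemma measurable_fst_snd [measurable]: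
  "(fst :: real \<times> real \<Rightarrow> real) \<in> borel_measurable borel" "(snd :: real \<times> real \<Rightarrow> real) \<in> borel_measurable borel"
  by (auto intro!: borel_measurable_continuous_onI continuous_intros)

lemma borel_measurable_slice:
  fixes h :: "real \<times> real \<Rightarrow> real"
  assumes "h \<in> borel_measurable borel"
  shows "(\<lambda>y. h (x, y)) \<in> borel_measurable borel" "(\<lambda>x. h (x, y)) \<in> borel_measurable borel"
    "(\<lambda>x. LBINT y. h (x, y)) \<in> borel_measurable borel"
proof -
  have [measurable]: "h \<in> borel_measurable (borel \<Otimes>\<^sub>M borel)"
    using assms by (simp add: borel_prod)
  show "(\<lambda>y. h (x, y)) \<in> borel_measurable borel" "(\<lambda>x. h (x, y)) \<in> borel_measurable borel"
    by measurable
  show "(\<lambda>x. LBINT y. h (x, y)) \<in> borel_measurable borel"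
    by measurable
qed

lemma integrable_product:
  fixes h k :: "real \<Rightarrow> real"
  assumes h: "integrable lborel h" and k: "integrable lborel k"
  shows "integrable lborel (\<lambda>z. h (fst z) * k (snd z))"
    and "(LBINT z. h (fst z) * k (snd z)) = (LBINT x. h x) * (LBINT y. k y)"
proof -
  have [measurable]: "h \<in> borel_measurable borel" "k \<in> borel_measurable borel"
    using h k by auto
  have "integrable (lborel \<Otimes>\<^sub>M lborel) (\<lambda>z. h (fst z) * k (snd z))"
  proof (rule lborel_pair.Fubini_integrable)
    show "integrable lborel (\<lambda>x. LBINT y. norm (h (fst (x, y)) * k (snd (x, y))))"
      using h by (simp add: abs_mult)
  qed (use k in auto)
  then show int: "integrable lborel (\<lambda>z. h (fst z) * k (snd z))"
    by (simp add: lborel_prod)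
  show "(LBINT z. h (fst z) * k (snd z)) = (LBINT x. h x) * (LBINT y. k y)"
    using lborel2_fst[OF int] by simp
qed

lemma AE_lborel2_fst:
  fixes P :: "real \<Rightarrow> bool"
  assumes "AE x in lborel. P x"
  shows "AE z in (lborel :: (real \<times> real) measure). P (fst z)"
proof -
  obtain N where N: "N \<in> null_sets lborel" "{x. \<not> P x} \<subseteq> N"
    using assms by (auto simp: eventually_ae_filter)
  then have [measurable]: "N \<in> sets borel"
    by auto
  have "AE x in lborel. AE y in (lborel :: real measure). x \<notin> N"
    using AE_not_in[OF N(1)] by eventually_elim auto
  moreover have "{z \<in> space (lborel \<Otimes>\<^sub>M (lborel :: real measure)). fst z \<notin> N} \<in> sets (lborel \<Otimes>\<^sub>M lborel)"
    by measurable
  ultimately have "AE z in lborel \<Otimes>\<^sub>M (lborel :: real measure). fst z \<notin> N"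
    using lborel_pair.AE_pair_iff[where P = "\<lambda>x y. x \<notin> N"] by blast
  then show ?thesis
    unfolding lborel_prod by eventually_elim (use N in auto)
qed

lemma AE_lborel2_slice:
  assumes "AE z in (lborel :: (real \<times> real) measure). P z"
  shows "AE x in lborel. AE y in lborel. P (x, y)"
  using assms unfolding lborel_prod[symmetric] by (rule lborel_pair.AE_pair)

lemma sq_int_slice:
  fixes h :: "real \<times> real \<Rightarrow> real"
  assumes "sq_int h"
  shows "AE x in lborel. sq_int (\<lambda>y. h (x, y))"
  using lborel2_AE[OF sq_intD(3)[OF assms]] borel_measurable_slice(1)[OF sq_intD(1)[OF assms]]
  by (auto simp: sq_int_def)

text \<open>Products of one-dimensional cut-offs converge to indicators of boxes inside the
  rectangle, which reduces the claim to \<open>AE_zero_if_box_integrals_zero\<close>.\<close>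

lemma AE_zero_if_product_test_integrals_zero:
  fixes E :: "real \<times> real \<Rightarrow> real"
  assumes E: "integrable lborel E"
    and zero: "\<And>\<phi> \<psi>. \<phi> \<in> test_functions {p<..<q} \<Longrightarrow> \<psi> \<in> test_functions {s<..<t} \<Longrightarrow>
        (LBINT z. E z * (\<phi> (fst z) * \<psi> (snd z))) = 0"
  shows "AE z in lborel. z \<in> {p<..<q} \<times> {s<..<t} \<longrightarrow> E z = 0"
proof -
  let ?R = "{p<..<q} \<times> {s<..<t}"
  have R: "?R \<in> sets borel"
    by (intro borel_open open_Times) auto
  have "AE z in lborel. indicator ?R z * E z = 0"
  proof (rule AE_zero_if_box_integrals_zero)
    show "integrable lborel (\<lambda>z. indicator ?R z * E z)"
      by (rule integrable_indicator_mult[OF E R])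
    show "(LBINT z. indicator ?R z * E z * indicator (box a b) z) = 0" for a b
    proof -
      let ?I = "{max p (fst a)<..<min q (fst b)}" and ?J = "{max s (snd a)<..<min t (snd b)}"
      obtain \<theta> :: "nat \<Rightarrow> real \<Rightarrow> real" where \<theta>: "\<And>n. \<theta> n \<in> test_functions ?I"
        "\<And>n x. 0 \<le> \<theta> n x" "\<And>n x. \<theta> n x \<le> 1" "\<And>x. (\<lambda>n. \<theta> n x) \<longlonglongrightarrow> indicator ?I x"
        using test_functions_approx_indicator[of "max p (fst a)" "min q (fst b)"] by metis
      obtain \<eta> :: "nat \<Rightarrow> real \<Rightarrow> real" where \<eta>: "\<And>n. \<eta> n \<in> test_functions ?J"
        "\<And>n x. 0 \<le> \<eta> n x" "\<And>n x. \<eta> n x \<le> 1" "\<And>x. (\<lambda>n. \<eta> n x) \<longlonglongrightarrow> indicator ?J x"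
        using test_functions_approx_indicator[of "max s (snd a)" "min t (snd b)"] by metis
      have "(LBINT z. E z * (\<theta> n (fst z) * \<eta> n (snd z))) = 0" for n
        by (intro zero test_functions_mono[OF \<theta>(1)] test_functions_mono[OF \<eta>(1)]) auto
      moreover have "(\<lambda>n. LBINT z. E z * (\<theta> n (fst z) * \<eta> n (snd z)))
          \<longlonglongrightarrow> (LBINT z. E z * (indicator ?I (fst z) * indicator ?J (snd z)))"
      proof (rule integral_approx_tendsto[OF E])
        show "(\<lambda>z. \<theta> n (fst z) * \<eta> n (snd z)) \<in> borel_measurable borel" for n
          using test_function_measurable[OF test_function_pair(1)[OF \<theta>(1) \<eta>(1) order_refl]] .
        show "\<bar>\<theta> n (fst z) * \<eta> n (snd z)\<bar> \<le> 1" for n z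
          using \<theta>(2,3)[of n "fst z"] \<eta>(2,3)[of n "snd z"] by (auto simp: abs_mult intro!: mult_le_one)
        show "(\<lambda>n. \<theta> n (fst z) * \<eta> n (snd z)) \<longlonglongrightarrow> indicator ?I (fst z) * indicator ?J (snd z)" for z
          by (intro tendsto_mult \<theta>(4) \<eta>(4))
      qed
      ultimately have "(LBINT z. E z * (indicator ?I (fst z) * indicator ?J (snd z))) = 0"
        by (simp add: LIMSEQ_const_iff)
      then show ?thesis
        by (rule back_subst[where P = "\<lambda>z. z = 0"])
           (intro Bochner_Integration.integral_cong refl;
            auto simp: indicator_def box_def Basis_real_pair inner_prod_def)
    qed
  qed
  then show ?thesis
    by eventually_elim (auto simp: indicator_def)
qed

text \<open>Cauchy-Schwarz on each column, of which a piece of length q - p matters.\<close>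

lemma column_integral_sq_int:
  fixes h :: "real \<times> real \<Rightarrow> real"
  assumes h: "sq_int h" "\<And>z. snd z \<notin> {p<..q} \<Longrightarrow> h z = 0" and "p \<le> q"
  shows "sq_int (\<lambda>x. LBINT y. h (x, y))" "l2 (\<lambda>x. LBINT y. h (x, y)) \<le> sqrt (q - p) * l2 h"
proof -
  let ?K = "\<lambda>x. LBINT y. h (x, y)" and ?R = "\<lambda>x. LBINT y. (h (x, y))\<^sup>2"
  have K: "?K \<in> borel_measurable borel"
    by (rule borel_measurable_slice(3)[OF sq_intD(1)[OF h(1)]])
  have R: "integrable lborel ?R" "(LBINT x. ?R x) = (l2 h)\<^sup>2"
    using lborel2_integrable[OF sq_intD(3)[OF h(1)]] lborel2_fst[OF sq_intD(3)[OF h(1)]] by (auto simp: l2_square)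
  have I: "sq_int (indicator {p<..q} :: real \<Rightarrow> real)"
    using \<open>p \<le> q\<close> by (intro sq_int_indicator) (auto simp: fmeasurable_def)
  have le: "AE x in lborel. (?K x)\<^sup>2 \<le> (q - p) * ?R x"
    using sq_int_slice[OF h(1)]
  proof eventually_elim
    case (elim x)
    have "?K x = (LBINT y. indicator {p<..q} y * h (x, y))"
    proof (intro Bochner_Integration.integral_cong refl)
      show "h (x, y) = indicator {p<..q} y * h (x, y)" for y
        using h(2)[of "(x, y)"] by (cases "y \<in> {p<..q}") auto
    qed
    then have "\<bar>?K x\<bar> \<le> l2 (indicator {p<..q} :: real \<Rightarrow> real) * l2 (\<lambda>y. h (x, y))"
      using Cauchy_Schwarz_l2[OF I elim] by simp
    then have "\<bar>?K x\<bar>\<^sup>2 \<le> (l2 (indicator {p<..q} :: real \<Rightarrow> real) * l2 (\<lambda>y. h (x, y)))\<^sup>2"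
      by (rule power_mono) simp
    also have "\<dots> = (q - p) * ?R x"
    proof -
      have "(l2 (indicator {p<..q} :: real \<Rightarrow> real))\<^sup>2 = q - p"
        unfolding l2_square using \<open>p \<le> q\<close> by (simp add: power2_eq_square flip: indicator_inter_arith)
      then show ?thesis
        by (simp only: power_mult_distrib l2_square)
    qed
    finally show ?case
      by simp
  qed
  have K2: "integrable lborel (\<lambda>x. (?K x)\<^sup>2)"
    by (rule Bochner_Integration.integrable_bound[of _ "\<lambda>x. (q - p) * ?R x"])
       (use R(1) K le in \<open>auto elim!: eventually_mono intro: order_trans[OF _ abs_ge_self]\<close>)
  then show "sq_int ?K"
    using K by (simp add: sq_int_def)
  have "(LBINT x. (?K x)\<^sup>2) \<le> (LBINT x. (q - p) * ?R x)"
    by (rule integral_mono_AE[OF K2 _ le]) (use R(1) in auto)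
  also have "\<dots> = (q - p) * (l2 h)\<^sup>2"
    using R(2) by simp
  finally have "sqrt (LBINT x. (?K x)\<^sup>2) \<le> sqrt ((q - p) * (l2 h)\<^sup>2)"
    by (rule real_sqrt_le_mono)
  then show "l2 ?K \<le> sqrt (q - p) * l2 h"
    by (simp add: real_sqrt_mult l2_nonneg l2_def[of ?K])
qed

text \<open>A function of the first variable alone gains the square root of the height of the strip
  on which it lives. On the layer between 0 and \<delta> this is the source of the small factor sqrt
  \<delta>.\<close>

lemma strip_sq_int:
  fixes k :: "real \<Rightarrow> real" and m :: "real \<times> real \<Rightarrow> real"
  assumes k: "sq_int k" and m: "m \<in> borel_measurable borel" "\<And>z. \<bar>m z\<bar> \<le> B * indicator {p..q} (snd z)" and "p \<le> q" "0 \<le> B"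
  shows "sq_int (\<lambda>z. m z * k (fst z))" "l2 (\<lambda>z. m z * k (fst z)) \<le> B * sqrt (q - p) * l2 k"
proof -
  have [measurable]: "k \<in> borel_measurable borel"
    using k by (rule sq_intD)
  let ?H = "\<lambda>z :: real \<times> real. B * (indicator {p..q} (snd z) * k (fst z))"
  have H: "?H \<in> borel_measurable borel"
    by measurable
  have eq: "(?H (x, y))\<^sup>2 = (B\<^sup>2 * (k x)\<^sup>2) * indicator {p..q} y" for x y
    by (auto simp: power_mult_distrib indicator_def)
  have "integrable (lborel \<Otimes>\<^sub>M lborel) (\<lambda>z. (?H z)\<^sup>2)"
  proof (rule lborel_pair.Fubini_integrable)
    show "(\<lambda>z. (?H z)\<^sup>2) \<in> borel_measurable (lborel \<Otimes>\<^sub>M lborel)"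
      using H by (simp add: lborel_prod)
    show "integrable lborel (\<lambda>x. LBINT y. norm ((?H (x, y))\<^sup>2))"
      unfolding eq using sq_intD(3)[OF k] \<open>p \<le> q\<close> by (simp add: abs_mult)
    show "AE x in lborel. integrable lborel (\<lambda>y. (?H (x, y))\<^sup>2)"
      unfolding eq using \<open>p \<le> q\<close> by simp
  qed
  then have H2: "integrable lborel (\<lambda>z. (?H z)\<^sup>2)"
    by (simp add: lborel_prod)
  then have Hsq: "sq_int ?H"
    using H by (simp add: sq_int_def)
  have "(l2 ?H)\<^sup>2 = (LBINT x. LBINT y. (?H (x, y))\<^sup>2)"
    unfolding l2_square by (rule lborel2_fst[OF H2])
  also have "\<dots> = (B * sqrt (q - p) * l2 k)\<^sup>2"
    unfolding eq using \<open>p \<le> q\<close> by (simp add: power_mult_distrib l2_square mult_ac)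
  finally have "l2 ?H = B * sqrt (q - p) * l2 k"
    using l2_nonneg[of ?H] l2_nonneg[of k] \<open>p \<le> q\<close> \<open>0 \<le> B\<close> by (subst (asm) power2_eq_iff_nonneg) auto
  moreover have m': "(\<lambda>z. m z * k (fst z)) \<in> borel_measurable borel"
    using m(1) by measurable
  moreover have "\<bar>m z * k (fst z)\<bar> \<le> \<bar>?H z\<bar>" for z
    using mult_right_mono[OF m(2)[of z], of "\<bar>k (fst z)\<bar>"] \<open>0 \<le> B\<close> by (simp add: abs_mult mult_ac)
  ultimately show "sq_int (\<lambda>z. m z * k (fst z))" "l2 (\<lambda>z. m z * k (fst z)) \<le> B * sqrt (q - p) * l2 k"
    using l2_mono[OF Hsq m'] by auto
qed

section \<open>Domains of columns over the unit interval\<close>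

text \<open>A single domain, with \<epsilon> fixed. Openness makes g lower semicontinuous on the
  unit interval. All constants are expressed by b and M, which will be the same for every
  \<epsilon>, so the estimates are uniform.\<close>

locale column_domain =
  fixes b M :: real and g :: "real \<Rightarrow> real"
  assumes b_pos: "b > 0" and g_nonneg: "\<And>x. 0 \<le> g x" and g_le: "\<And>x. g x \<le> M"
    and open_dom: "open {(x, y). 0 < x \<and> x < 1 \<and> - b < y \<and> y < g x}"
begin

definition Om :: "(real \<times> real) set" where
  "Om = {(x, y). 0 < x \<and> x < 1 \<and> - b < y \<and> y < g x}"

lemma mem_Om: "z \<in> Om \<longleftrightarrow> 0 < fst z \<and> fst z < 1 \<and> - b < snd z \<and> snd z < g (fst z)"
  by (auto simp: Om_def)

lemma open_Om: "open Om"
  using open_dom by (simp add: Om_def)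

lemma Om_borel [measurable, simp]: "Om \<in> sets borel"
  by (rule borel_open[OF open_Om])

lemma M_nonneg: "0 \<le> M"
  using g_nonneg g_le order_trans by blast

lemma Om_subset: "Om \<subseteq> {0<..<1} \<times> {- b<..M}"
proof
  show "z \<in> {0<..<1} \<times> {- b<..M}" if "z \<in> Om" for z
    using that g_le[of "fst z"] by (auto simp: mem_Om mem_Times_iff)
qed

lemma lower_subset: "{0<..<1} \<times> {- b<..<0} \<subseteq> Om"
proof
  show "z \<in> Om" if "z \<in> {0<..<1} \<times> {- b<..<0}" for z
    using that g_nonneg[of "fst z"] by (auto simp: mem_Om mem_Times_iff)
qed

lemma Om_fmeasurable: "Om \<in> fmeasurable lborel"
proof -
  have "bounded Om"
  proof (rule bounded_subset)
    show "bounded ({0..1::real} \<times> {- b..M})"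
      by (intro bounded_Times bounded_closed_interval)
    show "Om \<subseteq> {0..1} \<times> {- b..M}"
      using Om_subset by (auto dest!: subsetD)
  qed
  then show ?thesis
    using emeasure_bounded_finite[of Om] by (auto simp: fmeasurable_def)
qed

lemma section_eq: "indicator Om (x, y) = (indicator {0<..<1} x * indicator {- b<..<g x} y :: real)"
  by (auto simp: indicator_def mem_Om)

text \<open>A superlevel set at a height a >= 0 is the slice of the open set \<open>Om\<close> at y
  = a. The indicator is present because openness of \<open>Om\<close> says nothing about g off the
  unit interval.\<close>

lemma height_measurable: "(\<lambda>x. indicator {0<..<1} x * g x) \<in> borel_measurable borel"
proof -
  have "{x \<in> space borel. a < indicator {0<..<1} x * g x} \<in> sets borel" for a
  proof (cases "a < 0")
    case True
    then have "{x \<in> space borel. a < indicator {0<..<1} x * g x} = UNIV"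
      using g_nonneg by (auto simp: indicator_def intro: less_le_trans)
    then show ?thesis
      by simp
  next
    case False
    then have "{x \<in> space borel. a < indicator {0<..<1} x * g x} = (\<lambda>x. (x, a)) -` Om"
      using b_pos by (auto simp: indicator_def mem_Om)
    moreover have "open ((\<lambda>x. (x, a)) -` Om)"
      by (intro open_vimage open_Om continuous_intros)
    ultimately show ?thesis
      by (simp add: borel_open)
  qed
  then show ?thesis
    by (subst borel_measurable_iff_greater) blast
qed

definition wdiff :: "real \<times> real \<Rightarrow> (real \<times> real \<Rightarrow> real) \<Rightarrow> (real \<times> real \<Rightarrow> real) \<Rightarrow> bool" where
  "wdiff e u v \<longleftrightarrow> sq_int u \<and> sq_int v \<and> (\<forall>z. z \<notin> Om \<longrightarrow> u z = 0) \<and> (\<forall>z. z \<notin> Om \<longrightarrow> v z = 0) \<and>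
     (\<forall>\<zeta>\<in>test_functions Om. (LBINT z. u z * dir_deriv e \<zeta> z) = - (LBINT z. v z * \<zeta> z))"

lemma wdiffD:
  assumes "wdiff e u v"
  shows "sq_int u" "sq_int v" "z \<notin> Om \<Longrightarrow> u z = 0" "z \<notin> Om \<Longrightarrow> v z = 0"
    "\<zeta> \<in> test_functions Om \<Longrightarrow> (LBINT z. u z * dir_deriv e \<zeta> z) = - (LBINT z. v z * \<zeta> z)"
  using assms unfolding wdiff_def by blast+

lemma supp_snd:
  assumes "\<And>z. z \<notin> Om \<Longrightarrow> h z = (0::real)" "snd z \<notin> {- b<..M}"
  shows "h z = 0"
  using assms(2) Om_subset by (intro assms(1)) (auto simp: mem_Times_iff)

text \<open>The strip \<open>{- b<..<0}\<close> is contained in every column, and over it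
  \<open>Om\<close> is a rectangle; this makes the mean commute with horizontal
  differentiation.\<close>

definition avg :: "(real \<times> real \<Rightarrow> real) \<Rightarrow> real \<Rightarrow> real" where
  "avg h x = (LBINT y. indicator {- b<..<0} y * h (x, y)) / b"

lemma avg_sq_int:
  assumes h: "sq_int h" "\<And>z. z \<notin> Om \<Longrightarrow> h z = 0"
  shows "sq_int (avg h)" "x \<notin> {0<..<1} \<Longrightarrow> avg h x = 0" "integrable lborel (avg h)"
proof -
  have "sq_int (\<lambda>z. indicator {- b<..<0} (snd z) * h z)"
    by (rule sq_int_bounded_mult[OF h(1), where B = 1]) auto
  then have "sq_int (\<lambda>x. LBINT y. indicator {- b<..<0} (snd (x, y)) * h (x, y))"
    by (rule column_integral_sq_int(1)[where p = "- b" and q = 0]) (use b_pos in auto)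
  from sq_int_cmult[OF this, of "1 / b"] show sq: "sq_int (avg h)"
    by (simp add: avg_def[abs_def])
  have 0: "avg h x = 0" if "x \<notin> {0<..<1}" for x
  proof -
    have "h (x, y) = 0" for y
      by (rule h(2)) (use that in \<open>auto simp: mem_Om\<close>)
    then show ?thesis
      by (simp add: avg_def)
  qed
  then show "x \<notin> {0<..<1} \<Longrightarrow> avg h x = 0" .
  show "integrable lborel (avg h)"
    by (rule sq_int_integrable[OF sq 0 unit_fmeasurable])
qed

lemma Om_integrable:
  assumes "sq_int h" "\<And>z. z \<notin> Om \<Longrightarrow> h z = 0"
  shows "integrable lborel h"
  by (rule sq_int_integrable[OF assms Om_fmeasurable])

lemma integral_avg_mult:
  assumes h: "sq_int h" "\<And>z. z \<notin> Om \<Longrightarrow> h z = 0" and k: "sq_int k"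
  shows "(LBINT z. h z * (indicator {- b<..<0} (snd z) * k (fst z))) = b * (LBINT x. avg h x * k x)"
proof -
  have "sq_int (\<lambda>z. indicator {- b<..<0} (snd z) * k (fst z))"
    by (rule strip_sq_int(1)[OF k, where B = 1 and p = "- b" and q = 0]) (use b_pos in \<open>auto simp: indicator_def\<close>)
  from sq_int_mult_integrable[OF h(1) this]
  have "(LBINT z. h z * (indicator {- b<..<0} (snd z) * k (fst z)))
      = (LBINT x. LBINT y. (indicator {- b<..<0} y * h (x, y)) * k x)"
    by (subst lborel2_fst) (simp_all add: mult_ac)
  also have "\<dots> = (LBINT x. b * (avg h x * k x))"
    using b_pos by (simp add: avg_def)
  finally show ?thesis
    by simp
qed

text \<open>Test functions \<phi>(x) \<theta>(y), with \<theta> tending to the indicator of the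
  strip, show that \<open>avg u1\<close> is the weak derivative of \<open>avg u\<close>.\<close>

lemma avg_ac:
  assumes "wdiff (1, 0) u u1"
  obtains c where "AE x in lborel. avg u x = ac c (avg u1) x"
proof -
  note D = wdiffD[OF assms]
  have A: "sq_int (avg u)" "\<And>x. x \<notin> {0<..<1} \<Longrightarrow> avg u x = 0"
    by (rule avg_sq_int[OF D(1,3)], assumption)+
  have A1: "sq_int (avg u1)" "\<And>x. x \<notin> {0<..<1} \<Longrightarrow> avg u1 x = 0"
    by (rule avg_sq_int[OF D(2,4)], assumption)+
  have rep: "borel_rep {0<..<1} (avg u) (avg u)" "borel_rep {0<..<1} (avg u1) (avg u1)"
    using A A1 by (auto intro!: borel_rep_self)
  have "(LBINT x. avg u x * dir_deriv 1 \<phi> x) = - (LBINT x. avg u1 x * \<phi> x)"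
    if \<phi>: "\<phi> \<in> test_functions {0<..<1}" for \<phi>
  proof -
    obtain \<theta> :: "nat \<Rightarrow> real \<Rightarrow> real" where \<theta>: "\<And>n. \<theta> n \<in> test_functions {- b<..<0}"
      "\<And>n x. 0 \<le> \<theta> n x" "\<And>n x. \<theta> n x \<le> 1" "\<And>x. (\<lambda>n. \<theta> n x) \<longlonglongrightarrow> indicator {- b<..<0} x"
      using test_functions_approx_indicator[of "- b" 0] by metis
    note \<phi>' = test_function_dir_deriv[OF \<phi>, of 1, simplified]
    have lim: "(\<lambda>n. LBINT z. (h z * k (fst z)) * \<theta> n (snd z)) \<longlonglongrightarrow> b * (LBINT x. avg h x * k x)"
      if h: "sq_int h" "\<And>z. z \<notin> Om \<Longrightarrow> h z = 0" and k: "k \<in> test_functions {0<..<1}" for h k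
    proof -
      obtain B where B: "\<And>x. \<bar>k x\<bar> \<le> B"
        using test_function_bounded[OF k] by blast
      have [measurable]: "k \<in> borel_measurable borel"
        by (rule test_function_measurable[OF k])
      have [measurable]: "\<theta> n \<in> borel_measurable borel" for n
        by (rule test_function_measurable[OF \<theta>(1)])
      have "(\<lambda>n. LBINT z. (h z * k (fst z)) * \<theta> n (snd z))
          \<longlonglongrightarrow> (LBINT z. (h z * k (fst z)) * indicator {- b<..<0} (snd z))"
      proof (rule integral_approx_tendsto)
        show "integrable lborel (\<lambda>z. h z * k (fst z))"
          by (rule integrable_mult_bounded[OF Om_integrable[OF h]]) (use B in auto)
        show "\<bar>\<theta> n (snd z)\<bar> \<le> 1" for n z
          using \<theta>(2,3)[of n "snd z"] by simp
        show "(\<lambda>n. \<theta> n (snd z)) \<longlonglongrightarrow> indicator {- b<..<0} (snd z)" for z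
          by (rule \<theta>(4))
      qed measurable
      also have "(LBINT z. (h z * k (fst z)) * indicator {- b<..<0} (snd z)) = b * (LBINT x. avg h x * k x)"
        using integral_avg_mult[OF h test_function_sq_int(1)[OF k]] by (simp add: mult_ac)
      finally show ?thesis .
    qed
    have "(LBINT z. (u z * dir_deriv 1 \<phi> (fst z)) * \<theta> n (snd z)) = - (LBINT z. (u1 z * \<phi> (fst z)) * \<theta> n (snd z))" for n
      using D(5)[OF test_function_pair(1)[OF \<phi> \<theta>(1) lower_subset]]
      by (simp add: test_function_pair(2)[OF \<phi> \<theta>(1) lower_subset] mult.assoc)
    then have "(\<lambda>n. LBINT z. (u z * dir_deriv 1 \<phi> (fst z)) * \<theta> n (snd z)) \<longlonglongrightarrow> - (b * (LBINT x. avg u1 x * \<phi> x))"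
      using tendsto_minus[OF lim[OF D(2,4) \<phi>]] by simp
    with lim[OF D(1,3) \<phi>'] have "b * (LBINT x. avg u x * dir_deriv 1 \<phi> x) = - (b * (LBINT x. avg u1 x * \<phi> x))"
      by (rule LIMSEQ_unique)
    then have "b * (LBINT x. avg u x * dir_deriv 1 \<phi> x) = b * (- (LBINT x. avg u1 x * \<phi> x))"
      by simp
    then show ?thesis
      using b_pos by (simp only: mult_cancel_left) simp
  qed
  then have "L2_weak_deriv {0<..<1} 1 (avg u) (avg u1)"
    by (subst L2_weak_deriv_borel_rep[OF _ rep]) auto
  from weak_deriv_imp_prim[OF rep this] obtain c
    where c: "AE x in lborel. x \<in> {0<..<1} \<longrightarrow> avg u x = c + prim (avg u1) x" .
  have "AE x in lborel. avg u x = ac c (avg u1) x"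
    using c by eventually_elim (use A(2) in \<open>auto simp: ac_def indicator_def\<close>)
  then show ?thesis
    using that by blast
qed

text \<open>Truncating at the column integral of \<open>\<bar>h\<bar>\<close> changes nothing on columns where \<open>h\<close> is integrable,
  and makes the bound of \<open>vprim\<close> hold on all columns.\<close>

definition vprim :: "(real \<times> real \<Rightarrow> real) \<Rightarrow> real \<times> real \<Rightarrow> real" where
  "vprim h z = (if \<bar>prim (\<lambda>t. h (fst z, t)) (snd z)\<bar> \<le> (LBINT t. \<bar>h (fst z, t)\<bar>)
     then prim (\<lambda>t. h (fst z, t)) (snd z) else 0)"

lemma vprim_bound: "\<bar>vprim h (x, y)\<bar> \<le> (LBINT t. \<bar>h (x, t)\<bar>)"
  by (simp add: vprim_def integral_nonneg_AE)

lemma vprim_eq: "integrable lborel (\<lambda>t. h (x, t)) \<Longrightarrow> vprim h (x, y) = prim (\<lambda>t. h (x, t)) y"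
  using abs_prim_le[of "\<lambda>t. h (x, t)" y] by (simp add: vprim_def)

lemma vprim_measurable:
  assumes "h \<in> borel_measurable borel"
  shows "vprim h \<in> borel_measurable borel"
proof -
  have [measurable]: "h \<in> borel_measurable (borel \<Otimes>\<^sub>M borel)"
    using assms by (simp add: borel_prod)
  have "(\<lambda>z. LBINT t. (if t \<le> snd z then h (fst z, t) else 0)) \<in> borel_measurable (borel \<Otimes>\<^sub>M borel)"
    by measurable
  also have "(\<lambda>z. LBINT t. (if t \<le> snd z then h (fst z, t) else 0)) = (\<lambda>z. prim (\<lambda>t. h (fst z, t)) (snd z))"
    unfolding prim_def by (intro ext Bochner_Integration.integral_cong) (auto simp: indicator_def)
  finally have [measurable]: "(\<lambda>z. prim (\<lambda>t. h (fst z, t)) (snd z)) \<in> borel_measurable (borel \<Otimes>\<^sub>M borel)" .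
  have "vprim h \<in> borel_measurable (borel \<Otimes>\<^sub>M borel)"
    unfolding vprim_def[abs_def] by measurable
  then show ?thesis
    by (simp add: borel_prod)
qed

lemma column_abs_sq_int:
  assumes h: "sq_int h" "\<And>z. z \<notin> Om \<Longrightarrow> h z = 0"
  shows "sq_int (\<lambda>x. LBINT t. \<bar>h (x, t)\<bar>)" "l2 (\<lambda>x. LBINT t. \<bar>h (x, t)\<bar>) \<le> sqrt (b + M) * l2 h"
proof -
  have a: "sq_int (\<lambda>z. \<bar>h z\<bar>)"
    using h(1) by (auto simp: sq_int_def)
  have le: "- b \<le> M"
    using b_pos M_nonneg by simp
  have 0: "\<bar>h z\<bar> = 0" if "snd z \<notin> {- b<..M}" for z
    using supp_snd[OF h(2) that] by simp
  show "sq_int (\<lambda>x. LBINT t. \<bar>h (x, t)\<bar>)" "l2 (\<lambda>x. LBINT t. \<bar>h (x, t)\<bar>) \<le> sqrt (b + M) * l2 h"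
    using column_integral_sq_int[OF a 0 le] by (simp_all add: l2_def add.commute)
qed

text \<open>After subtraction of the vertical primitive of v the remainder D has zero weak
  derivative in y, so on a rectangle inside \<open>Om\<close> it depends on x alone. The rectangles
  used all stand on the bottom y = - b and cover the strip over their base. On each of them the
  value is therefore the strip mean of D, and the values on different rectangles agree
  automatically.\<close>

lemma vertical_structure:
  assumes "wdiff (0, 1) u v"
  shows "\<exists>c. sq_int c \<and> (AE x in lborel. c x = avg u x - avg (\<lambda>z. indicator Om z * vprim v z) x) \<and>
    (AE z in lborel. z \<in> Om \<longrightarrow> u z = c (fst z) + vprim v z)"
proof -
  note W = wdiffD[OF assms]
  have [measurable]: "u \<in> borel_measurable borel" "v \<in> borel_measurable borel"
    using W by (auto simp: sq_int_def)
  have [measurable]: "vprim v \<in> borel_measurable borel"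
    by (rule vprim_measurable) simp
  define U where "U z = indicator Om z * vprim v z" for z
  define D where "D z = u z - U z" for z
  define K where "K x = (LBINT t. \<bar>v (x, t)\<bar>)" for x
  have K: "sq_int K"
    unfolding K_def by (rule column_abs_sq_int(1)[OF W(2,4)])
  have U_sq: "sq_int U"
  proof (rule l2_mono(1))
    show "sq_int (\<lambda>z. indicator Om z * K (fst z))"
      using M_nonneg b_pos Om_subset
      by (intro strip_sq_int(1)[OF K, where B = 1 and p = "- b" and q = M]) (auto simp: indicator_def dest!: subsetD)
    show "U \<in> borel_measurable borel"
      unfolding U_def by measurable
    show "\<bar>U z\<bar> \<le> \<bar>indicator Om z * K (fst z)\<bar>" for z
      using vprim_bound[of v "fst z" "snd z"] by (auto simp: U_def K_def indicator_def)
  qed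
  have U0: "U z = 0" if "z \<notin> Om" for z
    using that by (simp add: U_def)
  have D: "sq_int D" "\<And>z. z \<notin> Om \<Longrightarrow> D z = 0"
    using sq_int_diff[OF W(1) U_sq] W(3) U0 by (auto simp: D_def[abs_def])
  define c where "c = avg D"
  note c = avg_sq_int[OF D, folded c_def]
  have D_int: "integrable lborel D"
    by (rule Om_integrable[OF D])
  have v_slice: "AE x in lborel. integrable lborel (\<lambda>t. v (x, t))"
    by (rule lborel2_AE[OF Om_integrable[OF W(2,4)]])
  have rect: "AE z in lborel. z \<in> {p<..<q} \<times> {- b<..<t} \<longrightarrow> D z = c (fst z)"
    if sub: "{p<..<q} \<times> {- b<..<t} \<subseteq> Om" and t: "0 \<le> t" for p q t
  proof -
    let ?R = "{p<..<q} \<times> {- b<..<t}"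
    have R [measurable]: "?R \<in> sets borel"
      by (intro borel_open open_Times) auto
    have cI: "integrable lborel (\<lambda>x. indicator {p<..<q} x * c x)"
      by (intro integrable_indicator_mult c) auto
    have tI: "integrable lborel (indicator {- b<..<t} :: real \<Rightarrow> real)"
      using t b_pos by (intro integrable_real_indicator) auto
    define E where "E z = indicator ?R z * D z - (indicator {p<..<q} (fst z) * c (fst z)) * indicator {- b<..<t} (snd z)" for z
    have E: "integrable lborel E"
      unfolding E_def
      by (intro Bochner_Integration.integrable_diff integrable_indicator_mult D_int R integrable_product(1)[OF cI tI])
    have zero: "(LBINT z. E z * (\<phi> (fst z) * \<zeta> (snd z))) = 0"
      if \<phi>: "\<phi> \<in> test_functions {p<..<q}" and \<zeta>: "\<zeta> \<in> test_functions {- b<..<t}" for \<phi> \<zeta>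
    proof -
      obtain B where B: "\<And>x. \<bar>\<phi> x\<bar> \<le> B"
        using test_function_bounded[OF \<phi>] by blast
      have [measurable]: "\<phi> \<in> borel_measurable borel"
        by (rule test_function_measurable[OF \<phi>])
      have D\<phi>: "integrable lborel (\<lambda>z. D z * \<phi> (fst z))"
        by (rule integrable_mult_bounded[OF D_int]) (use B in auto)
      \<comment> \<open>Integrating out the horizontal factor leaves a one-dimensional statement in
        y.\<close>
      define h where "h y = (LBINT x. D (x, y) * \<phi> x)" for y
      have h: "integrable lborel h"
        using lborel2_integrable_snd[OF D\<phi>] by (simp add: h_def[abs_def])
      have h_eq: "(LBINT z. D z * \<phi> (fst z) * k (snd z)) = (LBINT y. h y * k y)"
        if "k \<in> borel_measurable borel" "\<And>y. \<bar>k y\<bar> \<le> B'" for k B'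
      proof -
        have "integrable lborel (\<lambda>z. D z * \<phi> (fst z) * k (snd z))"
          using that by (intro integrable_mult_bounded[OF D\<phi>, where B = B']) auto
        from lborel2_snd[OF this] show ?thesis
          by (simp add: h_def)
      qed
      have "(LBINT y. h y * dir_deriv 1 \<psi> y) = 0" if \<psi>: "\<psi> \<in> test_functions {- b<..<t}" for \<psi>
      proof -
        note P = test_function_pair[OF \<phi> \<psi> sub]
        note \<psi>' = test_function_dir_deriv[OF \<psi>, of 1, simplified]
        note P' = test_function_pair(1)[OF \<phi> \<psi>' sub]
        obtain B' where B': "\<And>y. \<bar>dir_deriv 1 \<psi> y\<bar> \<le> B'"
          using test_function_bounded[OF \<psi>'] by blast
        have sqP: "sq_int (\<lambda>z. \<phi> (fst z) * dir_deriv 1 \<psi> (snd z))"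
          by (rule test_function_sq_int(1)[OF P'])
        have "(LBINT y. h y * dir_deriv 1 \<psi> y) = (LBINT z. D z * \<phi> (fst z) * dir_deriv 1 \<psi> (snd z))"
          by (rule h_eq[OF test_function_measurable[OF \<psi>'] B', symmetric])
        also have "\<dots> = (LBINT z. u z * (\<phi> (fst z) * dir_deriv 1 \<psi> (snd z)) - U z * (\<phi> (fst z) * dir_deriv 1 \<psi> (snd z)))"
          by (simp add: D_def algebra_simps)
        also have "\<dots> = (LBINT z. u z * (\<phi> (fst z) * dir_deriv 1 \<psi> (snd z)))
            - (LBINT z. U z * (\<phi> (fst z) * dir_deriv 1 \<psi> (snd z)))"
          by (intro Bochner_Integration.integral_diff sq_int_mult_integrable W U_sq sqP)
        also have "(LBINT z. u z * (\<phi> (fst z) * dir_deriv 1 \<psi> (snd z))) = - (LBINT z. v z * (\<phi> (fst z) * \<psi> (snd z)))"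
          using W(5)[OF P(1)] by (simp add: P(3))
        also have "(LBINT z. v z * (\<phi> (fst z) * \<psi> (snd z))) = (LBINT x. LBINT y. v (x, y) * (\<phi> x * \<psi> y))"
          using lborel2_fst[OF sq_int_mult_integrable[OF W(2) test_function_sq_int(1)[OF P(1)]]] by simp
        also have "(LBINT z. U z * (\<phi> (fst z) * dir_deriv 1 \<psi> (snd z)))
            = (LBINT x. LBINT y. U (x, y) * (\<phi> x * dir_deriv 1 \<psi> y))"
          using lborel2_fst[OF sq_int_mult_integrable[OF U_sq sqP]] by simp
        \<comment> \<open>On almost every column v is integrable, and there
          \<open>prim_parts\<close> moves the derivative from \<psi> to the primitive.\<close>
        also have "\<dots> = (LBINT x. - (LBINT y. v (x, y) * (\<phi> x * \<psi> y)))"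
        proof (rule integral_cong_AE)
          show "AE x in lborel. (LBINT y. U (x, y) * (\<phi> x * dir_deriv 1 \<psi> y)) = - (LBINT y. v (x, y) * (\<phi> x * \<psi> y))"
            using v_slice
          proof eventually_elim
            case (elim x)
            have "U (x, y) * (\<phi> x * dir_deriv 1 \<psi> y) = \<phi> x * (prim (\<lambda>t. v (x, t)) y * dir_deriv 1 \<psi> y)" for y
              using vprim_eq[of v x y, OF elim] test_function_zero[OF P', of "(x, y)"] by (cases "(x, y) \<in> Om") (auto simp: U_def)
            then have "(LBINT y. U (x, y) * (\<phi> x * dir_deriv 1 \<psi> y))
                = (LBINT y. \<phi> x * (prim (\<lambda>t. v (x, t)) y * dir_deriv 1 \<psi> y))"
              by (intro Bochner_Integration.integral_cong refl)
            also have "\<dots> = \<phi> x * (LBINT y. prim (\<lambda>t. v (x, t)) y * dir_deriv 1 \<psi> y)"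
              by simp
            also have "(LBINT y. prim (\<lambda>t. v (x, t)) y * dir_deriv 1 \<psi> y) = - (LBINT y. v (x, y) * \<psi> y)"
              using prim_parts[OF elim test_function_prim(3)[OF \<psi>]] test_function_prim(1,2)[OF \<psi>] by simp
            finally show ?case
              by (simp add: mult.left_commute)
          qed
        qed (use borel_measurable_slice(3)[OF sq_intD(1)[OF U_sq]] in
              \<open>use lborel2_integrable[OF sq_int_mult_integrable[OF U_sq sqP]]
                 lborel2_integrable[OF sq_int_mult_integrable[OF W(2) test_function_sq_int(1)[OF P(1)]]] in auto\<close>)
        finally show ?thesis
          by simp
      qed
      \<comment> \<open>The reference interval is the strip, so the constant is the strip mean of h,
        which is the integral of \<phi> times c.\<close>
      note dBR = du_Bois_Reymond[OF h, of "- b" t "- b" 0, OF _ _ _ t this \<zeta>]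
      obtain B' where B': "\<And>y. \<bar>\<zeta> y\<bar> \<le> B'"
        using test_function_bounded[OF \<zeta>] by blast
      have "E z * (\<phi> (fst z) * \<zeta> (snd z)) = D z * \<phi> (fst z) * \<zeta> (snd z) - (\<phi> (fst z) * c (fst z)) * \<zeta> (snd z)" for z
        using test_function_zero[OF \<phi>, of "fst z"] test_function_zero[OF \<zeta>, of "snd z"]
        by (cases "z \<in> ?R") (auto simp: E_def mem_Times_iff algebra_simps)
      moreover have "integrable lborel (\<lambda>z. D z * \<phi> (fst z) * \<zeta> (snd z))"
        by (rule integrable_mult_bounded[OF D\<phi>, where B = B']) (use B' test_function_measurable[OF \<zeta>] in auto)
      moreover have c\<phi>: "integrable lborel (\<lambda>x. \<phi> x * c x)"
        using integrable_mult_bounded[OF c(3), of \<phi> B] B by (simp add: mult.commute)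
      ultimately have "(LBINT z. E z * (\<phi> (fst z) * \<zeta> (snd z)))
          = (LBINT y. h y * \<zeta> y) - (LBINT x. \<phi> x * c x) * (LBINT y. \<zeta> y)"
        using integrable_product[OF c\<phi> test_function_sq_int(2)[OF \<zeta>]]
          h_eq[OF test_function_measurable[OF \<zeta>] B'] by simp
      moreover have "(LBINT y. h y * indicator {- b<..<0} y) = b * (LBINT x. \<phi> x * c x)"
      proof -
        have "(LBINT y. h y * indicator {- b<..<0} y) = (LBINT z. D z * \<phi> (fst z) * indicator {- b<..<0} (snd z))"
          by (rule h_eq[symmetric, where B' = 1]) auto
        also have "\<dots> = b * (LBINT x. \<phi> x * c x)"
          using integral_avg_mult[OF D test_function_sq_int(1)[OF \<phi>]] by (simp add: c_def mult_ac)
        finally show ?thesis .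
      qed
      ultimately show ?thesis
        using dBR b_pos t by simp
    qed
    have "AE z in lborel. z \<in> ?R \<longrightarrow> E z = 0"
      by (rule AE_zero_if_product_test_integrals_zero[OF E zero])
    then show ?thesis
      by eventually_elim (auto simp: E_def mem_Times_iff)
  qed
  \<comment> \<open>Rational corners make the family countable, so the exceptional null sets can be
    united.\<close>
  define Q where "Q = {(p, q, t). p \<in> \<rat> \<and> q \<in> \<rat> \<and> t \<in> \<rat> \<and> 0 \<le> t \<and> {p<..<q} \<times> {- b<..<t} \<subseteq> Om}"
  have "countable (\<rat> \<times> \<rat> \<times> (\<rat> :: real set))"
    by (intro countable_SIGMA countable_rat)
  then have Q: "countable Q"
    by (rule countable_subset[rotated]) (auto simp: Q_def)
  have cover: "\<exists>(p, q, t)\<in>Q. z \<in> {p<..<q} \<times> {- b<..<t}" if z: "z \<in> Om" for z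
  proof (cases "snd z < 0")
    case True
    then show ?thesis
      using z lower_subset by (intro bexI[of _ "(0, 1, 0)"]) (auto simp: Q_def mem_Om mem_Times_iff)
  next
    case False
    obtain t where t: "t \<in> \<rat>" "snd z < t" "t < g (fst z)"
      using Rats_dense_in_real[of "snd z" "g (fst z)"] z by (auto simp: mem_Om)
    \<comment> \<open>The slice at a height t above the point is open and contains a neighbourhood
      of its abscissa; below height t the rectangle over it lies in \<open>Om\<close>, since columns
      reach down to - b.\<close>
    have "open ((\<lambda>x. (x, t)) -` Om)"
      by (intro open_vimage open_Om continuous_intros)
    moreover have "fst z \<in> (\<lambda>x. (x, t)) -` Om"
      using z t by (auto simp: mem_Om)
    ultimately obtain e where e: "e > 0" "\<And>x. \<bar>x - fst z\<bar> < e \<Longrightarrow> (x, t) \<in> Om"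
      by (auto simp: open_dist dist_real_def)
    obtain p where p: "p \<in> \<rat>" "fst z - e < p" "p < fst z"
      using Rats_dense_in_real[of "fst z - e" "fst z"] e by auto
    obtain q where q: "q \<in> \<rat>" "fst z < q" "q < fst z + e"
      using Rats_dense_in_real[of "fst z" "fst z + e"] e by auto
    have "w \<in> Om" if w: "w \<in> {p<..<q} \<times> {- b<..<t}" for w
    proof -
      have "\<bar>fst w - fst z\<bar> < e"
        using p q w by (auto simp: mem_Times_iff abs_less_iff)
      from e(2)[OF this] show ?thesis
        using w by (auto simp: mem_Om mem_Times_iff)
    qed
    then show ?thesis
      using z t p q False by (intro bexI[of _ "(p, q, t)"]) (auto simp: Q_def mem_Om mem_Times_iff)
  qed
  have "AE z in lborel. \<forall>r\<in>Q. (case r of (p, q, t) \<Rightarrow> z \<in> {p<..<q} \<times> {- b<..<t} \<longrightarrow> D z = c (fst z))"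
    by (subst AE_ball_countable[OF Q]) (auto simp: Q_def intro!: rect)
  then have "AE z in lborel. z \<in> Om \<longrightarrow> u z = c (fst z) + vprim v z"
    by eventually_elim (use cover in \<open>fastforce simp: D_def U_def\<close>)
  moreover have u_int: "integrable lborel u" and U_int: "integrable lborel U"
    by (rule Om_integrable[OF W(1,3)] Om_integrable[OF U_sq U0], assumption)+
  have "AE x in lborel. c x = avg u x - avg U x"
    using lborel2_AE[OF u_int] lborel2_AE[OF U_int]
  proof eventually_elim
    case (elim x)
    have "(LBINT y. indicator {- b<..<0} y * u (x, y) - indicator {- b<..<0} y * U (x, y))
      = (LBINT y. indicator {- b<..<0} y * u (x, y)) - (LBINT y. indicator {- b<..<0} y * U (x, y))"
      by (intro Bochner_Integration.integral_diff integrable_indicator_mult elim) auto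
    then show ?case
      by (simp add: c_def avg_def D_def right_diff_distrib diff_divide_distrib)
  qed
  ultimately show ?thesis
    using c(1) by (auto simp: U_def[abs_def])
qed

text \<open>By \<open>vertical_structure\<close> the difference is a vertical primitive minus its
  strip mean. Each is bounded by the column integral of the modulus of v, hence the factor 2. One
  factor sqrt (b + M) comes from Cauchy-Schwarz on a column, the other from a function of x living
  on the height of the domain.\<close>

lemma oscillation_bound:
  assumes "wdiff (0, 1) u v"
  shows "sq_int (\<lambda>z. indicator Om z * (u z - avg u (fst z)))"
    "l2 (\<lambda>z. indicator Om z * (u z - avg u (fst z))) \<le> 2 * (b + M) * l2 v"
proof -
  note W = wdiffD[OF assms]
  define K where "K x = (LBINT t. \<bar>v (x, t)\<bar>)" for x
  have K: "sq_int K" "l2 K \<le> sqrt (b + M) * l2 v"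
    using column_abs_sq_int[OF W(2,4)] by (simp_all add: K_def[abs_def])
  have K0: "0 \<le> K x" for x
    by (simp add: K_def integral_nonneg_AE)
  let ?U = "\<lambda>z. indicator Om z * vprim v z"
  obtain c where c: "AE x in lborel. c x = avg u x - avg ?U x"
    "AE z in lborel. z \<in> Om \<longrightarrow> u z = c (fst z) + vprim v z"
    using vertical_structure[OF assms] by blast
  have avgU: "\<bar>avg ?U x\<bar> \<le> K x" for x
  proof -
    have "\<bar>LBINT y. indicator {- b<..<0} y * ?U (x, y)\<bar> \<le> (LBINT y. \<bar>indicator {- b<..<0} y * ?U (x, y)\<bar>)"
      by (rule integral_abs_bound)
    also have "\<dots> \<le> (LBINT y. indicator {- b<..<0} y * K x)"
    proof (rule integral_mono)
      have [measurable]: "vprim v \<in> borel_measurable borel"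
        by (rule vprim_measurable[OF sq_intD(1)[OF W(2)]])
      have m: "(\<lambda>z. indicator Om z * vprim v z) \<in> borel_measurable borel"
        by measurable
      show int: "integrable lborel (\<lambda>y. indicator {- b<..<0} y * K x)"
        using b_pos by (intro integrable_mult_left integrable_real_indicator) auto
      show le: "\<bar>indicator {- b<..<0} y * ?U (x, y)\<bar> \<le> indicator {- b<..<0} y * K x" for y
        using vprim_bound[of v x y] K0[of x] by (auto simp: indicator_def K_def)
      show "integrable lborel (\<lambda>y. \<bar>indicator {- b<..<0} y * ?U (x, y)\<bar>)"
        by (rule integrable_abs, rule integrable_bounded_by[OF int _ le]) (use borel_measurable_slice(1)[OF m, of x] in auto)
    qed
    also have "\<dots> = b * K x"
      using b_pos by simp
    finally show ?thesis
      using b_pos by (simp add: avg_def field_simps)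
  qed
  have ae: "AE z in lborel. \<bar>indicator Om z * (u z - avg u (fst z))\<bar> \<le> \<bar>2 * (indicator Om z * K (fst z))\<bar>"
    using AE_lborel2_fst[OF c(1)] c(2)
  proof eventually_elim
    case (elim z)
    show ?case
    proof (cases "z \<in> Om")
      case True
      then have "u z - avg u (fst z) = vprim v z - avg ?U (fst z)"
        using elim by simp
      moreover have "\<bar>vprim v z\<bar> \<le> K (fst z)"
        using vprim_bound[of v "fst z" "snd z"] by (simp add: K_def)
      ultimately show ?thesis
        using True avgU[of "fst z"] K0[of "fst z"] by simp
    qed simp
  qed
  define m :: "real \<times> real \<Rightarrow> real" where "m z = 2 * indicator Om z" for z
  have m: "m \<in> borel_measurable borel" "\<bar>m z\<bar> \<le> 2 * indicator {- b..M} (snd z)" for z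
    using Om_subset by (auto simp: m_def[abs_def] indicator_def dest!: subsetD)
  have "- b \<le> M"
    using M_nonneg b_pos by simp
  note S = strip_sq_int[OF K(1) m this, simplified]
  have meas: "(\<lambda>z. indicator Om z * (u z - avg u (fst z))) \<in> borel_measurable borel"
  proof -
    have [measurable]: "u \<in> borel_measurable borel" "avg u \<in> borel_measurable borel"
      using W(1) avg_sq_int(1)[OF W(1,3)] by (auto simp: sq_int_def)
    show ?thesis
      by measurable
  qed
  have sqle: "AE z in lborel. (indicator Om z * (u z - avg u (fst z)))\<^sup>2 \<le> (m z * K (fst z))\<^sup>2"
    using ae by eventually_elim (simp only: abs_le_square_iff[symmetric] m_def mult.assoc)
  show sq: "sq_int (\<lambda>z. indicator Om z * (u z - avg u (fst z)))"
    unfolding sq_int_def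
    by (intro conjI meas Bochner_Integration.integrable_bound[OF sq_intD(3)[OF S(1)]])
       (use meas sqle in \<open>auto elim!: eventually_mono\<close>)
  have "l2 (\<lambda>z. indicator Om z * (u z - avg u (fst z))) \<le> l2 (\<lambda>z. m z * K (fst z))"
    unfolding l2_def
    by (intro real_sqrt_le_mono integral_mono_AE sq_intD(3)[OF sq] sq_intD(3)[OF S(1)] sqle)
  also have "\<dots> \<le> 2 * sqrt (M + b) * l2 K"
    by (rule S(2))
  also have "\<dots> \<le> 2 * sqrt (M + b) * (sqrt (b + M) * l2 v)"
    using K(2) M_nonneg b_pos by (intro mult_left_mono) auto
  also have "\<dots> = 2 * (b + M) * l2 v"
    using M_nonneg b_pos by (simp add: add.commute)
  finally show "l2 (\<lambda>z. indicator Om z * (u z - avg u (fst z))) \<le> 2 * (b + M) * l2 v" .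
qed

end

section \<open>Oscillating test functions\<close>

lemma has_derivative_linear_at_one:
  fixes D :: "real \<times> real \<Rightarrow> real"
  assumes "bounded_linear D"
  shows "D (h, 0) = D (1, 0) * h" "D (0, h) = D (0, 1) * h"
proof -
  interpret bounded_linear D by fact
  show "D (h, 0) = D (1, 0) * h" "D (0, h) = D (0, 1) * h"
    using scale[of h "(1, 0)"] scale[of h "(0, 1)"] by simp_all
qed

lemma slice_deriv:
  fixes \<zeta> :: "real \<times> real \<Rightarrow> real"
  assumes "Ck (Suc k) \<zeta>"
  shows "((\<lambda>x. \<zeta> (x, y)) has_real_derivative dir_deriv (1, 0) \<zeta> (x, y)) (at x)"
    and "((\<lambda>y. \<zeta> (x, y)) has_real_derivative dir_deriv (0, 1) \<zeta> (x, y)) (at y)"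
proof -
  note D = Ck_SucD[OF assms, of "(x, y)"]
  have d1: "((\<lambda>x. (x, y)) has_derivative (\<lambda>h. (h, 0))) (at x)"
    and d2: "((\<lambda>y. (x, y)) has_derivative (\<lambda>h. (0, h))) (at y)"
    by (auto intro!: derivative_eq_intros)
  show "((\<lambda>x. \<zeta> (x, y)) has_real_derivative dir_deriv (1, 0) \<zeta> (x, y)) (at x)"
    unfolding has_field_derivative_def
    by (rule has_derivative_eq_rhs[OF has_derivative_compose[OF d1 D]])
       (rule ext, rule has_derivative_linear_at_one(1)[OF has_derivative_bounded_linear[OF D]])
  show "((\<lambda>y. \<zeta> (x, y)) has_real_derivative dir_deriv (0, 1) \<zeta> (x, y)) (at y)"
    unfolding has_field_derivative_def
    by (rule has_derivative_eq_rhs[OF has_derivative_compose[OF d2 D]])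
       (rule ext, rule has_derivative_linear_at_one(2)[OF has_derivative_bounded_linear[OF D]])
qed

lemma Ck_slice:
  fixes \<zeta> :: "real \<times> real \<Rightarrow> real"
  assumes "Ck k \<zeta>"
  shows "Ck k (\<lambda>x. \<zeta> (x, y))" "Ck k (\<lambda>y. \<zeta> (x, y))"
proof -
  have "Ck k (\<lambda>x. \<zeta> (x, y)) \<and> Ck k (\<lambda>y. \<zeta> (x, y))"
    using assms
  proof (induction k arbitrary: \<zeta>)
    case 0
    then show ?case
      by (auto intro!: continuous_on_compose2[of UNIV \<zeta>] continuous_intros)
  next
    case (Suc k)
    have "Ck k (dir_deriv (1, 0) \<zeta>)" "Ck k (dir_deriv (0, 1) \<zeta>)"
      using Suc.prems by (simp_all add: Basis_real_pair)
    note IH = Suc.IH[OF this(1)] Suc.IH[OF this(2)]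
    show ?case
      using Ck_real_SucI[OF slice_deriv(1)[OF Suc.prems]] Ck_real_SucI[OF slice_deriv(2)[OF Suc.prems]] IH by blast
  qed
  then show "Ck k (\<lambda>x. \<zeta> (x, y))" "Ck k (\<lambda>y. \<zeta> (x, y))"
    by auto
qed

lemma dir_deriv_real_eq:
  fixes \<phi> :: "real \<Rightarrow> real"
  assumes "(\<phi> has_real_derivative d) (at x)"
  shows "dir_deriv 1 \<phi> x = d"
  using fun_cong[OF frechet_derivative_at[OF assms[unfolded has_field_derivative_def]], of 1] by simp

text \<open>The weak derivatives of the oscillating test functions are verified line by line and
  then integrated; this needs slices of test functions to be test functions on the slices.\<close>

lemma test_function_slice:
  fixes \<zeta> :: "real \<times> real \<Rightarrow> real"
  assumes "\<zeta> \<in> test_functions \<Omega>"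
  shows "(\<lambda>x. \<zeta> (x, y)) \<in> test_functions {x. (x, y) \<in> \<Omega>}" "(\<lambda>y. \<zeta> (x, y)) \<in> test_functions {y. (x, y) \<in> \<Omega>}"
    "dir_deriv 1 (\<lambda>x. \<zeta> (x, y)) x = dir_deriv (1, 0) \<zeta> (x, y)"
    "dir_deriv 1 (\<lambda>y. \<zeta> (x, y)) y = dir_deriv (0, 1) \<zeta> (x, y)"
proof -
  obtain K where K: "compact K" "K \<subseteq> \<Omega>" "\<zeta> \<in> test_functions K"
    using assms by (rule test_function_supp)
  have c: "compact {x. (x, y) \<in> K}" "compact {y. (x, y) \<in> K}" for x y
  proof -
    have "compact (fst ` (K \<inter> (UNIV \<times> {y})))" "compact (snd ` (K \<inter> ({x} \<times> UNIV)))"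
      by (intro compact_continuous_image compact_Int_closed K closed_Times closed_UNIV closed_singleton continuous_intros)+
    moreover have "fst ` (K \<inter> (UNIV \<times> {y})) = {x. (x, y) \<in> K}" "snd ` (K \<inter> ({x} \<times> UNIV)) = {y. (x, y) \<in> K}"
      by force+
    ultimately show "compact {x. (x, y) \<in> K}" "compact {y. (x, y) \<in> K}"
      by auto
  qed
  note Ck = test_function_Ck[OF assms]
  show "(\<lambda>x. \<zeta> (x, y)) \<in> test_functions {x. (x, y) \<in> \<Omega>}"
    by (rule test_function_I[OF c(1)]) (use K(2) test_function_zero[OF K(3)] Ck_slice(1)[OF Ck] in auto)
  show "(\<lambda>y. \<zeta> (x, y)) \<in> test_functions {y. (x, y) \<in> \<Omega>}"
    by (rule test_function_I[OF c(2)]) (use K(2) test_function_zero[OF K(3)] Ck_slice(2)[OF Ck] in auto)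
  show "dir_deriv 1 (\<lambda>x. \<zeta> (x, y)) x = dir_deriv (1, 0) \<zeta> (x, y)"
    "dir_deriv 1 (\<lambda>y. \<zeta> (x, y)) y = dir_deriv (0, 1) \<zeta> (x, y)"
    by (rule dir_deriv_real_eq[OF slice_deriv(1)[OF Ck]] dir_deriv_real_eq[OF slice_deriv(2)[OF Ck]])+
qed

section \<open>Piecewise constant interpolation on a grid\<close>

definition grid_point :: "real \<Rightarrow> real \<Rightarrow> real \<Rightarrow> real" where
  "grid_point x0 l x = x0 + l * (of_int \<lceil>(x - x0) / l\<rceil> - 1)"

text \<open>Cells are open on the left and closed on the right, so a grid point belongs to the cell
  on its left; hence the ceiling minus 1. The same intervals occur in
  \<open>prim_increment\<close>.\<close>

lemma grid_point_bounds:
  assumes "l > 0"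
  shows "grid_point x0 l x < x" "x \<le> grid_point x0 l x + l"
proof -
  define r where "r = (x - x0) / l"
  have x: "x = x0 + l * r"
    using assms by (simp add: r_def)
  have "l * (of_int \<lceil>r\<rceil> - 1) < l * r" "l * r \<le> l * of_int \<lceil>r\<rceil>"
    using assms ceiling_correct[of r] by simp_all
  moreover have "grid_point x0 l x = x0 + l * (of_int \<lceil>r\<rceil> - 1)"
    by (simp add: grid_point_def r_def)
  ultimately show "grid_point x0 l x < x" "x \<le> grid_point x0 l x + l"
    by (simp_all add: x algebra_simps)
qed

lemma grid_interval_iff:
  assumes "l > 0"
  shows "x \<in> {x0 + l * of_int k<..x0 + l * (of_int k + 1)} \<longleftrightarrow> k = \<lceil>(x - x0) / l\<rceil> - 1"
proof -
  have "x \<in> {x0 + l * of_int k<..x0 + l * (of_int k + 1)} \<longleftrightarrow> of_int k < (x - x0) / l \<and> (x - x0) / l \<le> of_int k + 1"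
    using assms by (auto simp: field_simps)
  also have "\<dots> \<longleftrightarrow> k = \<lceil>(x - x0) / l\<rceil> - 1"
  proof
    assume "of_int k < (x - x0) / l \<and> (x - x0) / l \<le> of_int k + 1"
    then have "\<lceil>(x - x0) / l\<rceil> = k + 1"
      by (intro ceiling_unique) auto
    then show "k = \<lceil>(x - x0) / l\<rceil> - 1"
      by simp
  next
    assume "k = \<lceil>(x - x0) / l\<rceil> - 1"
    then show "of_int k < (x - x0) / l \<and> (x - x0) / l \<le> of_int k + 1"
      using ceiling_correct[of "(x - x0) / l"] by simp
  qed
  finally show ?thesis .
qed

lemma grid_point_measurable: "grid_point x0 l \<in> borel_measurable borel"
  unfolding grid_point_def[abs_def] by measurable

text \<open>On a cell the step function is constant, and the integral of the derivative is a
  difference of two values of \<xi> at grid points, both 0. Thus jumps at points where the test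
  function vanishes leave no trace in the weak derivative.\<close>

lemma step_function_integral_zero:
  fixes s \<xi> :: "real \<Rightarrow> real"
  assumes \<xi>: "\<xi> \<in> test_functions \<Omega>" and "l > 0" and zero: "\<And>k::int. \<xi> (x0 + l * of_int k) = 0"
  shows "(LBINT x. s (grid_point x0 l x) * dir_deriv 1 \<xi> x) = 0"
proof -
  note P = test_function_prim[OF \<xi>]
  obtain K where K: "compact K" "K \<subseteq> \<Omega>" "\<xi> \<in> test_functions K"
    using \<xi> by (rule test_function_supp)
  obtain N where N: "\<And>x. x \<in> K \<Longrightarrow> \<bar>x\<bar> \<le> N"
    using compact_imp_bounded[OF K(1)] by (auto simp: bounded_iff)
  \<comment> \<open>Only cells with index between -n and n can meet the support, so the sum is
    finite.\<close>
  define n where "n = \<lceil>(N + \<bar>x0\<bar>) / l\<rceil> + 1"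
  let ?k = "\<lambda>x. \<lceil>(x - x0) / l\<rceil> - 1"
  let ?I = "\<lambda>k::int. {x0 + l * of_int k<..x0 + l * (of_int k + 1)}"
  have "s (grid_point x0 l x) * dir_deriv 1 \<xi> x = (\<Sum>k\<in>{-n..n}. s (x0 + l * of_int k) * (indicator (?I k) x * dir_deriv 1 \<xi> x))" for x
  proof (cases "x \<in> K")
    case True
    have "\<bar>(x - x0) / l\<bar> \<le> (N + \<bar>x0\<bar>) / l"
      using N[OF True] \<open>l > 0\<close> by (auto simp: abs_divide intro!: divide_right_mono)
    then have "?k x \<in> {-n..n}"
      unfolding n_def by (auto simp: abs_le_iff; linarith)
    have "(\<Sum>k\<in>{-n..n}. s (x0 + l * of_int k) * (indicator (?I k) x * dir_deriv 1 \<xi> x))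
        = (\<Sum>k\<in>{-n..n}. if k = ?k x then s (x0 + l * of_int k) * dir_deriv 1 \<xi> x else 0)"
      unfolding indicator_def grid_interval_iff[OF \<open>l > 0\<close>] by (intro sum.cong) auto
    also have "\<dots> = s (x0 + l * of_int (?k x)) * dir_deriv 1 \<xi> x"
      using \<open>?k x \<in> {-n..n}\<close> by (simp only: sum.delta' finite_atLeastAtMost_int if_True sum.delta)
    finally show ?thesis
      by (simp add: grid_point_def)
  next
    case False
    then show ?thesis
      using test_function_dir_deriv_zero[OF K(3)] by simp
  qed
  then have "(LBINT x. s (grid_point x0 l x) * dir_deriv 1 \<xi> x)
      = (LBINT x. (\<Sum>k\<in>{-n..n}. s (x0 + l * of_int k) * (indicator (?I k) x * dir_deriv 1 \<xi> x)))"
    by simp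
  also have "\<dots> = (\<Sum>k\<in>{-n..n}. (LBINT x. s (x0 + l * of_int k) * (indicator (?I k) x * dir_deriv 1 \<xi> x)))"
    by (intro Bochner_Integration.integral_sum integrable_mult_right integrable_indicator_mult P(3)) auto
  also have "\<dots> = (\<Sum>k\<in>{-n..n}. s (x0 + l * of_int k) * (prim (dir_deriv 1 \<xi>) (x0 + l * (of_int k + 1)) - prim (dir_deriv 1 \<xi>) (x0 + l * of_int k)))"
    using \<open>l > 0\<close> by (intro sum.cong refl) (subst prim_increment[OF P(3)], auto)
  also have "\<dots> = 0"
  proof (intro sum.neutral ballI)
    fix k
    have "\<xi> (x0 + l * (of_int k + 1)) = 0"
      using zero[of "k + 1"] by simp
    then show "s (x0 + l * of_int k) * (prim (dir_deriv 1 \<xi>) (x0 + l * (of_int k + 1)) - prim (dir_deriv 1 \<xi>) (x0 + l * of_int k)) = 0"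
      by (simp add: P(1) zero)
  qed
  finally show ?thesis .
qed

text \<open>The squared increment is at most l times the integral of the square of v over the last
  stretch of length l before x. Integration in x counts each t over a length l, which supplies the
  second factor l.\<close>

lemma grid_difference_l2:
  assumes v: "sq_int v" "\<And>x. x \<notin> {0<..<1} \<Longrightarrow> v x = 0" and "l > 0"
  shows "sq_int (\<lambda>x. indicator {0<..<1} x * (prim v (grid_point x0 l x) - prim v x))" (is "sq_int ?D")
    and "l2 (\<lambda>x. indicator {0<..<1} x * (prim v (grid_point x0 l x) - prim v x)) \<le> l * l2 v"
proof -
  have int: "integrable lborel v"
    by (rule sq_int_integrable[OF v unit_fmeasurable])
  have [measurable]: "v \<in> borel_measurable borel" "prim v \<in> borel_measurable borel" "grid_point x0 l \<in> borel_measurable borel"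
    using int prim_measurable[of v] grid_point_measurable by auto
  show D: "sq_int ?D"
  proof (rule sq_int_bounded_supp[OF _ _ unit_fmeasurable])
    show "\<bar>?D x\<bar> \<le> (2 * (LBINT t. \<bar>v t\<bar>)) * indicator {0<..<1} x" for x
      using abs_prim_le[OF int, of x] abs_prim_le[OF int, of "grid_point x0 l x"] by (auto simp: indicator_def)
  qed measurable
  define F :: "real \<times> real \<Rightarrow> real" where "F z = indicator {fst z..fst z + l} (snd z) * (v (fst z))\<^sup>2" for z
  have F: "integrable lborel F"
  proof -
    have "integrable (lborel \<Otimes>\<^sub>M lborel) F"
    proof (rule lborel_pair.Fubini_integrable)
      show "F \<in> borel_measurable (lborel \<Otimes>\<^sub>M lborel)"
        unfolding F_def[abs_def] indicator_def atLeastAtMost_iff by measurable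
      show "integrable lborel (\<lambda>t. LBINT x. norm (F (t, x)))"
        using sq_intD(3)[OF v(1)] \<open>l > 0\<close> by (simp add: F_def abs_mult)
      show "AE t in lborel. integrable lborel (\<lambda>x. F (t, x))"
        using \<open>l > 0\<close> by (simp add: F_def)
    qed
    then show ?thesis
      by (simp add: lborel_prod)
  qed
  have Fint: "(LBINT x. LBINT t. F (t, x)) = l * (l2 v)\<^sup>2"
  proof -
    have "(LBINT x. LBINT t. F (t, x)) = (LBINT t. LBINT x. F (t, x))"
      using lborel2_snd[OF F] lborel2_fst[OF F] by (rule trans[OF sym])
    also have "\<dots> = (LBINT t. l * (v t)\<^sup>2)"
      using \<open>l > 0\<close> by (intro Bochner_Integration.integral_cong refl) (simp add: F_def)
    finally show ?thesis
      by (simp add: l2_square)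
  qed
  have Ieq: "(LBINT t. F (t, x)) = (LBINT t. indicator {x - l..x} t * (v t)\<^sup>2)" for x
    unfolding F_def by (intro Bochner_Integration.integral_cong refl) (auto simp: indicator_def)
  have le: "(?D x)\<^sup>2 \<le> l * (LBINT t. F (t, x))" for x
  proof -
    let ?p = "grid_point x0 l x"
    have gb: "?p < x" "x \<le> ?p + l"
      by (rule grid_point_bounds[OF \<open>l > 0\<close>])+
    have "(?D x)\<^sup>2 \<le> (prim v x - prim v ?p)\<^sup>2"
      by (auto simp: indicator_def power2_commute[of "prim v x"])
    also have "\<dots> \<le> (x - ?p) * (LBINT t. indicator {?p<..x} t * (v t)\<^sup>2)"
      using gb by (intro prim_increment_square_le v int) auto
    also have "\<dots> \<le> l * (LBINT t. indicator {x - l..x} t * (v t)\<^sup>2)"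
    proof (rule mult_mono)
      show "(LBINT t. indicator {?p<..x} t * (v t)\<^sup>2) \<le> (LBINT t. indicator {x - l..x} t * (v t)\<^sup>2)"
      proof (rule integral_mono)
        show "indicator {?p<..x} t * (v t)\<^sup>2 \<le> indicator {x - l..x} t * (v t)\<^sup>2" for t
          using gb by (auto simp: indicator_def)
      qed (intro integrable_indicator_mult sq_intD(3)[OF v(1)]; simp)+
    qed (use gb \<open>l > 0\<close> in \<open>auto intro!: integral_nonneg_AE\<close>)
    finally show ?thesis
      by (simp only: Ieq)
  qed
  have "(l2 ?D)\<^sup>2 \<le> (LBINT x. l * (LBINT t. F (t, x)))"
    unfolding l2_square
    by (rule integral_mono[OF sq_intD(3)[OF D] integrable_mult_right[OF lborel2_integrable_snd[OF F]] le])
  also have "\<dots> = (l * l2 v)\<^sup>2"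
    by (simp only: integral_mult_right_zero Fint power_mult_distrib power2_eq_square mult_ac)
  finally show "l2 ?D \<le> l * l2 v"
    by (rule power2_le_imp_le) (use \<open>l > 0\<close> l2_nonneg[of v] in simp)
qed

definition ramp :: "real \<Rightarrow> real \<Rightarrow> real" where
  "ramp \<delta> y = max 0 (min 1 (y / \<delta>))"

lemma ramp_prim:
  assumes "\<delta> > 0"
  shows "prim (\<lambda>t. indicator {0<..\<delta>} t / \<delta>) y = ramp \<delta> y"
proof -
  have "prim (\<lambda>t. indicator {0<..\<delta>} t / \<delta>) y = (LBINT t. indicator {0<..min \<delta> y} t / \<delta>)"
    unfolding prim_def by (intro Bochner_Integration.integral_cong refl) (auto simp: indicator_def)
  also have "\<dots> = ramp \<delta> y"
  proof (cases "0 \<le> y")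
    case True
    then show ?thesis
      using assms by (auto simp: ramp_def min_def max_def field_simps)
  next
    case False
    then have "{0<..min \<delta> y} = {}"
      by auto
    then show ?thesis
      using False assms by (simp add: ramp_def max_def min_def divide_simps)
  qed
  finally show ?thesis .
qed

lemma ramp_bounds:
  assumes "\<delta> > 0"
  shows "0 \<le> ramp \<delta> y" "ramp \<delta> y \<le> 1" "y \<le> 0 \<Longrightarrow> ramp \<delta> y = 0" "\<delta> \<le> y \<Longrightarrow> ramp \<delta> y = 1"
  using assms by (auto simp: ramp_def max_def min_def divide_simps)

lemma ramp_measurable [measurable]: "ramp \<delta> \<in> borel_measurable borel"
  unfolding ramp_def[abs_def] by measurable

lemma integral_affine_test:
  fixes \<xi> :: "real \<Rightarrow> real"
  assumes \<xi>: "\<xi> \<in> test_functions \<Omega>" and w: "integrable lborel w"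
  shows "integrable lborel (\<lambda>x. (a + prim w x) * dir_deriv 1 \<xi> x)"
    "(LBINT x. (a + prim w x) * dir_deriv 1 \<xi> x) = - (LBINT x. w x * \<xi> x)"
proof -
  note P = test_function_prim[OF \<xi>]
  have i: "integrable lborel (\<lambda>x. prim w x * dir_deriv 1 \<xi> x)"
    by (rule prim_mult_integrable[OF w P(3)])
  then show "integrable lborel (\<lambda>x. (a + prim w x) * dir_deriv 1 \<xi> x)"
    using P(3) by (simp add: distrib_right)
  show "(LBINT x. (a + prim w x) * dir_deriv 1 \<xi> x) = - (LBINT x. w x * \<xi> x)"
    using prim_parts[OF w P(3)] P i by (simp add: distrib_right)
qed

context column_domain
begin

text \<open>Equal to \<open>\<phi>\<close> for \<open>y \<le> 0\<close>, and to the value of \<open>\<phi>\<close> at the left end of the tooth for \<open>y \<ge> \<delta>\<close>. The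
  jumps are invisible in \<open>Om\<close>, since the grid points are zeros of \<open>g\<close>.\<close>

definition osc_test :: "real \<Rightarrow> real \<Rightarrow> real \<Rightarrow> real \<Rightarrow> (real \<Rightarrow> real) \<Rightarrow> real \<times> real \<Rightarrow> real" where
  "osc_test x0 l \<delta> a v z = indicator Om z * ((1 - ramp \<delta> (snd z)) * (a + prim v (fst z))
     + ramp \<delta> (snd z) * (a + prim v (grid_point x0 l (fst z))))"

definition osc_test1 :: "real \<Rightarrow> (real \<Rightarrow> real) \<Rightarrow> real \<times> real \<Rightarrow> real" where
  "osc_test1 \<delta> v z = indicator Om z * (1 - ramp \<delta> (snd z)) * v (fst z)"

definition osc_test2 :: "real \<Rightarrow> real \<Rightarrow> real \<Rightarrow> (real \<Rightarrow> real) \<Rightarrow> real \<times> real \<Rightarrow> real" where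
  "osc_test2 x0 l \<delta> v z = indicator Om z * (indicator {0<..\<delta>} (snd z) / \<delta>) *
     (prim v (grid_point x0 l (fst z)) - prim v (fst z))"

text \<open>The horizontal derivative is checked on lines y = const, where the function is a mixture
  of an absolutely continuous function and a step function with fixed weights. The vertical one is
  checked on columns, where it is a constant plus a multiple of the ramp.\<close>

lemma osc_test_wdiff:
  assumes v: "sq_int v" "\<And>x. x \<notin> {0<..<1} \<Longrightarrow> v x = 0" and "l > 0" "\<delta> > 0"
    and grid: "\<And>k::int. g (x0 + l * of_int k) = 0"
  shows "wdiff (1, 0) (osc_test x0 l \<delta> a v) (osc_test1 \<delta> v)"
    and "wdiff (0, 1) (osc_test x0 l \<delta> a v) (osc_test2 x0 l \<delta> v)"
proof -
  let ?\<Phi> = "osc_test x0 l \<delta> a v" and ?\<Phi>1 = "osc_test1 \<delta> v" and ?\<Phi>2 = "osc_test2 x0 l \<delta> v"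
  let ?A = "\<lambda>x. a + prim v x" and ?S = "\<lambda>x. a + prim v (grid_point x0 l x)"
  let ?\<kappa> = "\<lambda>t. indicator {0<..\<delta>} t / \<delta> :: real"
  have int: "integrable lborel v"
    by (rule sq_int_integrable[OF v unit_fmeasurable])
  have [measurable]: "v \<in> borel_measurable borel" "prim v \<in> borel_measurable borel" "grid_point x0 l \<in> borel_measurable borel"
    using int prim_measurable[of v] grid_point_measurable by auto
  note ramp = ramp_bounds[OF \<open>\<delta> > 0\<close>]
  define B where "B = (LBINT t. \<bar>v t\<bar>)"
  have B: "\<bar>prim v x\<bar> \<le> B" for x
    unfolding B_def by (rule abs_prim_le[OF int])
  have A: "\<bar>?A x\<bar> \<le> \<bar>a\<bar> + B" for x
    using B[of x] by simp
  have sq: "sq_int ?\<Phi>"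
  proof (rule sq_int_bounded_supp[OF _ _ Om_fmeasurable])
    show "?\<Phi> \<in> borel_measurable borel"
      unfolding osc_test_def[abs_def] by measurable
    show "\<bar>?\<Phi> z\<bar> \<le> (\<bar>a\<bar> + B) * indicator Om z" for z
    proof -
      have "\<bar>(1 - ramp \<delta> (snd z)) * ?A (fst z) + ramp \<delta> (snd z) * ?S (fst z)\<bar>
          \<le> (1 - ramp \<delta> (snd z)) * (\<bar>a\<bar> + B) + ramp \<delta> (snd z) * (\<bar>a\<bar> + B)"
        using ramp[of "snd z"] A
        by (intro order_trans[OF abs_triangle_ineq] add_mono) (auto simp: abs_mult intro!: mult_left_mono)
      then show ?thesis
        by (auto simp: osc_test_def indicator_def algebra_simps)
    qed
  qed
  have sq1: "sq_int ?\<Phi>1"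
    unfolding osc_test1_def[abs_def]
    by (rule strip_sq_int(1)[OF v(1), where B = 1 and p = "- b" and q = M])
       (use ramp b_pos M_nonneg Om_subset in \<open>auto simp: indicator_def abs_le_iff intro: order_trans[of _ 1] dest!: subsetD\<close>)
  have sq2: "sq_int ?\<Phi>2"
  proof (rule sq_int_bounded_supp[OF _ _ Om_fmeasurable])
    show "?\<Phi>2 \<in> borel_measurable borel"
      unfolding osc_test2_def[abs_def] by measurable
    show "\<bar>?\<Phi>2 z\<bar> \<le> (1 / \<delta> * (2 * B)) * indicator Om z" for z
      using B[of "fst z"] B[of "grid_point x0 l (fst z)"] \<open>\<delta> > 0\<close>
      by (auto simp: osc_test2_def indicator_def divide_right_mono)
  qed
  have zero: "?\<Phi> z = 0" "?\<Phi>1 z = 0" "?\<Phi>2 z = 0" if "z \<notin> Om" for z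
    using that by (auto simp: osc_test_def osc_test1_def osc_test2_def)
  have "(LBINT z. ?\<Phi> z * dir_deriv (1, 0) \<zeta> z) = - (LBINT z. ?\<Phi>1 z * \<zeta> z)"
    if \<zeta>: "\<zeta> \<in> test_functions Om" for \<zeta>
  proof -
    have d\<zeta>: "dir_deriv (1, 0) \<zeta> \<in> test_functions Om"
      by (rule test_function_dir_deriv[OF \<zeta>]) (simp add: Basis_real_pair)
    have "(LBINT x. ?\<Phi> (x, y) * dir_deriv (1, 0) \<zeta> (x, y)) = - (LBINT x. ?\<Phi>1 (x, y) * \<zeta> (x, y))" for y
    proof -
      define \<xi> where "\<xi> x = \<zeta> (x, y)" for x
      have \<xi>: "\<xi> \<in> test_functions {x. (x, y) \<in> Om}" and \<xi>': "dir_deriv 1 \<xi> x = dir_deriv (1, 0) \<zeta> (x, y)" for x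
        using test_function_slice(1,3)[OF \<zeta>] by (simp_all add: \<xi>_def[abs_def])
      note aff = integral_affine_test[OF \<xi> int, of a]
      have S_int: "integrable lborel (\<lambda>x. ?S x * dir_deriv 1 \<xi> x)"
        using integrable_mult_bounded[OF test_function_prim(3)[OF \<xi>], of ?S "\<bar>a\<bar> + B"] A by (simp add: mult.commute)
      \<comment> \<open>For y <= 0 the weight of the step function is 0; for y > 0 the grid points
        lie outside \<open>Om\<close>, so the test function vanishes at all of them.\<close>
      have step: "ramp \<delta> y * (LBINT x. ?S x * dir_deriv 1 \<xi> x) = 0"
      proof (cases "y \<le> 0")
        case False
        have "\<xi> (x0 + l * of_int k) = 0" for k
          using False grid[of k] test_function_zero[OF \<xi>, of "x0 + l * of_int k"] by (simp add: mem_Om)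
        then show ?thesis
          using step_function_integral_zero[OF \<xi> \<open>l > 0\<close>, of x0 ?A] by simp
      qed (simp add: ramp)
      have "?\<Phi> (x, y) * dir_deriv (1, 0) \<zeta> (x, y)
          = (1 - ramp \<delta> y) * (?A x * dir_deriv 1 \<xi> x) + ramp \<delta> y * (?S x * dir_deriv 1 \<xi> x)" for x
        using test_function_zero[OF d\<zeta>, of "(x, y)"]
        by (cases "(x, y) \<in> Om") (auto simp: osc_test_def \<xi>' algebra_simps)
      then have "(LBINT x. ?\<Phi> (x, y) * dir_deriv (1, 0) \<zeta> (x, y))
          = (LBINT x. (1 - ramp \<delta> y) * (?A x * dir_deriv 1 \<xi> x) + ramp \<delta> y * (?S x * dir_deriv 1 \<xi> x))"
        by simp
      also have "\<dots> = (1 - ramp \<delta> y) * (LBINT x. ?A x * dir_deriv 1 \<xi> x) + ramp \<delta> y * (LBINT x. ?S x * dir_deriv 1 \<xi> x)"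
        by (simp only: integrable_mult_right aff(1) S_int Bochner_Integration.integral_add integral_mult_right_zero)
      also have "\<dots> = - ((1 - ramp \<delta> y) * (LBINT x. v x * \<xi> x))"
        using aff(2) step by simp
      also have "(1 - ramp \<delta> y) * (LBINT x. v x * \<xi> x) = (LBINT x. (1 - ramp \<delta> y) * (v x * \<xi> x))"
        by simp
      also have "\<dots> = (LBINT x. ?\<Phi>1 (x, y) * \<zeta> (x, y))"
      proof (intro Bochner_Integration.integral_cong refl)
        show "(1 - ramp \<delta> y) * (v x * \<xi> x) = ?\<Phi>1 (x, y) * \<zeta> (x, y)" for x
          using test_function_zero[OF \<zeta>, of "(x, y)"] by (cases "(x, y) \<in> Om") (auto simp: osc_test1_def \<xi>_def)
      qed
      finally show ?thesis .
    qed
    then show ?thesis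
      using lborel2_snd[OF sq_int_mult_integrable[OF sq test_function_sq_int(1)[OF d\<zeta>]]]
        lborel2_snd[OF sq_int_mult_integrable[OF sq1 test_function_sq_int(1)[OF \<zeta>]]] by simp
  qed
  then show "wdiff (1, 0) ?\<Phi> ?\<Phi>1"
    using sq sq1 zero by (simp add: wdiff_def)
  have \<kappa>: "integrable lborel ?\<kappa>"
    using \<open>\<delta> > 0\<close> by (intro integrable_divide integrable_real_indicator) auto
  have "(LBINT z. ?\<Phi> z * dir_deriv (0, 1) \<zeta> z) = - (LBINT z. ?\<Phi>2 z * \<zeta> z)"
    if \<zeta>: "\<zeta> \<in> test_functions Om" for \<zeta>
  proof -
    have d\<zeta>: "dir_deriv (0, 1) \<zeta> \<in> test_functions Om"
      by (rule test_function_dir_deriv[OF \<zeta>]) (simp add: Basis_real_pair)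
    have "(LBINT y. ?\<Phi> (x, y) * dir_deriv (0, 1) \<zeta> (x, y)) = - (LBINT y. ?\<Phi>2 (x, y) * \<zeta> (x, y))" for x
    proof -
      define \<xi> where "\<xi> y = \<zeta> (x, y)" for y
      have \<xi>: "\<xi> \<in> test_functions {y. (x, y) \<in> Om}" and \<xi>': "dir_deriv 1 \<xi> y = dir_deriv (0, 1) \<zeta> (x, y)" for y
        using test_function_slice(2,4)[OF \<zeta>] by (simp_all add: \<xi>_def[abs_def])
      let ?d = "prim v (grid_point x0 l x) - prim v x"
      note aff = integral_affine_test[OF \<xi> \<kappa>, of 0, simplified]
      note P = test_function_prim[OF \<xi>]
      have "?\<Phi> (x, y) * dir_deriv (0, 1) \<zeta> (x, y)
          = ?A x * dir_deriv 1 \<xi> y + ?d * (prim ?\<kappa> y * dir_deriv 1 \<xi> y)" for y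
        using test_function_zero[OF d\<zeta>, of "(x, y)"]
        by (cases "(x, y) \<in> Om") (auto simp: osc_test_def \<xi>' ramp_prim[OF \<open>\<delta> > 0\<close>] algebra_simps)
      then have "(LBINT y. ?\<Phi> (x, y) * dir_deriv (0, 1) \<zeta> (x, y))
          = (LBINT y. ?A x * dir_deriv 1 \<xi> y + ?d * (prim ?\<kappa> y * dir_deriv 1 \<xi> y))"
        by simp
      also have "\<dots> = ?A x * (LBINT y. dir_deriv 1 \<xi> y) + ?d * (LBINT y. prim ?\<kappa> y * dir_deriv 1 \<xi> y)"
        by (simp only: integrable_mult_right aff(1) P(3) Bochner_Integration.integral_add integral_mult_right_zero)
      also have "\<dots> = - (?d * (LBINT y. ?\<kappa> y * \<xi> y))"
        using aff(2) P(2) by simp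
      also have "?d * (LBINT y. ?\<kappa> y * \<xi> y) = (LBINT y. ?d * (?\<kappa> y * \<xi> y))"
        by simp
      also have "\<dots> = (LBINT y. ?\<Phi>2 (x, y) * \<zeta> (x, y))"
      proof (intro Bochner_Integration.integral_cong refl)
        show "?d * (?\<kappa> y * \<xi> y) = ?\<Phi>2 (x, y) * \<zeta> (x, y)" for y
          using test_function_zero[OF \<zeta>, of "(x, y)"] by (cases "(x, y) \<in> Om") (auto simp: osc_test2_def \<xi>_def)
      qed
      finally show ?thesis .
    qed
    then show ?thesis
      using lborel2_fst[OF sq_int_mult_integrable[OF sq test_function_sq_int(1)[OF d\<zeta>]]]
        lborel2_fst[OF sq_int_mult_integrable[OF sq2 test_function_sq_int(1)[OF \<zeta>]]] by simp
  qed
  then show "wdiff (0, 1) ?\<Phi> ?\<Phi>2"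
    using sq sq2 zero by (simp add: wdiff_def)
qed

end

section \<open>Energy estimates\<close>

context column_domain
begin

definition weak_eq :: "real \<Rightarrow> (real \<times> real \<Rightarrow> real) \<Rightarrow> (real \<times> real \<Rightarrow> real) \<Rightarrow> (real \<times> real \<Rightarrow> real) \<Rightarrow> (real \<times> real \<Rightarrow> real) \<Rightarrow> bool" where
  "weak_eq \<epsilon> f u u1 u2 \<longleftrightarrow> sq_int f \<and> (\<forall>z. z \<notin> Om \<longrightarrow> f z = 0) \<and> wdiff (1, 0) u u1 \<and> wdiff (0, 1) u u2 \<and>
    (\<forall>\<Phi> \<Phi>1 \<Phi>2. wdiff (1, 0) \<Phi> \<Phi>1 \<longrightarrow> wdiff (0, 1) \<Phi> \<Phi>2 \<longrightarrow>
      (LBINT z. u1 z * \<Phi>1 z) + 1 / \<epsilon>\<^sup>2 * (LBINT z. u2 z * \<Phi>2 z) + (LBINT z. u z * \<Phi> z)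
        = (LBINT z. f z * \<Phi> z))"

text \<open>The solution is inserted as its own test function; the factor 1 / \<epsilon>^2 in the
  energy turns into the factor \<epsilon> in the bound of the vertical derivative.\<close>

lemma energy_bounds:
  assumes eq: "weak_eq \<epsilon> f u u1 u2" and "\<epsilon> > 0" and C: "l2 f \<le> C"
  shows "l2 u \<le> C" "l2 u1 \<le> C" "l2 u2 \<le> \<epsilon> * C"
proof -
  have W: "wdiff (1, 0) u u1" "wdiff (0, 1) u u2" and f: "sq_int f"
    using eq by (auto simp: weak_eq_def)
  have C0: "0 \<le> C"
    using l2_nonneg[of f] C by linarith
  have "(l2 u1)\<^sup>2 + 1 / \<epsilon>\<^sup>2 * (l2 u2)\<^sup>2 + (l2 u)\<^sup>2 = (LBINT z. f z * u z)"
  proof -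
    have "(LBINT z. u1 z * u1 z) + 1 / \<epsilon>\<^sup>2 * (LBINT z. u2 z * u2 z) + (LBINT z. u z * u z)
        = (LBINT z. f z * u z)"
      using eq W unfolding weak_eq_def by blast
    then show ?thesis
      unfolding l2_square by (simp add: power2_eq_square)
  qed
  also have "\<dots> \<le> l2 f * l2 u"
    using Cauchy_Schwarz_l2[OF f wdiffD(1)[OF W(1)]] by linarith
  also have "\<dots> \<le> C * l2 u"
    by (rule mult_right_mono[OF C l2_nonneg])
  finally have E: "(l2 u1)\<^sup>2 + 1 / \<epsilon>\<^sup>2 * (l2 u2)\<^sup>2 + (l2 u)\<^sup>2 \<le> C * l2 u" .
  have nn: "0 \<le> 1 / \<epsilon>\<^sup>2 * (l2 u2)\<^sup>2"
    by simp
  then have "l2 u * l2 u \<le> C * l2 u"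
    using E zero_le_power2[of "l2 u1"] by (simp only: power2_eq_square)
  then show u: "l2 u \<le> C"
    using l2_nonneg[of u] C0 by (cases "l2 u = 0") auto
  have "C * l2 u \<le> C\<^sup>2"
    using u C0 by (simp add: power2_eq_square mult_left_mono)
  then have "(l2 u1)\<^sup>2 \<le> C\<^sup>2" "1 / \<epsilon>\<^sup>2 * (l2 u2)\<^sup>2 \<le> C\<^sup>2"
    using E nn zero_le_power2[of "l2 u1"] zero_le_power2[of "l2 u"] by linarith+
  then have "(l2 u1)\<^sup>2 \<le> C\<^sup>2" "(l2 u2)\<^sup>2 \<le> (\<epsilon> * C)\<^sup>2"
    using \<open>\<epsilon> > 0\<close> by (simp_all add: field_simps power_mult_distrib)
  then show "l2 u1 \<le> C" "l2 u2 \<le> \<epsilon> * C"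
    using C0 \<open>\<epsilon> > 0\<close> by (auto intro: power2_le_imp_le)
qed

lemma integral_column_mult:
  assumes h: "sq_int h" "\<And>z. z \<notin> Om \<Longrightarrow> h z = 0" and k: "sq_int k"
  shows "(LBINT z. h z * (indicator Om z * k (fst z))) = (LBINT x. (LBINT y. h (x, y)) * k x)"
proof -
  have "sq_int (\<lambda>z. indicator Om z * k (fst z))"
    using b_pos M_nonneg Om_subset
    by (intro strip_sq_int(1)[OF k, where B = 1 and p = "- b" and q = M]) (auto simp: indicator_def dest!: subsetD)
  note i = sq_int_mult_integrable[OF h(1) this]
  have "h (x, y) * (indicator Om (x, y) * k x) = h (x, y) * k x" for x y
    using h(2)[of "(x, y)"] by (cases "(x, y) \<in> Om") auto
  then show ?thesis
    unfolding lborel2_fst[OF i] fst_conv by (simp only: integral_mult_left_zero)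
qed

lemma indicator_column_integral:
  "(LBINT y. indicator Om (x, y)) = indicator {0<..<1} x * (b + g x)"
  using b_pos g_nonneg[of x] by (simp add: section_eq)

text \<open>The four terms are, in this order: the horizontal flux in the teeth up to height
  \<delta>; the vertical derivative of the test function; the replacement of the test function by
  \<phi>(x), once against u and once against f; the replacement of u by its strip mean.\<close>

definition err :: "real \<Rightarrow> real \<Rightarrow> real \<Rightarrow> real" where
  "err \<epsilon> l \<delta> = sqrt \<delta> + l / (\<epsilon> * sqrt \<delta>) + 2 * sqrt (b + M) * l + 2 * (b + M) * sqrt (b + M) * \<epsilon>"

text \<open>Each term of the equation tested with \<open>osc_test\<close> is compared with its
  one-dimensional counterpart by Cauchy-Schwarz, with the norms of u and its derivatives taken from
  \<open>energy_bounds\<close>.\<close>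

lemma homogenization_estimate:
  assumes eq: "weak_eq \<epsilon> f u u1 u2" and "\<epsilon> > 0" and C: "l2 f \<le> C"
    and v: "sq_int v" "\<And>x. x \<notin> {0<..<1} \<Longrightarrow> v x = 0" and "l > 0" "\<delta> > 0"
    and grid: "\<And>k::int. g (x0 + l * of_int k) = 0"
  shows "\<bar>b * (LBINT x. avg u1 x * v x) + (LBINT x. (b + g x) * (avg u x * ac a v x))
      - (LBINT x. (LBINT y. f (x, y)) * ac a v x)\<bar> \<le> C * err \<epsilon> l \<delta> * (l2 v + l2 (ac a v))"
proof -
  note E = energy_bounds[OF eq \<open>\<epsilon> > 0\<close> C]
  have W: "wdiff (1, 0) u u1" "wdiff (0, 1) u u2" and f: "sq_int f" "\<And>z. z \<notin> Om \<Longrightarrow> f z = 0"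
    using eq by (auto simp: weak_eq_def)
  note D1 = wdiffD[OF W(1)] and D2 = wdiffD[OF W(2)]
  have C0: "0 \<le> C"
    using l2_nonneg[of f] C by linarith
  define \<Phi> where "\<Phi> = osc_test x0 l \<delta> a v"
  define \<Phi>1 where "\<Phi>1 = osc_test1 \<delta> v"
  define \<Phi>2 where "\<Phi>2 = osc_test2 x0 l \<delta> v"
  have \<Phi>: "wdiff (1, 0) \<Phi> \<Phi>1" "wdiff (0, 1) \<Phi> \<Phi>2"
    unfolding \<Phi>_def \<Phi>1_def \<Phi>2_def by (rule osc_test_wdiff[OF v \<open>l > 0\<close> \<open>\<delta> > 0\<close> grid]; assumption)+
  have main: "(LBINT z. u1 z * \<Phi>1 z) + 1 / \<epsilon>\<^sup>2 * (LBINT z. u2 z * \<Phi>2 z) + (LBINT z. u z * \<Phi> z)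
        = (LBINT z. f z * \<Phi> z)"
    using eq \<Phi> unfolding weak_eq_def by blast
  have int: "integrable lborel v"
    by (rule sq_int_integrable[OF v unit_fmeasurable])
  let ?\<phi> = "ac a v"
  have \<phi>: "sq_int ?\<phi>"
    by (rule ac_sq_int[OF int])
  define D where "D x = indicator {0<..<1} x * (prim v (grid_point x0 l x) - prim v x)" for x
  have D: "sq_int D" "l2 D \<le> l * l2 v"
    unfolding D_def by (rule grid_difference_l2[OF v \<open>l > 0\<close>]; assumption)+
  note ramp = ramp_bounds[OF \<open>\<delta> > 0\<close>]
  have bM: "- b \<le> M" "0 \<le> b + M" "M - - b = b + M"
    using b_pos M_nonneg by auto

  \<comment> \<open>The part of the horizontal derivative at heights from 0 to \<delta>. Below 0 the
    ramp is 0 and the exact term remains; above \<delta> the derivative is 0.\<close>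
  define m1 :: "real \<times> real \<Rightarrow> real" where "m1 z = indicator Om z * indicator {0..} (snd z) * (1 - ramp \<delta> (snd z))" for z
  have m1: "m1 \<in> borel_measurable borel" "\<bar>m1 z\<bar> \<le> 1 * indicator {0..\<delta>} (snd z)" for z
    using ramp[of "snd z"] by (auto simp: m1_def[abs_def] indicator_def)
  have m1v: "sq_int (\<lambda>z. m1 z * v (fst z))" "l2 (\<lambda>z. m1 z * v (fst z)) \<le> sqrt \<delta> * l2 v"
    using strip_sq_int[OF v(1) m1] \<open>\<delta> > 0\<close> by auto
  have lowv: "sq_int (\<lambda>z. indicator {- b<..<0} (snd z) * v (fst z))"
    by (rule strip_sq_int(1)[OF v(1), where B = 1 and p = "- b" and q = 0]) (use b_pos in \<open>auto simp: indicator_def\<close>)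
  have "u1 z * \<Phi>1 z = u1 z * (indicator {- b<..<0} (snd z) * v (fst z)) + u1 z * (m1 z * v (fst z))" for z
    using D1(4)[of z] ramp(3)[of "snd z"]
    by (cases "z \<in> Om"; cases "snd z < 0") (auto simp: \<Phi>1_def osc_test1_def m1_def mem_Om algebra_simps)
  then have "(LBINT z. u1 z * \<Phi>1 z)
      = (LBINT z. u1 z * (indicator {- b<..<0} (snd z) * v (fst z))) + (LBINT z. u1 z * (m1 z * v (fst z)))"
    using sq_int_mult_integrable[OF D1(2) lowv] sq_int_mult_integrable[OF D1(2) m1v(1)] by simp
  also have "(LBINT z. u1 z * (indicator {- b<..<0} (snd z) * v (fst z))) = b * (LBINT x. avg u1 x * v x)"
    by (rule integral_avg_mult[OF D1(2,4) v(1)])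
  finally have t1: "(LBINT z. u1 z * \<Phi>1 z) = b * (LBINT x. avg u1 x * v x) + (LBINT z. u1 z * (m1 z * v (fst z)))" .
  have e1: "\<bar>LBINT z. u1 z * (m1 z * v (fst z))\<bar> \<le> C * (sqrt \<delta> * l2 v)"
    by (rule order_trans[OF Cauchy_Schwarz_l2[OF D1(2) m1v(1)]]) (intro mult_mono E m1v(2) C0 l2_nonneg)

  \<comment> \<open>The slope 1 / \<delta> on a layer of height \<delta> has norm 1 / sqrt \<delta>;
    the grid difference contributes l.\<close>
  define m2 :: "real \<times> real \<Rightarrow> real" where "m2 z = indicator Om z * (indicator {0<..\<delta>} (snd z) / \<delta>)" for z
  have m2: "m2 \<in> borel_measurable borel" "\<bar>m2 z\<bar> \<le> 1 / \<delta> * indicator {0..\<delta>} (snd z)" for z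
    using \<open>\<delta> > 0\<close> by (auto simp: m2_def[abs_def] indicator_def)
  have m2D: "sq_int (\<lambda>z. m2 z * D (fst z))" "l2 (\<lambda>z. m2 z * D (fst z)) \<le> 1 / \<delta> * sqrt \<delta> * l2 D"
    using strip_sq_int[OF D(1) m2] \<open>\<delta> > 0\<close> by auto
  have \<Phi>2_eq: "\<Phi>2 = (\<lambda>z. m2 z * D (fst z))"
    by (rule ext) (auto simp: \<Phi>2_def osc_test2_def m2_def D_def indicator_def mem_Om)
  have "\<bar>LBINT z. u2 z * \<Phi>2 z\<bar> \<le> l2 u2 * l2 \<Phi>2"
    by (rule Cauchy_Schwarz_l2[OF D2(2) wdiffD(2)[OF \<Phi>(2)]])
  also have "\<dots> \<le> (\<epsilon> * C) * (1 / \<delta> * sqrt \<delta> * (l * l2 v))"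
  proof (rule mult_mono[OF E(3)])
    show "l2 \<Phi>2 \<le> 1 / \<delta> * sqrt \<delta> * (l * l2 v)"
      unfolding \<Phi>2_eq using m2D(2) mult_left_mono[OF D(2), of "1 / \<delta> * sqrt \<delta>"] \<open>\<delta> > 0\<close> by simp
  qed (use C0 \<open>\<epsilon> > 0\<close> l2_nonneg in auto)
  finally have bnd: "\<bar>LBINT z. u2 z * \<Phi>2 z\<bar> \<le> (\<epsilon> * C) * (1 / \<delta> * sqrt \<delta> * (l * l2 v))" .
  \<comment> \<open>The bound \<epsilon> C of the vertical derivative absorbs one of the two factors
    1 / \<epsilon>.\<close>
  have "\<bar>1 / \<epsilon>\<^sup>2 * (LBINT z. u2 z * \<Phi>2 z)\<bar> = 1 / \<epsilon>\<^sup>2 * \<bar>LBINT z. u2 z * \<Phi>2 z\<bar>"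
    by (simp add: abs_mult)
  also have "\<dots> \<le> 1 / \<epsilon>\<^sup>2 * ((\<epsilon> * C) * (1 / \<delta> * sqrt \<delta> * (l * l2 v)))"
    by (rule mult_left_mono[OF bnd]) simp
  also have "\<dots> = C * (l / (\<epsilon> * sqrt \<delta>) * l2 v)"
  proof -
    have "1 / \<delta> * sqrt \<delta> = 1 / sqrt \<delta>"
      using \<open>\<delta> > 0\<close> by (simp add: field_simps)
    then show ?thesis
      using \<open>\<epsilon> > 0\<close> by (simp add: power2_eq_square field_simps)
  qed
  finally have e2: "\<bar>1 / \<epsilon>\<^sup>2 * (LBINT z. u2 z * \<Phi>2 z)\<bar> \<le> C * (l / (\<epsilon> * sqrt \<delta>) * l2 v)" .

  define m3 :: "real \<times> real \<Rightarrow> real" where "m3 z = indicator Om z * ramp \<delta> (snd z)" for z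
  have m3: "m3 \<in> borel_measurable borel" "\<bar>m3 z\<bar> \<le> 1 * indicator {- b..M} (snd z)" for z
    using ramp[of "snd z"] Om_subset by (auto simp: m3_def[abs_def] indicator_def dest!: subsetD)
  have m3D: "sq_int (\<lambda>z. m3 z * D (fst z))" "l2 (\<lambda>z. m3 z * D (fst z)) \<le> sqrt (b + M) * (l * l2 v)"
  proof -
    note S = strip_sq_int[OF D(1) m3 bM(1)]
    show "sq_int (\<lambda>z. m3 z * D (fst z))"
      using S(1) by simp
    show "l2 (\<lambda>z. m3 z * D (fst z)) \<le> sqrt (b + M) * (l * l2 v)"
      using S(2) mult_left_mono[OF D(2), of "sqrt (b + M)"] bM by (simp add: add.commute)
  qed
  define I where "I z = indicator Om z * ?\<phi> (fst z)" for z
  have mI: "(indicator Om :: real \<times> real \<Rightarrow> real) \<in> borel_measurable borel" "\<bar>indicator Om z :: real\<bar> \<le> 1 * indicator {- b..M} (snd z)" for z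
    using Om_subset by (auto simp: indicator_def dest!: subsetD)
  have I: "sq_int I" "l2 I \<le> sqrt (b + M) * l2 ?\<phi>"
    using strip_sq_int[OF \<phi> mI bM(1)] by (auto simp: I_def[abs_def] add.commute)
  \<comment> \<open>The test function is \<phi> plus a correction where the ramp is positive, which
    is of order l by the grid difference.\<close>
  have \<Phi>_eq: "\<Phi> z = I z + m3 z * D (fst z)" for z
    by (cases "z \<in> Om") (auto simp: \<Phi>_def osc_test_def I_def m3_def D_def ac_def mem_Om algebra_simps)
  have t3: "(LBINT z. h z * \<Phi> z) = (LBINT z. h z * I z) + (LBINT z. h z * (m3 z * D (fst z)))"
    and e3: "\<bar>LBINT z. h z * (m3 z * D (fst z))\<bar> \<le> C * (sqrt (b + M) * l * l2 v)"
    if "sq_int h" "l2 h \<le> C" for h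
  proof -
    show "(LBINT z. h z * \<Phi> z) = (LBINT z. h z * I z) + (LBINT z. h z * (m3 z * D (fst z)))"
      using sq_int_mult_integrable[OF that(1) I(1)] sq_int_mult_integrable[OF that(1) m3D(1)]
      by (simp add: \<Phi>_eq distrib_left)
    show "\<bar>LBINT z. h z * (m3 z * D (fst z))\<bar> \<le> C * (sqrt (b + M) * l * l2 v)"
      by (rule order_trans[OF Cauchy_Schwarz_l2[OF that(1) m3D(1)]])
         (use m3D(2) in \<open>auto simp: mult.assoc intro!: mult_mono that C0 l2_nonneg\<close>)
  qed
  have t4: "(LBINT z. f z * I z) = (LBINT x. (LBINT y. f (x, y)) * ?\<phi> x)"
    unfolding I_def by (rule integral_column_mult[OF f \<phi>])

  let ?w = "avg u"
  have w: "sq_int ?w"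
    by (rule avg_sq_int(1)[OF D1(1,3)])
  \<comment> \<open>The part of u that its strip mean misses, of order \<epsilon> by
    \<open>oscillation_bound\<close>.\<close>
  define R where "R z = indicator Om z * (u z - ?w (fst z))" for z
  have R: "sq_int R" "l2 R \<le> 2 * (b + M) * l2 u2"
    unfolding R_def by (rule oscillation_bound[OF W(2)])+
  have e5: "\<bar>LBINT z. R z * I z\<bar> \<le> C * (2 * (b + M) * sqrt (b + M) * \<epsilon> * l2 ?\<phi>)"
  proof -
    have l2R: "l2 R \<le> 2 * (b + M) * (\<epsilon> * C)"
      using R(2) mult_left_mono[OF E(3), of "2 * (b + M)"] bM(2) by simp
    have "\<bar>LBINT z. R z * I z\<bar> \<le> l2 R * l2 I"
      by (rule Cauchy_Schwarz_l2[OF R(1) I(1)])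
    also have "\<dots> \<le> (2 * (b + M) * (\<epsilon> * C)) * (sqrt (b + M) * l2 ?\<phi>)"
      using l2R bM(2) C0 \<open>\<epsilon> > 0\<close> by (intro mult_mono I(2) l2_nonneg) auto
    finally show ?thesis
      by (simp add: mult_ac)
  qed
  define wI where "wI z = indicator Om z * ?w (fst z)" for z
  have wI: "sq_int wI"
    using strip_sq_int(1)[OF w mI bM(1)] by (simp add: wI_def[abs_def])
  have "u z * I z = R z * I z + wI z * I z" for z
    by (cases "z \<in> Om") (auto simp: R_def wI_def I_def algebra_simps)
  then have "(LBINT z. u z * I z) = (LBINT z. R z * I z) + (LBINT z. wI z * I z)"
    using sq_int_mult_integrable[OF R(1) I(1)] sq_int_mult_integrable[OF wI I(1)] by simp
  also have "(LBINT z. wI z * I z) = (LBINT x. (LBINT y. wI (x, y)) * ?\<phi> x)"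
    unfolding I_def by (rule integral_column_mult[OF wI _ \<phi>]) (simp add: wI_def)
  \<comment> \<open>The length of the column, b + g x, is how the teeth enter the zero-order
    term.\<close>
  also have "\<dots> = (LBINT x. (b + g x) * (?w x * ?\<phi> x))"
  proof (intro Bochner_Integration.integral_cong refl)
    fix x
    have "(LBINT y. wI (x, y)) = (LBINT y. indicator Om (x, y)) * ?w x"
      by (simp add: wI_def)
    then show "(LBINT y. wI (x, y)) * ?\<phi> x = (b + g x) * (?w x * ?\<phi> x)"
      using ac_zero[of x a v] by (cases "x \<in> {0<..<1}") (auto simp: indicator_column_integral)
  qed
  finally have t5: "(LBINT z. u z * I z) = (LBINT z. R z * I z) + (LBINT x. (b + g x) * (?w x * ?\<phi> x))" .

  have "\<bar>b * (LBINT x. avg u1 x * v x) + (LBINT x. (b + g x) * (avg u x * ac a v x))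
      - (LBINT x. (LBINT y. f (x, y)) * ac a v x)\<bar>
     \<le> C * (sqrt \<delta> * l2 v) + C * (l / (\<epsilon> * sqrt \<delta>) * l2 v) + C * (sqrt (b + M) * l * l2 v) + C * (sqrt (b + M) * l * l2 v)
        + C * (2 * (b + M) * sqrt (b + M) * \<epsilon> * l2 ?\<phi>)"
    using main t1 t3[OF D1(1) E(1)] t3[OF f(1) C] t4 t5 e1 e2 e3[OF D1(1) E(1)] e3[OF f(1) C] e5
    unfolding abs_le_iff by (intro conjI; linarith)
  also have "\<dots> = C * ((sqrt \<delta> + l / (\<epsilon> * sqrt \<delta>) + 2 * sqrt (b + M) * l) * l2 v + 2 * (b + M) * sqrt (b + M) * \<epsilon> * l2 ?\<phi>)"
    by (simp only: distrib_left distrib_right mult_2 mult.assoc add.assoc)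
  also have "\<dots> \<le> C * (err \<epsilon> l \<delta> * l2 v + err \<epsilon> l \<delta> * l2 ?\<phi>)"
  proof (intro mult_left_mono[OF _ C0] add_mono mult_right_mono l2_nonneg)
    have p: "0 \<le> sqrt \<delta>" "0 \<le> l / (\<epsilon> * sqrt \<delta>)" "0 \<le> 2 * sqrt (b + M) * l" "0 \<le> 2 * (b + M) * sqrt (b + M) * \<epsilon>"
      using \<open>\<delta> > 0\<close> \<open>l > 0\<close> \<open>\<epsilon> > 0\<close> bM(2) by auto
    then show "sqrt \<delta> + l / (\<epsilon> * sqrt \<delta>) + 2 * sqrt (b + M) * l \<le> err \<epsilon> l \<delta>"
      "2 * (b + M) * sqrt (b + M) * \<epsilon> \<le> err \<epsilon> l \<delta>"
      unfolding err_def by linarith+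
  qed
  also have "\<dots> = C * err \<epsilon> l \<delta> * (l2 v + l2 ?\<phi>)"
    by (simp add: distrib_left mult.assoc)
  finally show ?thesis .
qed

end

text \<open>For \<phi> = \<open>ac a v\<close>, integration by parts yields \<phi>(1) times the
  integral of h, minus the integral of the primitive of h against v. Thus h enters through its
  primitive only, a quantity that tends to 0 already under weak convergence.\<close>

lemma integral_ac_bound:
  assumes h: "integrable lborel h" "\<And>x. x \<notin> {0<..<1} \<Longrightarrow> h x = 0"
    and v: "sq_int v" "\<And>x. x \<notin> {0<..<1} \<Longrightarrow> v x = 0"
  shows "\<bar>LBINT x. h x * ac a v x\<bar>
    \<le> (\<bar>LBINT x. h x\<bar> + l2 (\<lambda>x. indicator {0<..<1} x * prim h x)) * (l2 v + l2 (ac a v))"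
proof -
  let ?J = "indicator {0<..<1} :: real \<Rightarrow> real"
  have int: "integrable lborel v"
    by (rule sq_int_integrable[OF v unit_fmeasurable])
  have J: "sq_int ?J"
    by (rule sq_int_indicator[OF unit_fmeasurable])
  have l2J: "l2 ?J = 1"
    by (simp add: l2_def power2_eq_square flip: indicator_inter_arith)
  have Jh: "sq_int (\<lambda>x. ?J x * prim h x)"
    using prim_sq_int[OF h(1), of 0] by simp
  \<comment> \<open>The boundary value \<phi>(1). It equals \<phi>(x) plus the increment from x to
    1; taking norms in x bounds it by the norms of \<phi> and its derivative.\<close>
  define K where "K = a + (LBINT x. v x)"
  have "\<bar>K\<bar> \<le> l2 (ac a v) + l2 v"
  proof -
    let ?r = "\<lambda>x. ?J x * ((LBINT t. v t) - prim v x)"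
    have r: "\<bar>?r x\<bar> \<le> \<bar>l2 v * ?J x\<bar>" for x
    proof (cases "x \<in> {0<..<1}")
      case True
      have "((LBINT t. v t) - prim v x)\<^sup>2 \<le> (1 - x) * (LBINT t. indicator {x<..1} t * (v t)\<^sup>2)"
        using prim_increment_square_le[OF v(1) int, of x 1] prim_unit_interval(2)[of v 1] v(2) True by simp
      also have "\<dots> \<le> 1 * (LBINT t. (v t)\<^sup>2)"
        using True sq_intD(3)[OF v(1)]
        by (intro mult_mono integral_mono integrable_indicator_mult integral_nonneg_AE) (auto simp: indicator_def)
      finally have "((LBINT t. v t) - prim v x)\<^sup>2 \<le> (l2 v)\<^sup>2"
        by (simp add: l2_square)
      then show ?thesis
        using True by (simp add: abs_le_square_iff)
    qed simp
    have rm: "?r \<in> borel_measurable borel"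
      using prim_measurable[of v] int by auto
    note R = l2_mono[OF sq_int_cmult[OF J, of "l2 v"] rm r]
    have "\<bar>K\<bar> = l2 (\<lambda>x. K * ?J x)"
      by (simp add: l2_cmult l2J)
    also have "(\<lambda>x. K * ?J x) = (\<lambda>x. ac a v x + ?r x)"
      by (auto simp: fun_eq_iff K_def ac_def indicator_def)
    also have "l2 \<dots> \<le> l2 (ac a v) + l2 ?r"
      by (rule l2_triangle[OF ac_sq_int[OF int] R(1)])
    also have "l2 ?r \<le> l2 v"
      using R(2) by (simp add: l2_cmult l2J l2_nonneg)
    finally show ?thesis
      by simp
  qed
  have "h x * ac a v x = a * h x + h x * prim v x" for x
    using h(2)[of x] by (cases "x \<in> {0<..<1}") (auto simp: ac_def algebra_simps)
  then have "(LBINT x. h x * ac a v x) = (LBINT x. a * h x + h x * prim v x)"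
    by simp
  also have "\<dots> = a * (LBINT x. h x) + (LBINT x. h x * prim v x)"
    using h(1) prim_mult_integrable[OF int h(1)] by (simp add: mult.commute)
  also have "\<dots> = (LBINT x. h x) * K - (LBINT x. prim h x * v x)"
    using prim_parts[OF h(1) int] by (simp add: K_def algebra_simps)
  also have "(LBINT x. prim h x * v x) = (LBINT x. (?J x * prim h x) * v x)"
  proof (intro Bochner_Integration.integral_cong refl)
    show "prim h x * v x = (?J x * prim h x) * v x" for x
      using v(2)[of x] by (cases "x \<in> {0<..<1}") auto
  qed
  finally have "\<bar>LBINT x. h x * ac a v x\<bar> \<le> \<bar>LBINT x. h x\<bar> * \<bar>K\<bar> + \<bar>LBINT x. (?J x * prim h x) * v x\<bar>"
    using abs_triangle_ineq4[of "(LBINT x. h x) * K" "LBINT x. (?J x * prim h x) * v x"] by (simp add: abs_mult)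
  also have "\<dots> \<le> \<bar>LBINT x. h x\<bar> * (l2 v + l2 (ac a v)) + l2 (\<lambda>x. ?J x * prim h x) * (l2 v + l2 (ac a v))"
  proof (rule add_mono)
    show "\<bar>LBINT x. h x\<bar> * \<bar>K\<bar> \<le> \<bar>LBINT x. h x\<bar> * (l2 v + l2 (ac a v))"
      using \<open>\<bar>K\<bar> \<le> l2 (ac a v) + l2 v\<close> by (intro mult_left_mono) auto
    have "\<bar>LBINT x. (?J x * prim h x) * v x\<bar> \<le> l2 (\<lambda>x. ?J x * prim h x) * l2 v"
      by (rule Cauchy_Schwarz_l2[OF Jh v(1)])
    also have "\<dots> \<le> l2 (\<lambda>x. ?J x * prim h x) * (l2 v + l2 (ac a v))"
      by (intro mult_left_mono) (auto simp: l2_nonneg)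
    finally show "\<bar>LBINT x. (?J x * prim h x) * v x\<bar> \<le> l2 (\<lambda>x. ?J x * prim h x) * (l2 v + l2 (ac a v))" .
  qed
  finally show ?thesis
    by (simp add: distrib_right)
qed

context column_domain
begin

text \<open>\<open>h\<close> is the residual after subtraction of the limit equation: the error of
  the source, minus the deviation of the column height from p times the limit solution. The limit
  equation enters multiplied by p, so that its leading coefficient is b, as in
  \<open>homogenization_estimate\<close>.\<close>

lemma convergence_estimate:
  fixes p c0 :: real and fh v0 :: "real \<Rightarrow> real"
  assumes eq: "weak_eq \<epsilon> f u u1 u2" and "\<epsilon> > 0" and C: "l2 f \<le> C" and "l > 0" "\<delta> > 0"
    and grid: "\<And>k::int. g (x0 + l * of_int k) = 0"
    and fh: "sq_int fh" "\<And>x. x \<notin> {0<..<1} \<Longrightarrow> fh x = 0"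
    and v0: "sq_int v0" "\<And>x. x \<notin> {0<..<1} \<Longrightarrow> v0 x = 0"
    and limit: "\<And>a w. sq_int w \<Longrightarrow> (\<And>x. x \<notin> {0<..<1} \<Longrightarrow> w x = 0) \<Longrightarrow>
       b * (LBINT x. v0 x * w x) + p * (LBINT x. ac c0 v0 x * ac a w x) = (LBINT x. fh x * ac a w x)"
  defines "h \<equiv> \<lambda>x. (LBINT y. f (x, y)) - fh x - indicator {0<..<1} x * (b + g x - p) * ac c0 v0 x"
  defines "\<sigma> \<equiv> \<bar>LBINT x. h x\<bar> + l2 (\<lambda>x. indicator {0<..<1} x * prim h x)"
  shows "l2 (\<lambda>z. indicator Om z * (u z - ac c0 v0 (fst z)))
    \<le> 2 * (b + M) * (\<epsilon> * C) + sqrt (b + M) * (2 * (C * err \<epsilon> l \<delta> + \<sigma>) / b)"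
proof -
  note E = energy_bounds[OF eq \<open>\<epsilon> > 0\<close> C]
  have W: "wdiff (1, 0) u u1" "wdiff (0, 1) u u2" and f: "sq_int f" "\<And>z. z \<notin> Om \<Longrightarrow> f z = 0"
    using eq by (auto simp: weak_eq_def)
  note D1 = wdiffD[OF W(1)]
  have bM: "- b \<le> M" "0 \<le> b + M" "M - - b = b + M"
    using b_pos M_nonneg by auto
  have C0: "0 \<le> C"
    using l2_nonneg[of f] C by linarith
  let ?J = "indicator {0<..<1} :: real \<Rightarrow> real"
  let ?w = "avg u" and ?u0 = "ac c0 v0"
  have w: "sq_int ?w"
    by (rule avg_sq_int(1)[OF D1(1,3)])
  have w1: "sq_int (avg u1)"
    by (rule avg_sq_int(1)[OF D1(2,4)])
  have w1_0: "avg u1 x = 0" if "x \<notin> {0<..<1}" for x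
    by (rule avg_sq_int(2)[OF D1(2,4) that])
  have v0i: "integrable lborel v0"
    by (rule sq_int_integrable[OF v0 unit_fmeasurable])
  have w1i: "integrable lborel (avg u1)"
    by (rule sq_int_integrable[OF w1 w1_0 unit_fmeasurable])
  have u0: "sq_int ?u0"
    by (rule ac_sq_int[OF v0i])
  obtain c where c: "AE x in lborel. ?w x = ac c (avg u1) x"
    using avg_ac[OF W(1)] by blast
  \<comment> \<open>Up to a null set the error w - u is \<open>ac a v\<close>, so v is its weak
    derivative; both will serve as test data.\<close>
  define v where "v x = avg u1 x - v0 x" for x
  define a where "a = c - c0"
  let ?e = "ac a v"
  have v: "sq_int v" "\<And>x. x \<notin> {0<..<1} \<Longrightarrow> v x = 0"
    using sq_int_diff[OF w1 v0(1)] w1_0 v0(2) by (auto simp: v_def[abs_def])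
  have vi: "integrable lborel v"
    by (rule sq_int_integrable[OF v unit_fmeasurable])
  have e: "sq_int ?e"
    by (rule ac_sq_int[OF vi])
  have ew: "AE x in lborel. ?w x = ?u0 x + ?e x"
    using c by eventually_elim (use ac_diff[OF w1i v0i, of c _ c0] in \<open>simp add: a_def v_def[abs_def] algebra_simps\<close>)
  let ?F = "\<lambda>x. LBINT y. f (x, y)"
  have F: "sq_int ?F"
    by (rule column_integral_sq_int(1)[OF f(1) _ bM(1)]) (rule supp_snd[OF f(2)])
  have F0: "?F x = 0" if "x \<notin> {0<..<1}" for x
  proof -
    have "f (x, y) = 0" for y
      by (rule f(2)) (use that in \<open>auto simp: mem_Om\<close>)
    then show ?thesis
      by simp
  qed
  define q where "q x = ?J x * (b + g x - p)" for x
  have qm: "q \<in> borel_measurable borel"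
  proof -
    have "q = (\<lambda>x. ?J x * (b - p) + ?J x * g x)"
      by (auto simp: q_def fun_eq_iff algebra_simps)
    then show ?thesis
      using height_measurable by simp
  qed
  have qb: "\<bar>q x\<bar> \<le> b + M + \<bar>p\<bar>" for x
    using g_nonneg[of x] g_le[of x] b_pos M_nonneg by (auto simp: q_def indicator_def)
  have qu: "sq_int (\<lambda>x. q x * ?u0 x)"
    by (rule sq_int_bounded_mult[OF u0 qm qb])
  have heq: "h = (\<lambda>x. ?F x - fh x - q x * ?u0 x)"
    by (simp add: h_def q_def)
  have h: "sq_int h" "\<And>x. x \<notin> {0<..<1} \<Longrightarrow> h x = 0"
    unfolding heq using sq_int_diff[OF sq_int_diff[OF F fh(1)] qu] F0 fh(2) by (auto simp: q_def)
  have hi: "integrable lborel h"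
    by (rule sq_int_integrable[OF h unit_fmeasurable])

  have g1m: "(\<lambda>x. ?J x * (b + g x)) \<in> borel_measurable borel"
    using height_measurable by (simp add: distrib_left)
  have g1b: "\<bar>?J x * (b + g x)\<bar> \<le> b + M" for x
    using g_nonneg[of x] g_le[of x] b_pos M_nonneg by (auto simp: indicator_def)
  have ge: "sq_int (\<lambda>x. ?J x * (b + g x) * ?e x)"
    by (rule sq_int_bounded_mult[OF e g1m g1b])
  \<comment> \<open>Inserting w = u0 + e splits the zero-order term into a quadratic part in e, the
    deviation of the height from p against the fixed u0, and the term of the limit equation.\<close>
  have 1: "(LBINT x. (b + g x) * (?w x * ?e x))
     = (LBINT x. (?J x * (b + g x) * ?e x) * ?e x) + (LBINT x. q x * ?u0 x * ?e x) + p * (LBINT x. ?u0 x * ?e x)"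
  proof -
    have "(LBINT x. (b + g x) * (?w x * ?e x))
        = (LBINT x. (?J x * (b + g x) * ?e x) * ?e x + q x * ?u0 x * ?e x + p * (?u0 x * ?e x))"
    proof (rule integral_cong_AE)
      show "AE x in lborel. (b + g x) * (?w x * ?e x) = (?J x * (b + g x) * ?e x) * ?e x + q x * ?u0 x * ?e x + p * (?u0 x * ?e x)"
        using ew
      proof eventually_elim
        case (elim x)
        then show ?case
          using ac_zero[of x a v] by (cases "x \<in> {0<..<1}") (auto simp: q_def algebra_simps)
      qed
      have "(\<lambda>x. (b + g x) * (?w x * ?e x)) = (\<lambda>x. (?J x * (b + g x)) * (?w x * ?e x))"
      proof
        show "(b + g x) * (?w x * ?e x) = (?J x * (b + g x)) * (?w x * ?e x)" for x
          using ac_zero[of x a v] by (cases "x \<in> {0<..<1}") auto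
      qed
      moreover have "(\<lambda>x. (?J x * (b + g x)) * (?w x * ?e x)) \<in> borel_measurable lborel"
        using borel_measurable_times[OF g1m borel_measurable_times[OF sq_intD(1)[OF w] sq_intD(1)[OF e]]]
        by (simp only: measurable_lborel2)
      ultimately show "(\<lambda>x. (b + g x) * (?w x * ?e x)) \<in> borel_measurable lborel"
        by (simp only:)
    qed (use sq_intD(1)[OF ge] sq_intD(1)[OF e] sq_intD(1)[OF qu] sq_intD(1)[OF u0] in auto)
    also have "\<dots> = (LBINT x. (?J x * (b + g x) * ?e x) * ?e x) + (LBINT x. q x * ?u0 x * ?e x) + p * (LBINT x. ?u0 x * ?e x)"
      using sq_int_mult_integrable[OF ge e] sq_int_mult_integrable[OF qu e] sq_int_mult_integrable[OF u0 e] by simp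
    finally show ?thesis .
  qed
  have 2: "(LBINT x. avg u1 x * v x) = (l2 v)\<^sup>2 + (LBINT x. v0 x * v x)"
  proof -
    have "(LBINT x. avg u1 x * v x) = (LBINT x. (v x)\<^sup>2 + v0 x * v x)"
      by (intro Bochner_Integration.integral_cong refl) (simp add: v_def power2_eq_square algebra_simps)
    also have "\<dots> = (l2 v)\<^sup>2 + (LBINT x. v0 x * v x)"
      using sq_intD(3)[OF v(1)] sq_int_mult_integrable[OF v0(1) v(1)] by (simp add: l2_square)
    finally show ?thesis .
  qed
  have 3: "(LBINT x. h x * ?e x) = (LBINT x. ?F x * ?e x) - (LBINT x. fh x * ?e x) - (LBINT x. q x * ?u0 x * ?e x)"
    using sq_int_mult_integrable[OF F e] sq_int_mult_integrable[OF fh(1) e] sq_int_mult_integrable[OF qu e]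
    by (simp add: heq left_diff_distrib)
  \<comment> \<open>Since g >= 0, the quadratic part is coercive with the same constant b as the
    derivative term.\<close>
  have 4: "b * (l2 ?e)\<^sup>2 \<le> (LBINT x. (?J x * (b + g x) * ?e x) * ?e x)"
    unfolding l2_square integral_mult_right_zero[symmetric]
  proof (rule integral_mono)
    show "b * (?e x)\<^sup>2 \<le> (?J x * (b + g x) * ?e x) * ?e x" for x
      using ac_zero[of x a v] g_nonneg[of x]
      by (cases "x \<in> {0<..<1}") (auto simp: power2_eq_square distrib_right mult.assoc)
  qed (use sq_intD(3)[OF e] sq_int_mult_integrable[OF ge e] in auto)
  \<comment> \<open>The energy is quadratic and the right-hand side linear in N. As N^2 is at most
    twice the sum of squares, one factor N can be divided out, at the price of the factor 2 in the
    bound.\<close>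
  define N where "N = l2 v + l2 ?e"
  have N0: "0 \<le> N"
    by (simp add: N_def l2_nonneg)
  have 5: "\<bar>LBINT x. h x * ?e x\<bar> \<le> \<sigma> * N"
    unfolding \<sigma>_def N_def by (rule integral_ac_bound[OF hi h(2) v])
  have 6: "\<bar>b * (LBINT x. avg u1 x * v x) + (LBINT x. (b + g x) * (?w x * ?e x))
      - (LBINT x. ?F x * ?e x)\<bar> \<le> C * err \<epsilon> l \<delta> * N"
    unfolding N_def by (rule homogenization_estimate[OF eq \<open>\<epsilon> > 0\<close> C v \<open>l > 0\<close> \<open>\<delta> > 0\<close> grid])
  have 7: "b * (LBINT x. v0 x * v x) + p * (LBINT x. ?u0 x * ?e x) = (LBINT x. fh x * ?e x)"
    by (rule limit[OF v])
  have "b * (LBINT x. avg u1 x * v x) = b * (l2 v)\<^sup>2 + b * (LBINT x. v0 x * v x)"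
    by (simp add: 2 distrib_left)
  then have "b * (l2 v)\<^sup>2 + b * (l2 ?e)\<^sup>2 \<le> C * err \<epsilon> l \<delta> * N + \<sigma> * N"
    using 1 3 4 5 6 7 by linarith
  then have "b * ((l2 v)\<^sup>2 + (l2 ?e)\<^sup>2) \<le> (C * err \<epsilon> l \<delta> + \<sigma>) * N"
    by (simp add: algebra_simps)
  moreover have "N\<^sup>2 \<le> 2 * ((l2 v)\<^sup>2 + (l2 ?e)\<^sup>2)"
    using sum_squares_bound[of "l2 v" "l2 ?e"] by (simp add: N_def power2_sum)
  then have "b * N\<^sup>2 \<le> b * (2 * ((l2 v)\<^sup>2 + (l2 ?e)\<^sup>2))"
    using b_pos by (intro mult_left_mono) auto
  ultimately have "(b * N) * N \<le> (2 * (C * err \<epsilon> l \<delta> + \<sigma>)) * N"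
    by (simp add: power2_eq_square algebra_simps)
  moreover have "0 \<le> 2 * (C * err \<epsilon> l \<delta> + \<sigma>)"
  proof -
    have "0 \<le> err \<epsilon> l \<delta>"
      unfolding err_def using \<open>\<delta> > 0\<close> \<open>l > 0\<close> \<open>\<epsilon> > 0\<close> bM(2) by (intro add_nonneg_nonneg) auto
    then show ?thesis
      using C0 by (auto simp: \<sigma>_def l2_nonneg)
  qed
  ultimately have "b * N \<le> 2 * (C * err \<epsilon> l \<delta> + \<sigma>)"
    using N0 by (cases "N = 0") auto
  then have "N \<le> 2 * (C * err \<epsilon> l \<delta> + \<sigma>) / b"
    using b_pos by (simp add: field_simps)
  then have eN: "l2 ?e \<le> 2 * (C * err \<epsilon> l \<delta> + \<sigma>) / b"
    using l2_nonneg[of v] by (simp add: N_def)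

  let ?R = "\<lambda>z. indicator Om z * (u z - ?w (fst z))"
  have R: "sq_int ?R" "l2 ?R \<le> 2 * (b + M) * (\<epsilon> * C)"
  proof -
    note O = oscillation_bound[OF W(2)]
    show "sq_int ?R"
      by (rule O(1))
    show "l2 ?R \<le> 2 * (b + M) * (\<epsilon> * C)"
      using O(2) mult_left_mono[OF E(3), of "2 * (b + M)"] bM(2) by simp
  qed
  have mI: "(indicator Om :: real \<times> real \<Rightarrow> real) \<in> borel_measurable borel" "\<bar>indicator Om z :: real\<bar> \<le> 1 * indicator {- b..M} (snd z)" for z
    using Om_subset by (auto simp: indicator_def dest!: subsetD)
  have T: "sq_int (\<lambda>z. indicator Om z * ?e (fst z))" "l2 (\<lambda>z. indicator Om z * ?e (fst z)) \<le> sqrt (b + M) * l2 ?e"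
    using strip_sq_int[OF e mI bM(1)] by (auto simp: add.commute)
  have "l2 (\<lambda>z. indicator Om z * (u z - ?u0 (fst z))) = l2 (\<lambda>z. ?R z + indicator Om z * ?e (fst z))"
  proof -
    have [measurable]: "u \<in> borel_measurable borel" "?u0 \<in> borel_measurable borel" "?e \<in> borel_measurable borel" "?w \<in> borel_measurable borel"
      using D1(1) u0 e w by (auto simp: sq_int_def)
    have ae: "AE z in lborel. (indicator Om z * (u z - ?u0 (fst z)))\<^sup>2 = (?R z + indicator Om z * ?e (fst z))\<^sup>2"
      using AE_lborel2_fst[OF ew] by eventually_elim (auto simp: indicator_def)
    show ?thesis
      unfolding l2_def by (intro arg_cong[where f = sqrt] integral_cong_AE ae) measurable
  qed
  also have "\<dots> \<le> l2 ?R + l2 (\<lambda>z. indicator Om z * ?e (fst z))"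
    by (rule l2_triangle[OF R(1) T(1)])
  also have "\<dots> \<le> 2 * (b + M) * (\<epsilon> * C) + sqrt (b + M) * (2 * (C * err \<epsilon> l \<delta> + \<sigma>) / b)"
    using R(2) T(2) mult_left_mono[OF eN, of "sqrt (b + M)"] bM(2) by simp
  finally show ?thesis .
qed

section \<open>From the stated weak formulation to Borel representatives\<close>

lemma wdiff_iff_weak_deriv:
  assumes "borel_rep Om u u'" "borel_rep Om v v'" "e \<in> Basis"
  shows "wdiff e u' v' \<longleftrightarrow> L2_weak_deriv Om e u v"
  unfolding L2_weak_deriv_borel_rep[OF Om_borel assms] wdiff_def
  using borel_repD(1,2)[OF assms(1)] borel_repD(1,2)[OF assms(2)] by blast

lemma weak_solution_2D_rep:
  assumes sol: "weak_solution_2D Om \<epsilon> f u" and f: "f \<in> L2 Om"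
  obtains f' u' u1 u2 where "borel_rep Om f f'" "borel_rep Om u u'" "weak_eq \<epsilon> f' u' u1 u2"
proof -
  obtain v1 v2 where u: "u \<in> H1 Om" and d: "L2_weak_deriv Om (1, 0) u v1" "L2_weak_deriv Om (0, 1) u v2"
    and eq: "\<And>\<phi> \<phi>1 \<phi>2. \<phi> \<in> H1 Om \<Longrightarrow> L2_weak_deriv Om (1, 0) \<phi> \<phi>1 \<Longrightarrow> L2_weak_deriv Om (0, 1) \<phi> \<phi>2 \<Longrightarrow>
          (LINT x|lebesgue_on Om. v1 x * \<phi>1 x + 1 / \<epsilon>\<^sup>2 * (v2 x * \<phi>2 x) + u x * \<phi> x) = (LINT x|lebesgue_on Om. f x * \<phi> x)"
    using sol unfolding weak_solution_2D_def by blast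
  obtain f' where f': "borel_rep Om f f'"
    using L2_borel_rep[OF Om_borel f] by blast
  obtain u' where u': "borel_rep Om u u'"
    using L2_borel_rep[OF Om_borel] u by (auto simp: H1_def)
  obtain u1 where u1: "borel_rep Om v1 u1"
    using L2_borel_rep[OF Om_borel] d by (auto simp: L2_weak_deriv_def)
  obtain u2 where u2: "borel_rep Om v2 u2"
    using L2_borel_rep[OF Om_borel] d by (auto simp: L2_weak_deriv_def)
  have B: "(1, 0) \<in> (Basis :: (real \<times> real) set)" "(0, 1) \<in> (Basis :: (real \<times> real) set)"
    by (simp_all add: Basis_real_pair)
  have "weak_eq \<epsilon> f' u' u1 u2"
    unfolding weak_eq_def
  proof (intro conjI allI impI)
    show "wdiff (1, 0) u' u1" "wdiff (0, 1) u' u2"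
      using d wdiff_iff_weak_deriv[OF u' u1 B(1)] wdiff_iff_weak_deriv[OF u' u2 B(2)] by auto
    fix \<Phi> \<Phi>1 \<Phi>2
    assume W: "wdiff (1, 0) \<Phi> \<Phi>1" "wdiff (0, 1) \<Phi> \<Phi>2"
    note W1 = wdiffD[OF W(1)] and W2 = wdiffD[OF W(2)]
    have r: "borel_rep Om \<Phi> \<Phi>" "borel_rep Om \<Phi>1 \<Phi>1" "borel_rep Om \<Phi>2 \<Phi>2"
      using W unfolding wdiff_def by (auto intro!: borel_rep_self)
    have D: "L2_weak_deriv Om (1, 0) \<Phi> \<Phi>1" "L2_weak_deriv Om (0, 1) \<Phi> \<Phi>2"
      using W wdiff_iff_weak_deriv[OF r(1) r(2) B(1)] wdiff_iff_weak_deriv[OF r(1) r(3) B(2)] by auto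
    have "\<Phi> \<in> H1 Om"
      using D borel_rep_imp_L2(1)[OF Om_borel r(1)] by (auto simp: H1_def Basis_real_pair)
    note E = eq[OF this D]
    have [measurable]: "\<Phi> \<in> borel_measurable borel" "\<Phi>1 \<in> borel_measurable borel" "\<Phi>2 \<in> borel_measurable borel"
      "u' \<in> borel_measurable borel" "u1 \<in> borel_measurable borel" "u2 \<in> borel_measurable borel"
      using W1(1,2) W2(2) borel_repD(1)[OF u'] borel_repD(1)[OF u1] borel_repD(1)[OF u2] by (auto simp: sq_int_def)
    have "(LINT x|lebesgue_on Om. v1 x * \<Phi>1 x + 1 / \<epsilon>\<^sup>2 * (v2 x * \<Phi>2 x) + u x * \<Phi> x)
        = (LBINT x. u1 x * \<Phi>1 x + 1 / \<epsilon>\<^sup>2 * (u2 x * \<Phi>2 x) + u' x * \<Phi> x)"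
    proof (rule integral_lebesgue_on_AE_eq[OF Om_borel])
      show "AE x in lborel. x \<in> Om \<longrightarrow> v1 x * \<Phi>1 x + 1 / \<epsilon>\<^sup>2 * (v2 x * \<Phi>2 x) + u x * \<Phi> x
          = u1 x * \<Phi>1 x + 1 / \<epsilon>\<^sup>2 * (u2 x * \<Phi>2 x) + u' x * \<Phi> x"
        using borel_repD(3)[OF u'] borel_repD(3)[OF u1] borel_repD(3)[OF u2] by eventually_elim auto
      show "u1 x * \<Phi>1 x + 1 / \<epsilon>\<^sup>2 * (u2 x * \<Phi>2 x) + u' x * \<Phi> x = 0" if "x \<notin> Om" for x
        using borel_repD(2)[OF u' that] borel_repD(2)[OF u1 that] borel_repD(2)[OF u2 that] by simp
    qed measurable
    also have "\<dots> = (LBINT z. u1 z * \<Phi>1 z) + 1 / \<epsilon>\<^sup>2 * (LBINT z. u2 z * \<Phi>2 z) + (LBINT z. u' z * \<Phi> z)"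
      using sq_int_mult_integrable[OF borel_repD(1)[OF u1] W1(2)] sq_int_mult_integrable[OF borel_repD(1)[OF u2] W2(2)]
        sq_int_mult_integrable[OF borel_repD(1)[OF u'] W1(1)] by simp
    finally show "(LBINT z. u1 z * \<Phi>1 z) + 1 / \<epsilon>\<^sup>2 * (LBINT z. u2 z * \<Phi>2 z) + (LBINT z. u' z * \<Phi> z)
        = (LBINT z. f' z * \<Phi> z)"
      using E integral_mult_rep[OF f' r(1) Om_borel] by simp
  qed (use borel_repD(1,2)[OF f'] in auto)
  then show ?thesis
    using that f' u' by blast
qed

text \<open>A null set of the plane meets almost every column in a null set, so f and its Borel
  version have the same column integrals almost everywhere.\<close>

lemma column_integral_rep:
  assumes f: "borel_rep Om f f'"
  shows "borel_rep {0<..<1} (\<lambda>x. LINT y|lebesgue_on {- b<..<g x}. f (x, y)) (\<lambda>x. LBINT y. f' (x, y))"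
proof -
  note f' = borel_repD[OF f]
  have 0: "f' (x, y) = 0" if "x \<notin> {0<..<1}" for x y
    by (rule f'(2)) (use that in \<open>auto simp: mem_Om\<close>)
  have "AE x in lborel. AE y in lborel. (x, y) \<in> Om \<longrightarrow> f (x, y) = f' (x, y)"
    by (rule AE_lborel2_slice[OF f'(3)])
  then have "AE x in lborel. x \<in> {0<..<1} \<longrightarrow> (LINT y|lebesgue_on {- b<..<g x}. f (x, y)) = (LBINT y. f' (x, y))"
  proof eventually_elim
    case (elim x)
    show ?case
    proof
      assume x: "x \<in> {0<..<1}"
      show "(LINT y|lebesgue_on {- b<..<g x}. f (x, y)) = (LBINT y. f' (x, y))"
      proof (rule integral_lebesgue_on_AE_eq)
        show "AE y in lborel. y \<in> {- b<..<g x} \<longrightarrow> f (x, y) = f' (x, y)"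
          using elim by eventually_elim (use x in \<open>auto simp: mem_Om\<close>)
        show "f' (x, y) = 0" if "y \<notin> {- b<..<g x}" for y
          by (rule f'(2)) (use that in \<open>auto simp: mem_Om\<close>)
      qed (use borel_measurable_slice(1)[OF sq_intD(1)[OF f'(1)]] in auto)
    qed
  qed
  moreover have "sq_int (\<lambda>x. LBINT y. f' (x, y))"
  proof (rule column_integral_sq_int(1)[OF f'(1)])
    show "f' z = 0" if "snd z \<notin> {- b<..M}" for z
      by (rule supp_snd[OF f'(2) that])
  qed (use b_pos M_nonneg in auto)
  ultimately show ?thesis
    using 0 by (auto simp: borel_rep_def)
qed

end

section \<open>Rapidly oscillating coefficients\<close>

text \<open>For indicators of intervals the integral is a difference of two values of the primitive.
  Uniform boundedness of the \<open>q n\<close> makes the class of admissible k closed under L1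
  limits; Dynkin's theorem then reaches all Borel sets, and simple functions reach all integrable
  k.\<close>

lemma weakly_null_if_prim_null:
  fixes q :: "nat \<Rightarrow> real \<Rightarrow> real"
  assumes qm: "\<And>n. q n \<in> borel_measurable borel" and qB: "\<And>n x. \<bar>q n x\<bar> \<le> B * indicator {0<..<1} x"
    and lim: "\<And>x. (\<lambda>n. prim (q n) x) \<longlonglongrightarrow> 0" and k: "integrable lborel k"
  shows "(\<lambda>n. LBINT x. q n x * k x) \<longlonglongrightarrow> 0"
proof -
  let ?J = "indicator {0<..<1} :: real \<Rightarrow> real"
  have B0: "0 \<le> B"
    using qB[of 0 "1 / 2"] by simp
  have qB': "\<bar>q n x\<bar> \<le> B" for n x
    using qB[of n x] B0 by (cases "x \<in> {0<..<1}") auto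
  have q0: "q n x = 0" if "x \<notin> {0<..<1}" for n x
    using qB[of n x] that by simp
  have qi: "integrable lborel (q n)" for n
    by (rule sq_int_integrable[OF sq_int_bounded_supp[OF qm qB unit_fmeasurable] q0 unit_fmeasurable])
  have qk: "integrable lborel (\<lambda>x. q n x * h x)" if "integrable lborel h" for n h
    using integrable_mult_bounded[OF that qm qB'] by (simp add: mult.commute)
  \<comment> \<open>Replacing h by an approximation costs at most B times the L1 distance on the
    unit interval, uniformly in n.\<close>
  have closed: "(\<lambda>n. LBINT x. q n x * h x) \<longlonglongrightarrow> 0"
    if h: "integrable lborel h" and s: "\<And>i::nat. integrable lborel (s i)"
      and P: "\<And>i. (\<lambda>n. LBINT x. q n x * s i x) \<longlonglongrightarrow> 0"
      and L1: "(\<lambda>i. LBINT x. ?J x * \<bar>s i x - h x\<bar>) \<longlonglongrightarrow> 0" for h s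
  proof (rule tendstoI)
    fix e :: real
    assume "0 < e"
    have "(\<lambda>i. B * (LBINT x. ?J x * \<bar>s i x - h x\<bar>)) \<longlonglongrightarrow> B * 0"
      by (intro tendsto_intros L1)
    then have "\<forall>\<^sub>F i in sequentially. B * (LBINT x. ?J x * \<bar>s i x - h x\<bar>) < e / 2"
      using \<open>0 < e\<close> by (intro order_tendstoD(2)) auto
    then obtain i where i: "B * (LBINT x. ?J x * \<bar>s i x - h x\<bar>) < e / 2"
      by (auto simp: eventually_sequentially)
    have "\<forall>\<^sub>F n in sequentially. \<bar>LBINT x. q n x * s i x\<bar> < e / 2"
      using tendstoD[OF P[of i], of "e / 2"] \<open>0 < e\<close> by (simp add: dist_real_def)
    then show "\<forall>\<^sub>F n in sequentially. dist (LBINT x. q n x * h x) 0 < e"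
    proof eventually_elim
      case (elim n)
      have sh: "integrable lborel (\<lambda>x. s i x - h x)"
        using s h by simp
      have "(LBINT x. q n x * h x) = (LBINT x. q n x * s i x) - (LBINT x. q n x * (s i x - h x))"
        using qk[OF s[of i], of n] qk[OF h, of n] by (simp add: right_diff_distrib)
      moreover have "\<bar>LBINT x. q n x * (s i x - h x)\<bar> \<le> B * (LBINT x. ?J x * \<bar>s i x - h x\<bar>)"
      proof -
        have "\<bar>LBINT x. q n x * (s i x - h x)\<bar> \<le> (LBINT x. \<bar>q n x * (s i x - h x)\<bar>)"
          by (rule integral_abs_bound)
        also have "\<dots> \<le> (LBINT x. B * (?J x * \<bar>s i x - h x\<bar>))"
        proof (rule integral_mono)
          show "integrable lborel (\<lambda>x. B * (?J x * \<bar>s i x - h x\<bar>))"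
            by (intro integrable_mult_right integrable_indicator_mult integrable_abs sh) simp
          show "\<bar>q n x * (s i x - h x)\<bar> \<le> B * (?J x * \<bar>s i x - h x\<bar>)" for x
            using mult_right_mono[OF qB[of n x], of "\<bar>s i x - h x\<bar>"] by (simp add: abs_mult mult.assoc)
        qed (use qk[OF sh] in simp)
        finally show ?thesis
          by simp
      qed
      ultimately show ?case
        using elim i by (simp add: dist_real_def)
    qed
  qed
  have sets: "(\<lambda>n. LBINT x. q n x * indicator A x) \<longlonglongrightarrow> 0" if A: "A \<in> sets borel" for A
  proof -
    let ?E = "range (\<lambda>(a, b). box a b :: real set)"
    have E: "Int_stable ?E" "?E \<subseteq> Pow UNIV"
      by (auto simp: Int_stable_def box_Int_box)
    have sE: "sets borel = sigma_sets UNIV ?E"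
      by (simp add: borel_eq_box)
    have "A \<in> sigma_sets UNIV ?E"
      using A sE by simp
    with E show ?thesis
    proof (induction rule: sigma_sets_induct_disjoint)
      case (basic A)
      then obtain a b where A: "A = {a<..<b}"
        by (auto simp: box_real)
      show ?case
      proof (cases "a \<le> b")
        case True
        have "(LBINT x. q n x * indicator A x) = prim (q n) b - prim (q n) a" for n
          unfolding prim_increment[OF qi True] A
          using AE_lborel_singleton[of b] qm[of n] by (intro integral_cong_AE) (auto simp: indicator_def)
        then show ?thesis
          using tendsto_diff[OF lim[of b] lim[of a]] by simp
      qed (simp add: A)
    next
      case empty
      show ?case
        by simp
    next
      case (compl A)
      then have A: "A \<in> sets borel"
        using sE by simp
      \<comment> \<open>The integral of \<open>q n\<close> over the whole line is its primitive at
        1, so complements are covered.\<close>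
      have "(LBINT x. q n x * indicator (UNIV - A) x) = prim (q n) 1 - (LBINT x. q n x * indicator A x)" for n
      proof -
        have "(LBINT x. q n x * indicator (UNIV - A) x) = (LBINT x. q n x - q n x * indicator A x)"
          by (intro Bochner_Integration.integral_cong refl) (auto simp: indicator_def)
        also have "\<dots> = (LBINT x. q n x) - (LBINT x. q n x * indicator A x)"
          using integrable_indicator_mult[OF qi A, of n] qi[of n] by (simp add: mult.commute)
        also have "(LBINT x. q n x) = prim (q n) 1"
          by (rule prim_unit_interval(2)[symmetric]) (auto simp: q0)
        finally show ?thesis .
      qed
      then show ?case
        using tendsto_diff[OF lim[of 1] compl(2)] by simp
    next
      case (union A)
      have A: "A i \<in> sets borel" for i
        using union(2) sE by auto
      \<comment> \<open>Restricted to the unit interval, the union has finite measure and is the L1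
        limit of the finite unions; against \<open>q n\<close>, which vanishes elsewhere, the
        restriction changes nothing.\<close>
      let ?s = "\<lambda>i x. ?J x * indicator (\<Union>j<i. A j) x" and ?h = "\<lambda>x. ?J x * indicator (\<Union>i. A i) x"
      have J: "integrable lborel ?J"
        by (intro integrable_real_indicator) auto
      have "(\<lambda>n. LBINT x. q n x * ?h x) \<longlonglongrightarrow> 0"
      proof (rule closed[where s = ?s])
        show hi: "integrable lborel ?h"
          using integrable_indicator_mult[OF J, of "\<Union>i. A i"] A by (simp add: mult.commute)
        show si: "integrable lborel (?s i)" for i
          using integrable_indicator_mult[OF J, of "\<Union>j<i. A j"] A by (simp add: mult.commute)
        have "(LBINT x. q n x * ?s i x) = (\<Sum>j<i. (LBINT x. q n x * indicator (A j) x))" for n i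
        proof -
          have "indicator (\<Union>j<i. A j) x = (\<Sum>j<i. indicator (A j) x :: real)" for x
            using union(1) by (intro indicator_UN_disjoint) (auto simp: disjoint_family_on_def)
          then have "q n x * ?s i x = (\<Sum>j<i. q n x * indicator (A j) x)" for x
            using q0[of x n] by (cases "x \<in> {0<..<1}") (auto simp: sum_distrib_left)
          then have "(LBINT x. q n x * ?s i x) = (LBINT x. (\<Sum>j<i. q n x * indicator (A j) x))"
            by (intro Bochner_Integration.integral_cong refl)
          also have "\<dots> = (\<Sum>j<i. (LBINT x. q n x * indicator (A j) x))"
            using integrable_indicator_mult[OF qi A] by (intro Bochner_Integration.integral_sum) (simp add: mult.commute)
          finally show ?thesis .
        qed
        moreover have "(\<lambda>n. \<Sum>j<i. (LBINT x. q n x * indicator (A j) x)) \<longlonglongrightarrow> (\<Sum>j<i. 0)" for i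
          by (intro tendsto_sum union(3))
        ultimately show "(\<lambda>n. LBINT x. q n x * ?s i x) \<longlonglongrightarrow> 0" for i
          by simp
        have "(\<lambda>i. LBINT x. ?J x * \<bar>?s i x - ?h x\<bar>) \<longlonglongrightarrow> (LINT x|(lborel :: real measure). (0::real))"
        proof (rule integral_dominated_convergence[where w = ?J])
          show "AE x in lborel. (\<lambda>i. ?J x * \<bar>?s i x - ?h x\<bar>) \<longlonglongrightarrow> 0"
          proof (rule AE_I2)
            fix x :: real
            show "(\<lambda>i. ?J x * \<bar>?s i x - ?h x\<bar>) \<longlonglongrightarrow> 0"
            proof (cases "\<exists>j. x \<in> A j")
              case True
              then obtain j where j: "x \<in> A j" ..
              have "\<forall>\<^sub>F i in sequentially. ?J x * \<bar>?s i x - ?h x\<bar> = 0"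
                using eventually_gt_at_top[of j]
              proof eventually_elim
                case (elim i)
                then have "x \<in> (\<Union>j<i. A j)" "x \<in> (\<Union>i. A i)"
                  using j by auto
                then show ?case
                  by simp
              qed
              then show ?thesis
                by (rule tendsto_eventually)
            qed simp
          qed
        qed (use A J in \<open>auto simp: indicator_def\<close>)
        then show "(\<lambda>i. LBINT x. ?J x * \<bar>?s i x - ?h x\<bar>) \<longlonglongrightarrow> 0"
          by simp
      qed
      moreover have "q n x * ?h x = q n x * indicator (\<Union>i. A i) x" for n x
        using q0[of x n] by (cases "x \<in> {0<..<1}") auto
      ultimately show ?case
        by simp
    qed
  qed
  show ?thesis
    using k
  proof (induction rule: integrable_induct)
    case (base A c)
    then have "(\<lambda>n. (LBINT x. q n x * indicator A x) * c) \<longlonglongrightarrow> 0 * c"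
      by (intro tendsto_mult sets tendsto_const) simp
    then show ?case
      by (simp flip: integral_mult_left_zero add: mult.assoc)
  next
    case (add f g)
    have "(LBINT x. q n x * (f x + g x)) = (LBINT x. q n x * f x) + (LBINT x. q n x * g x)" for n
      using qk[OF add.hyps(1), of n] qk[OF add.hyps(2), of n] by (simp add: distrib_left)
    then show ?case
      using tendsto_add[OF add.IH] by simp
  next
    case (lim f s)
    show ?case
    proof (rule closed[OF lim.hyps(4,1) lim.IH])
      have "(\<lambda>i. LBINT x. ?J x * \<bar>s i x - f x\<bar>) \<longlonglongrightarrow> (LINT x|(lborel :: real measure). (0::real))"
      \<comment> \<open>The approximating simple functions are bounded by twice the modulus of
        f.\<close>
      proof (rule integral_dominated_convergence[where w = "\<lambda>x. 3 * \<bar>f x\<bar>"])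
        show "AE x in lborel. (\<lambda>i. ?J x * \<bar>s i x - f x\<bar>) \<longlonglongrightarrow> 0"
        proof (rule AE_I2)
          fix x :: real
          have "(\<lambda>i. ?J x * \<bar>s i x - f x\<bar>) \<longlonglongrightarrow> ?J x * \<bar>f x - f x\<bar>"
            using lim.hyps(2)[of x] by (intro tendsto_intros) auto
          then show "(\<lambda>i. ?J x * \<bar>s i x - f x\<bar>) \<longlonglongrightarrow> 0"
            by simp
        qed
        show "AE x in lborel. norm (?J x * \<bar>s i x - f x\<bar>) \<le> 3 * \<bar>f x\<bar>" for i
          using lim.hyps(3)[of _ i] by (intro AE_I2) (auto simp: indicator_def abs_le_iff, (smt (verit))+)
        show "(\<lambda>x. ?J x * \<bar>s i x - f x\<bar>) \<in> borel_measurable lborel" for i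
          using lim.hyps(1)[of i] lim.hyps(4) by auto
      qed (use lim.hyps(4) in auto)
      then show "(\<lambda>i. LBINT x. ?J x * \<bar>s i x - f x\<bar>) \<longlonglongrightarrow> 0"
        by simp
    qed
  qed
qed

text \<open>Full periods integrate to zero, so only a remainder of length at most L counts.\<close>

lemma periodic_zero_mean_prim_bound:
  fixes H :: "real \<Rightarrow> real"
  assumes m: "H \<in> borel_measurable borel" and K: "\<And>t. \<bar>H t\<bar> \<le> K" and per: "\<And>t. H (t + L) = H t" and "L > 0"
    and mean: "(LBINT t. indicator {0<..L} t * H t) = 0" and "0 \<le> y"
  shows "\<bar>LBINT t. indicator {0<..y} t * H t\<bar> \<le> L * K"
proof -
  have K0: "0 \<le> K"
    using K[of 0] by simp
  have int: "integrable lborel (\<lambda>t. indicator {a<..b} t * H t)" if "a \<le> b" for a b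
    by (rule integrable_mult_bounded[OF _ m K]) (use that in \<open>auto intro!: integrable_real_indicator\<close>)
  define I where "I y = (LBINT t. indicator {0<..y} t * H t)" for y
  have step: "I y = I (y - L)" if "L \<le> y" for y
  proof -
    have "I y = (LBINT t. indicator {0<..L} t * H t + indicator {L<..y} t * H t)"
      unfolding I_def using that \<open>L > 0\<close> by (intro Bochner_Integration.integral_cong refl) (auto simp: indicator_def)
    also have "\<dots> = (LBINT t. indicator {L<..y} t * H t)"
      using int[of 0 L] int[OF that] \<open>L > 0\<close> mean by simp
    also have "\<dots> = (LBINT t. indicator {L<..y} (L + 1 * t) * H (L + 1 * t))"
      by (subst lborel_integral_real_affine[where c = 1 and t = L]) simp_all
    also have "\<dots> = I (y - L)"
      unfolding I_def using per by (intro Bochner_Integration.integral_cong refl) (auto simp: indicator_def add.commute[of L])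
    finally show ?thesis .
  qed
  have small: "\<bar>I y\<bar> \<le> L * K" if "0 \<le> y" "y \<le> L" for y
  proof -
    have "\<bar>I y\<bar> \<le> (LBINT t. \<bar>indicator {0<..y} t * H t\<bar>)"
      unfolding I_def by (rule integral_abs_bound)
    also have "\<dots> \<le> (LBINT t. indicator {0<..y} t * K)"
      using int[OF that(1)] that K
      by (intro integral_mono integrable_abs integrable_mult_left integrable_real_indicator) (auto simp: indicator_def)
    also have "\<dots> = y * K"
      using that by simp
    also have "\<dots> \<le> L * K"
      using that K0 by (intro mult_right_mono)
    finally show ?thesis .
  qed
  have "\<forall>y. 0 \<le> y \<and> y < real n * L \<longrightarrow> \<bar>I y\<bar> \<le> L * K" for n
  proof (induction n)
    case (Suc n)
    show ?case
    proof (intro allI impI)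
      fix y
      assume y: "0 \<le> y \<and> y < real (Suc n) * L"
      show "\<bar>I y\<bar> \<le> L * K"
      proof (cases "y \<le> L")
        case True
        then show ?thesis
          using small y by simp
      next
        case False
        then show ?thesis
          using Suc[rule_format, of "y - L"] y step[of y] by (simp add: algebra_simps)
      qed
    qed
  qed simp
  moreover obtain n where "y / L < real n"
    using reals_Archimedean2 by blast
  then have "y < real n * L"
    using \<open>L > 0\<close> by (simp add: field_simps)
  ultimately show ?thesis
    using \<open>0 \<le> y\<close> by (auto simp: I_def)
qed

text \<open>The substitution t = \<mu> s contributes the factor \<mu>; the remaining integral of H
  over a long interval is bounded independently of its length.\<close>

lemma periodic_scaled_prim_bound:
  fixes H :: "real \<Rightarrow> real"
  assumes m: "H \<in> borel_measurable borel" and K: "\<And>t. \<bar>H t\<bar> \<le> K" and per: "\<And>t. H (t + L) = H t" and "L > 0"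
    and mean: "(LBINT t. indicator {0<..L} t * H t) = 0" and "\<mu> > 0"
  shows "\<bar>prim (\<lambda>t. indicator {0<..<1} t * H (t / \<mu>)) x\<bar> \<le> \<mu> * (L * K)"
proof -
  \<comment> \<open>Restricting the integrand to the unit interval amounts to clamping the end point
    x to [0, 1].\<close>
  define y where "y = max 0 (min x 1)"
  have "prim (\<lambda>t. indicator {0<..<1} t * H (t / \<mu>)) x = (LBINT t. indicator {0<..y} t * H (t / \<mu>))"
    unfolding prim_def
  proof (rule integral_cong_AE)
    show "AE t in lborel. indicator {..x} t * (indicator {0<..<1} t * H (t / \<mu>)) = indicator {0<..y} t * H (t / \<mu>)"
      using AE_lborel_singleton[of "1::real"] by eventually_elim (auto simp: y_def indicator_def)
  qed (use m in auto)
  also have "\<dots> = \<mu> * (LBINT t. indicator {0<..y} (0 + \<mu> * t) * H ((0 + \<mu> * t) / \<mu>))"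
    using \<open>\<mu> > 0\<close> by (subst lborel_integral_real_affine[where c = \<mu> and t = 0]) simp_all
  also have "(LBINT t. indicator {0<..y} (0 + \<mu> * t) * H ((0 + \<mu> * t) / \<mu>)) = (LBINT t. indicator {0<..y / \<mu>} t * H t)"
    using \<open>\<mu> > 0\<close> by (intro Bochner_Integration.integral_cong refl) (auto simp: indicator_def field_simps zero_less_mult_iff)
  finally have "\<bar>prim (\<lambda>t. indicator {0<..<1} t * H (t / \<mu>)) x\<bar> = \<mu> * \<bar>LBINT t. indicator {0<..y / \<mu>} t * H t\<bar>"
    using \<open>\<mu> > 0\<close> by (simp add: abs_mult)
  also have "\<dots> \<le> \<mu> * (L * K)"
    using \<open>\<mu> > 0\<close> by (intro mult_left_mono periodic_zero_mean_prim_bound[OF m K per \<open>L > 0\<close> mean]) (auto simp: y_def)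
  finally show ?thesis .
qed

lemma unit_integral_abs_le_l2:
  fixes h :: "real \<Rightarrow> real"
  assumes h: "sq_int h" "\<And>x. x \<notin> {0<..<1} \<Longrightarrow> h x = 0"
  shows "(LBINT x. \<bar>h x\<bar>) \<le> l2 h"
proof -
  let ?J = "indicator {0<..<1} :: real \<Rightarrow> real"
  have "sq_int (\<lambda>x. \<bar>h x\<bar>)"
    using h(1) by (auto simp: sq_int_def)
  moreover have "sq_int ?J"
    by (rule sq_int_indicator[OF unit_fmeasurable])
  ultimately have "\<bar>LBINT x. ?J x * \<bar>h x\<bar>\<bar> \<le> l2 ?J * l2 (\<lambda>x. \<bar>h x\<bar>)"
    by (intro Cauchy_Schwarz_l2)
  moreover have "?J x * \<bar>h x\<bar> = \<bar>h x\<bar>" for x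
    using h(2)[of x] by (cases "x \<in> {0<..<1}") auto
  moreover have "l2 ?J = 1"
    by (simp add: l2_def power2_eq_square flip: indicator_inter_arith)
  ultimately show ?thesis
    by (simp add: l2_def)
qed

text \<open>The step from weak to strong convergence: the L1 bound dominates all primitives on the
  unit interval, so their pointwise limit 0 is a limit in the quantity by which
  \<open>integral_ac_bound\<close> measures data.\<close>

lemma prim_l2_tendsto_zero:
  fixes h :: "nat \<Rightarrow> real \<Rightarrow> real"
  assumes h: "\<And>n. integrable lborel (h n)" "\<And>n x. x \<notin> {0<..<1} \<Longrightarrow> h n x = 0"
    and B: "\<And>n. (LBINT x. \<bar>h n x\<bar>) \<le> B" and lim: "\<And>x. (\<lambda>n. prim (h n) x) \<longlonglongrightarrow> 0"
  shows "(\<lambda>n. \<bar>LBINT x. h n x\<bar> + l2 (\<lambda>x. indicator {0<..<1} x * prim (h n) x)) \<longlonglongrightarrow> 0"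
proof -
  have m: "prim (h n) \<in> borel_measurable borel" for n
    by (rule prim_measurable) (use h in auto)
  have "(\<lambda>n. LBINT x. (indicator {0<..<1} x * prim (h n) x)\<^sup>2) \<longlonglongrightarrow> (LINT x|(lborel :: real measure). (0::real))"
  proof (rule integral_dominated_convergence[where w = "\<lambda>x. B\<^sup>2 * indicator {0<..<1} x"])
    show "AE x in lborel. (\<lambda>n. (indicator {0<..<1} x * prim (h n) x)\<^sup>2) \<longlonglongrightarrow> 0"
    proof (rule AE_I2)
      fix x :: real
      have "(\<lambda>n. (indicator {0<..<1} x * prim (h n) x)\<^sup>2) \<longlonglongrightarrow> (indicator {0<..<1} x * 0)\<^sup>2"
        by (intro tendsto_intros lim)
      then show "(\<lambda>n. (indicator {0<..<1} x * prim (h n) x)\<^sup>2) \<longlonglongrightarrow> 0"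
        by simp
    qed
    show "AE x in lborel. norm ((indicator {0<..<1} x * prim (h n) x)\<^sup>2) \<le> B\<^sup>2 * indicator {0<..<1} x" for n
    proof (rule AE_I2)
      fix x :: real
      have "\<bar>prim (h n) x\<bar> \<le> B"
        using abs_prim_le[OF h(1)[of n], of x] B[of n] by linarith
      then have "\<bar>prim (h n) x\<bar>\<^sup>2 \<le> B\<^sup>2"
        by (intro power_mono) auto
      then show "norm ((indicator {0<..<1} x * prim (h n) x)\<^sup>2) \<le> B\<^sup>2 * indicator {0<..<1} x"
        by (auto simp: indicator_def)
    qed
    show "integrable lborel (\<lambda>x. B\<^sup>2 * indicator {0<..<1::real} x)"
      by (intro integrable_mult_right integrable_real_indicator) auto
  qed (use m in auto)
  then have "(\<lambda>n. l2 (\<lambda>x. indicator {0<..<1} x * prim (h n) x)) \<longlonglongrightarrow> 0"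
    unfolding l2_def using tendsto_real_sqrt by fastforce
  moreover have "(LBINT x. h n x) = prim (h n) 1" for n
    by (rule prim_unit_interval(2)[symmetric]) (auto simp: h(2))
  then have "(\<lambda>n. \<bar>LBINT x. h n x\<bar>) \<longlonglongrightarrow> 0"
    using tendsto_rabs[OF lim[of 1]] by simp
  ultimately show ?thesis
    using tendsto_add by fastforce
qed

section \<open>The family of oscillating domains\<close>

locale oscillating_boundary =
  fixes \<alpha> b L \<epsilon>0 M y0 :: real and G :: "real \<Rightarrow> real"
  assumes \<alpha>: "\<alpha> > 1" and b_pos: "b > 0" and L_pos: "L > 0" and \<epsilon>0_pos: "\<epsilon>0 > 0"
    and periodic: "\<And>y. G (y + L) = G y" and G_nonneg: "\<And>y. 0 \<le> G y" and G_y0: "G y0 = 0"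
    and G_le: "\<And>y. G y \<le> M"
    and open_domain: "\<And>\<epsilon>. \<epsilon> \<in> {0<..<\<epsilon>0} \<Longrightarrow> open (osc_domain b G \<alpha> \<epsilon>)"
begin

lemma column: "\<epsilon> \<in> {0<..<\<epsilon>0} \<Longrightarrow> column_domain b M (osc G \<alpha> \<epsilon>)"
  using b_pos G_nonneg G_le open_domain[of \<epsilon>] by unfold_locales (auto simp: osc_def osc_domain_def)

lemma Om_eq: "\<epsilon> \<in> {0<..<\<epsilon>0} \<Longrightarrow> column_domain.Om b (osc G \<alpha> \<epsilon>) = osc_domain b G \<alpha> \<epsilon>"
  by (simp add: column_domain.Om_def[OF column] osc_domain_def)

lemma G_shift_nat: "G (y + real n * L) = G y"
proof (induction n)
  case (Suc n)
  have "G (y + real (Suc n) * L) = G ((y + real n * L) + L)"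
    by (simp add: algebra_simps)
  then show ?case
    using Suc periodic by simp
qed simp

lemma G_shift: "G (y + of_int k * L) = G y"
proof (cases "0 \<le> k")
  case True
  then show ?thesis
    using G_shift_nat[of y "nat k"] by simp
next
  case False
  then show ?thesis
    using G_shift_nat[of "y + of_int k * L" "nat (- k)"] by simp
qed

text \<open>Openness of the domains is pulled back to G. A shift by n periods makes y positive, and
  for small \<epsilon> the rescaled point lies in the unit interval, where the slice of the domain
  at height a is a superlevel set of the rescaled G. This is the origin of the Borel measurability
  of G.\<close>

lemma open_superlevel:
  assumes "0 \<le> a"
  shows "open {y. a < G y}"
proof (subst open_subopen, intro ballI)
  fix y
  assume y: "y \<in> {y. a < G y}"
  obtain n :: nat where "- y / L < real n"
    using reals_Archimedean2 by blast
  define s where "s = y + real n * L"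
  have s: "0 < s"
    using \<open>- y / L < real n\<close> L_pos by (simp add: s_def field_simps)
  \<comment> \<open>As \<epsilon>^\<alpha> <= \<epsilon> for \<epsilon> <= 1, the bound 1 / (2 s)
    keeps the rescaled point s \<epsilon>^\<alpha> at or below 1/2.\<close>
  define \<epsilon> where "\<epsilon> = min (\<epsilon>0 / 2) (min (1 / 2) (1 / (2 * s)))"
  have \<epsilon>: "0 < \<epsilon>" "\<epsilon> < \<epsilon>0" "\<epsilon> \<le> 1" "\<epsilon> \<le> 1 / (2 * s)"
    using s \<epsilon>0_pos by (auto simp: \<epsilon>_def)
  define \<mu> where "\<mu> = \<epsilon> powr \<alpha>"
  have \<mu>: "0 < \<mu>"
    using \<epsilon> by (simp add: \<mu>_def)
  have "\<mu> \<le> \<epsilon> powr 1"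
    unfolding \<mu>_def using \<epsilon> \<alpha> by (intro powr_mono') auto
  then have "s * \<mu> \<le> s * (1 / (2 * s))"
    using \<epsilon> s by (intro mult_left_mono) auto
  then have s\<mu>: "s * \<mu> < 1"
    using s by simp
  let ?V = "(\<lambda>y'. ((y' + real n * L) * \<mu>, a)) -` osc_domain b G \<alpha> \<epsilon>"
  have osc: "osc G \<alpha> \<epsilon> ((y' + real n * L) * \<mu>) = G y'" for y'
    using \<mu> G_shift_nat[of y' n] by (simp add: osc_def \<mu>_def)
  have "open ?V"
    using \<epsilon> by (intro open_vimage open_domain continuous_intros) auto
  moreover have "y \<in> ?V"
    using s \<mu> s\<mu> y assms b_pos osc[of y] by (simp add: osc_domain_def s_def)
  moreover have "?V \<subseteq> {y. a < G y}"
    using osc by (auto simp: osc_domain_def)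
  ultimately show "\<exists>T. open T \<and> y \<in> T \<and> T \<subseteq> {y. a < G y}"
    by blast
qed

lemma G_borel [measurable]: "G \<in> borel_measurable borel"
proof -
  have "{y \<in> space borel. a < G y} \<in> sets borel" for a
  proof (cases "0 \<le> a")
    case True
    then show ?thesis
      using borel_open[OF open_superlevel[OF True]] by simp
  next
    case False
    then have "a < G y" for y
      using G_nonneg[of y] by linarith
    then have "{y \<in> space borel. a < G y} = UNIV"
      by simp
    then show ?thesis
      by simp
  qed
  then show ?thesis
    by (subst borel_measurable_iff_greater) blast
qed

definition mean :: real where
  "mean = (LBINT t. indicator {0<..L} t * G t) / L"

lemma integral_cell:
  "(LINT y|lebesgue_on {0..L}. G y) = L * mean" "(LBINT t. indicator {0<..<L} t * G t) = L * mean"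
proof -
  have "(LINT y|lebesgue_on {0..L}. G y) = (LBINT y. indicator {0..L} y * G y)"
    by (rule integral_lebesgue_on_AE_eq) auto
  also have "\<dots> = (LBINT t. indicator {0<..L} t * G t)"
    using AE_lborel_singleton[of "0::real"] by (intro integral_cong_AE) (auto simp: indicator_def)
  finally show "(LINT y|lebesgue_on {0..L}. G y) = L * mean"
    using L_pos by (simp add: mean_def)
  have "(LBINT t. indicator {0<..<L} t * G t) = (LBINT t. indicator {0<..L} t * G t)"
    using AE_lborel_singleton[of L] by (intro integral_cong_AE) (auto simp: indicator_def)
  then show "(LBINT t. indicator {0<..<L} t * G t) = L * mean"
    using L_pos by (simp add: mean_def)
qed

lemma G_cell_integrable: "integrable lborel (\<lambda>t. indicator {0<..L} t * G t)"
  by (rule integrable_mult_bounded[where B = M])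
     (use L_pos G_nonneg G_le in \<open>auto intro!: integrable_real_indicator\<close>)

lemma mean_bounds: "0 \<le> mean" "mean \<le> M"
proof -
  show "0 \<le> mean"
    unfolding mean_def using L_pos G_nonneg by (intro divide_nonneg_pos integral_nonneg_AE) auto
  have "(LBINT t. indicator {0<..L} t * G t) \<le> (LBINT t. indicator {0<..L} t * M)"
    using L_pos G_le
    by (intro integral_mono G_cell_integrable integrable_mult_left integrable_real_indicator) (auto simp: indicator_def)
  also have "\<dots> = L * M"
    using L_pos by simp
  finally show "mean \<le> M"
    using L_pos by (simp add: mean_def field_simps)
qed

lemma oscillation_abs_le: "\<bar>G t - mean\<bar> \<le> M"
  using G_nonneg[of t] G_le[of t] mean_bounds by auto

text \<open>By periodicity the primitive of the centred oscillation is of order \<epsilon>^\<alpha>;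
  \<open>weakly_null_if_prim_null\<close> then admits every integrable k.\<close>

lemma osc_weakly_null:
  assumes S: "\<And>n. S n \<in> {0<..<\<epsilon>0}" "S \<longlonglongrightarrow> 0" and k: "integrable lborel k"
  shows "(\<lambda>n. LBINT x. (indicator {0<..<1} x * (osc G \<alpha> (S n) x - mean)) * k x) \<longlonglongrightarrow> 0"
proof (rule weakly_null_if_prim_null[OF _ _ _ k])
  show "(\<lambda>x. indicator {0<..<1} x * (osc G \<alpha> (S n) x - mean)) \<in> borel_measurable borel" for n
    unfolding osc_def by measurable
  show "\<bar>indicator {0<..<1} x * (osc G \<alpha> (S n) x - mean)\<bar> \<le> M * indicator {0<..<1} x" for n x
    using oscillation_abs_le by (auto simp: osc_def indicator_def)
  show "(\<lambda>n. prim (\<lambda>x. indicator {0<..<1} x * (osc G \<alpha> (S n) x - mean)) x) \<longlonglongrightarrow> 0" for x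
  proof (rule Lim_null_comparison)
    have zero: "(LBINT t. indicator {0<..L} t * (G t - mean)) = 0"
    proof -
      have "(LBINT t. indicator {0<..L} t * (G t - mean))
          = (LBINT t. indicator {0<..L} t * G t - indicator {0<..L} t * mean)"
        by (simp add: right_diff_distrib)
      also have "\<dots> = 0"
        using G_cell_integrable L_pos by (subst Bochner_Integration.integral_diff) (auto simp: mean_def intro!: integrable_mult_left integrable_real_indicator)
      finally show ?thesis .
    qed
    have "\<bar>prim (\<lambda>x. indicator {0<..<1} x * (osc G \<alpha> (S n) x - mean)) x\<bar> \<le> S n powr \<alpha> * (L * M)" for n
      unfolding osc_def
      by (rule periodic_scaled_prim_bound[where H = "\<lambda>t. G t - mean", OF _ oscillation_abs_le _ L_pos zero])
         (use S(1)[of n] periodic in auto)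
    then show "\<forall>\<^sub>F n in sequentially. norm (prim (\<lambda>x. indicator {0<..<1} x * (osc G \<alpha> (S n) x - mean)) x) \<le> S n powr \<alpha> * (L * M)"
      by simp
    have "(\<lambda>n. S n powr \<alpha>) \<longlonglongrightarrow> 0"
      by (rule tendsto_zero_powrI[OF S(2) tendsto_const]) (use S(1) \<alpha> in \<open>auto intro!: always_eventually less_imp_le\<close>)
    from tendsto_mult_right[OF this, of "L * M"] show "(\<lambda>n. S n powr \<alpha> * (L * M)) \<longlonglongrightarrow> 0"
      by simp
  qed
qed

text \<open>Weak convergence tested with the indicator of an initial interval is pointwise
  convergence of the primitives.\<close>

lemma column_integral_weak_limit:
  assumes weak: "L2_weakly_converges {0<..<1} (\<lambda>\<epsilon>. vertical_integral b G \<alpha> \<epsilon> (f \<epsilon>)) fhat (at_right 0)"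
    and fh: "borel_rep {0<..<1} fhat fh" and S: "\<And>n. S n \<in> {0<..<\<epsilon>0}" "S \<longlonglongrightarrow> 0"
    and rep: "\<And>n. borel_rep (osc_domain b G \<alpha> (S n)) (f (S n)) (f' n)"
  shows "(\<lambda>n. prim (\<lambda>x. LBINT y. f' n (x, y)) x) \<longlonglongrightarrow> prim fh x"
proof -
  let ?J = "{0<..<1} :: real set"
  define \<phi> :: "real \<Rightarrow> real" where "\<phi> t = indicator ({..x} \<inter> ?J) t" for t
  have "{..x} \<inter> ?J \<in> fmeasurable lborel"
    by (rule fmeasurable_Int_fmeasurable[OF unit_fmeasurable, of "{..x}", unfolded Int_commute[of ?J]]) simp
  then have \<phi>: "borel_rep ?J \<phi> \<phi>"
    using sq_int_indicator by (intro borel_rep_self) (auto simp: \<phi>_def[abs_def])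
  have \<phi>_L2: "\<phi> \<in> L2 ?J"
    by (rule borel_rep_imp_L2(1)[OF _ \<phi>]) simp
  have F: "borel_rep ?J (vertical_integral b G \<alpha> (S n) (f (S n))) (\<lambda>x. LBINT y. f' n (x, y))" for n
    using column_domain.column_integral_rep[OF column[OF S(1)[of n]], of "f (S n)" "f' n"] rep[of n]
    by (simp add: Om_eq[OF S(1)] vertical_integral_def[abs_def])
  have filt: "filterlim S (at_right 0) sequentially"
    by (rule tendsto_imp_filterlim_at_right[OF S(2)]) (use S(1) in auto)
  have "((\<lambda>\<epsilon>. LINT t|lebesgue_on ?J. vertical_integral b G \<alpha> \<epsilon> (f \<epsilon>) t * \<phi> t) \<longlongrightarrow> (LINT t|lebesgue_on ?J. fhat t * \<phi> t)) (at_right 0)"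
    using weak \<phi>_L2 by (auto simp: L2_weakly_converges_def)
  from filterlim_compose[OF this filt]
  have lim: "(\<lambda>n. LINT t|lebesgue_on ?J. vertical_integral b G \<alpha> (S n) (f (S n)) t * \<phi> t) \<longlonglongrightarrow> (LINT t|lebesgue_on ?J. fhat t * \<phi> t)" .
  have prim: "(LINT t|lebesgue_on ?J. k t * \<phi> t) = prim k' x" if "borel_rep ?J k k'" for k k'
  proof -
    have "(LINT t|lebesgue_on ?J. k t * \<phi> t) = (LBINT t. k' t * \<phi> t)"
      by (rule integral_mult_rep[OF that \<phi>]) simp
    also have "\<dots> = prim k' x"
      unfolding prim_def
    proof (intro Bochner_Integration.integral_cong refl)
      show "k' t * \<phi> t = indicator {..x} t * k' t" for t
        using borel_repD(2)[OF that, of t] by (cases "t \<in> ?J") (auto simp: \<phi>_def indicator_def)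
    qed
    finally show ?thesis .
  qed
  show ?thesis
    using lim by (simp only: prim[OF F] prim[OF fh])
qed

text \<open>The limit is taken along arbitrary sequences tending to 0 from the right, which makes
  dominated convergence in the index available. The bound of \<open>convergence_estimate\<close>
  then tends to 0 term by term.\<close>

lemma homogenized_limit:
  assumes f_L2: "\<And>\<epsilon>. \<epsilon> \<in> {0<..<\<epsilon>0} \<Longrightarrow> f \<epsilon> \<in> L2 (osc_domain b G \<alpha> \<epsilon>)"
    and f_bound: "\<And>\<epsilon>. \<epsilon> \<in> {0<..<\<epsilon>0} \<Longrightarrow> L2_norm (osc_domain b G \<alpha> \<epsilon>) (f \<epsilon>) \<le> C"
    and weak: "L2_weakly_converges {0<..<1} (\<lambda>\<epsilon>. vertical_integral b G \<alpha> \<epsilon> (f \<epsilon>)) fhat (at_right 0)"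
    and sol: "\<And>\<epsilon>. \<epsilon> \<in> {0<..<\<epsilon>0} \<Longrightarrow> weak_solution_2D (osc_domain b G \<alpha> \<epsilon>) \<epsilon> (f \<epsilon>) (u \<epsilon>)"
    and fh: "borel_rep {0<..<1} fhat fh"
    and v0: "sq_int v0" "\<And>x. x \<notin> {0<..<1} \<Longrightarrow> v0 x = 0"
    and limit: "\<And>a w. sq_int w \<Longrightarrow> (\<And>x. x \<notin> {0<..<1} \<Longrightarrow> w x = 0) \<Longrightarrow>
       b * (LBINT x. v0 x * w x) + (b + mean) * (LBINT x. ac c0 v0 x * ac a w x) = (LBINT x. fh x * ac a w x)"
  shows "((\<lambda>\<epsilon>. L2_norm (osc_domain b G \<alpha> \<epsilon>) (\<lambda>x. u \<epsilon> x - (c0 + prim v0 (fst x)))) \<longlongrightarrow> 0) (at_right 0)"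
proof (rule tendsto_at_right_sequentially[OF \<epsilon>0_pos])
  fix S :: "nat \<Rightarrow> real"
  assume S0: "\<And>n. 0 < S n" "\<And>n. S n < \<epsilon>0" "S \<longlonglongrightarrow> 0"
  then have S: "S n \<in> {0<..<\<epsilon>0}" for n
    by simp
  let ?J = "indicator {0<..<1} :: real \<Rightarrow> real"
  let ?Om = "\<lambda>n. osc_domain b G \<alpha> (S n)" and ?g = "\<lambda>n. osc G \<alpha> (S n)"
  have M0: "0 \<le> M"
    using G_nonneg G_le order_trans by blast
  let ?P = "\<lambda>n f' u' u1 u2. borel_rep (?Om n) (f (S n)) f' \<and> borel_rep (?Om n) (u (S n)) u' \<and>
      column_domain.weak_eq b (?g n) (S n) f' u' u1 u2"
  have ex: "\<exists>f' u' u1 u2. ?P n f' u' u1 u2" for n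
  proof -
    interpret C: column_domain b M "?g n"
      by (rule column[OF S])
    have "weak_solution_2D C.Om (S n) (f (S n)) (u (S n))" "f (S n) \<in> L2 C.Om"
      using sol[OF S] f_L2[OF S] by (simp_all add: Om_eq[OF S])
    then obtain f' u' u1 u2 where "borel_rep C.Om (f (S n)) f'" "borel_rep C.Om (u (S n)) u'" "C.weak_eq (S n) f' u' u1 u2"
      by (rule C.weak_solution_2D_rep)
    then have "?P n f' u' u1 u2"
      by (simp only: Om_eq[OF S] simp_thms)
    then show ?thesis
      by blast
  qed
  from choice[OF allI[OF ex]] obtain f' where ex1: "\<forall>n. \<exists>u' u1 u2. ?P n (f' n) u' u1 u2" ..
  from choice[OF ex1] obtain u' where ex2: "\<forall>n. \<exists>u1 u2. ?P n (f' n) (u' n) u1 u2" ..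
  from choice[OF ex2] obtain u1 where ex3: "\<forall>n. \<exists>u2. ?P n (f' n) (u' n) (u1 n) u2" ..
  from choice[OF ex3] obtain u2 where P: "\<forall>n. ?P n (f' n) (u' n) (u1 n) (u2 n)" ..
  then have f': "borel_rep (?Om n) (f (S n)) (f' n)" and u': "borel_rep (?Om n) (u (S n)) (u' n)" and
    eq: "column_domain.weak_eq b (?g n) (S n) (f' n) (u' n) (u1 n) (u2 n)" for n
    by simp_all
  have Om_sets: "?Om n \<in> sets borel" for n
    by (rule borel_open[OF open_domain[OF S]])
  have C: "l2 (f' n) \<le> C" for n
    using f_bound[OF S[of n]] borel_rep_imp_L2(2)[OF Om_sets f'[of n]] by simp
  have v0i: "integrable lborel v0"
    by (rule sq_int_integrable[OF v0 unit_fmeasurable])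
  have u0: "sq_int (ac c0 v0)"
    by (rule ac_sq_int[OF v0i])
  have u0i: "integrable lborel (ac c0 v0)"
    by (rule sq_int_integrable[OF u0 ac_zero unit_fmeasurable])
  have fhi: "integrable lborel fh"
    by (rule sq_int_integrable[OF borel_repD(1,2)[OF fh] unit_fmeasurable])
  define F where "F n x = (LBINT y. f' n (x, y))" for n x
  define q where "q n x = ?J x * (?g n x - mean)" for n x
  define h where "h n x = F n x - fh x - q n x * ac c0 v0 x" for n x
  define \<sigma> where "\<sigma> n = \<bar>LBINT x. h n x\<bar> + l2 (\<lambda>x. ?J x * prim (h n) x)" for n
  \<comment> \<open>The width of one tooth; the value of \<delta> below equalizes the orders of the
    first two terms of \<open>err\<close>.\<close>
  define l where "l n = S n powr \<alpha> * L" for n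
  define \<delta> where "\<delta> n = S n powr (\<alpha> - 1)" for n
  have pos: "0 < l n" "0 < \<delta> n" for n
    using S0(1)[of n] L_pos by (simp_all add: l_def \<delta>_def)

  have Frep: "borel_rep {0<..<1} (\<lambda>x. LINT y|lebesgue_on {- b<..<?g n x}. f (S n) (x, y)) (F n)" for n
    unfolding F_def using column_domain.column_integral_rep[OF column[OF S[of n]], of "f (S n)" "f' n"] f'[of n]
    by (simp add: Om_eq[OF S])
  have F: "sq_int (F n)" "\<And>x. x \<notin> {0<..<1} \<Longrightarrow> F n x = 0" for n
    using borel_repD(1,2)[OF Frep[of n]] by auto
  have Fi: "integrable lborel (F n)" for n
    by (rule sq_int_integrable[OF F unit_fmeasurable])
  have F_l2: "l2 (F n) \<le> sqrt (b + M) * C" for n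
  proof -
    have "l2 (F n) \<le> sqrt (M - - b) * l2 (f' n)"
      unfolding F_def
    proof (rule column_integral_sq_int(2)[OF borel_repD(1)[OF f']])
      show "f' n z = 0" if "snd z \<notin> {- b<..M}" for z
        by (rule borel_repD(2)[OF f']) (use that G_le[of "fst z / S n powr \<alpha>"] in \<open>auto simp: osc_domain_def osc_def\<close>)
    qed (use b_pos M0 in auto)
    also have "\<dots> \<le> sqrt (M - - b) * C"
      using C[of n] b_pos M0 by (intro mult_left_mono) auto
    finally show ?thesis
      by (simp add: add.commute)
  qed
  have qm: "q n \<in> borel_measurable borel" for n
    unfolding q_def osc_def by measurable
  have qB: "\<bar>q n x\<bar> \<le> M" for n x
    using oscillation_abs_le M0 by (auto simp: q_def osc_def indicator_def)
  have qu: "integrable lborel (\<lambda>x. q n x * ac c0 v0 x)" for n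
    using integrable_mult_bounded[OF u0i qm qB] by (simp add: mult.commute)
  have hi: "integrable lborel (h n)" for n
    unfolding h_def using Fi fhi qu by simp
  have h0: "h n x = 0" if "x \<notin> {0<..<1}" for n x
    using F(2)[OF that] borel_repD(2)[OF fh that] that by (simp add: h_def q_def)
  have h_bound: "(LBINT x. \<bar>h n x\<bar>) \<le> sqrt (b + M) * C + (LBINT x. \<bar>fh x\<bar>) + M * (LBINT x. \<bar>ac c0 v0 x\<bar>)" for n
  proof -
    have "(LBINT x. \<bar>h n x\<bar>) \<le> (LBINT x. \<bar>F n x\<bar> + \<bar>fh x\<bar> + M * \<bar>ac c0 v0 x\<bar>)"
    proof (rule integral_mono)
      show "\<bar>h n x\<bar> \<le> \<bar>F n x\<bar> + \<bar>fh x\<bar> + M * \<bar>ac c0 v0 x\<bar>" for x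
      proof -
        have "\<bar>q n x * ac c0 v0 x\<bar> \<le> M * \<bar>ac c0 v0 x\<bar>"
          using mult_right_mono[OF qB[of n x], of "\<bar>ac c0 v0 x\<bar>"] by (simp add: abs_mult)
        then show ?thesis
          unfolding h_def by linarith
      qed
    qed (use hi Fi fhi u0i in auto)
    also have "\<dots> = (LBINT x. \<bar>F n x\<bar>) + (LBINT x. \<bar>fh x\<bar>) + M * (LBINT x. \<bar>ac c0 v0 x\<bar>)"
      using Fi fhi u0i by simp
    finally show ?thesis
      using unit_integral_abs_le_l2[OF F, of n] F_l2[of n] by simp
  qed
  \<comment> \<open>The source part converges by the weak hypothesis on the data; the oscillating
    height is tested against the fixed integrable function \<open>ac c0 v0\<close> cut off at
    x.\<close>
  have h_lim: "(\<lambda>n. prim (h n) x) \<longlonglongrightarrow> 0" for x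
  proof -
    have "prim (h n) x = (prim (F n) x - prim fh x) - (LBINT t. q n t * (indicator {..x} t * ac c0 v0 t))" for n
    proof -
      have "prim (h n) x = prim (\<lambda>t. F n t - fh t) x - prim (\<lambda>t. q n t * ac c0 v0 t) x"
        unfolding h_def by (rule prim_diff[OF _ qu]) (use Fi fhi in auto)
      also have "prim (\<lambda>t. F n t - fh t) x = prim (F n) x - prim fh x"
        by (rule prim_diff[OF Fi fhi])
      finally show ?thesis
        by (simp add: prim_def mult.left_commute)
    qed
    moreover have A: "(\<lambda>n. prim (F n) x - prim fh x) \<longlonglongrightarrow> prim fh x - prim fh x"
      unfolding F_def by (intro tendsto_intros column_integral_weak_limit[OF weak fh S S0(3) f'])
    moreover have B: "(\<lambda>n. LBINT t. q n t * (indicator {..x} t * ac c0 v0 t)) \<longlonglongrightarrow> 0"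
      unfolding q_def by (intro osc_weakly_null S S0(3) integrable_indicator_mult u0i) simp
    ultimately show ?thesis
      using tendsto_diff[OF A B] by simp
  qed
  have \<sigma>_lim: "\<sigma> \<longlonglongrightarrow> 0"
    unfolding \<sigma>_def by (rule prim_l2_tendsto_zero[OF hi h0 h_bound h_lim])

  have norm_eq: "L2_norm (?Om n) (\<lambda>x. u (S n) x - (c0 + prim v0 (fst x)))
      = l2 (\<lambda>z. indicator (?Om n) z * (u' n z - ac c0 v0 (fst z)))" for n
  proof (rule borel_rep_imp_L2(2)[OF Om_sets])
    interpret C: column_domain b M "?g n"
      by (rule column[OF S])
    have sq: "sq_int (\<lambda>z. indicator (?Om n) z * ac c0 v0 (fst z))"
      by (rule strip_sq_int(1)[OF u0, where B = 1 and p = "- b" and q = M])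
         (use C.Om_subset Om_sets b_pos M0 in \<open>auto simp: Om_eq[OF S] indicator_def dest!: subsetD\<close>)
    have "sq_int (\<lambda>z. u' n z - indicator (?Om n) z * ac c0 v0 (fst z))"
      by (rule sq_int_diff[OF borel_repD(1)[OF u'] sq])
    moreover have "u' n z - indicator (?Om n) z * ac c0 v0 (fst z) = indicator (?Om n) z * (u' n z - ac c0 v0 (fst z))" for z
      using borel_repD(2)[OF u'[of n], of z] by (cases "z \<in> ?Om n") auto
    ultimately have "sq_int (\<lambda>z. indicator (?Om n) z * (u' n z - ac c0 v0 (fst z)))"
      by simp
    moreover have "AE z in lborel. z \<in> ?Om n \<longrightarrow> u (S n) z - (c0 + prim v0 (fst z)) = indicator (?Om n) z * (u' n z - ac c0 v0 (fst z))"
      using borel_repD(3)[OF u'[of n]] by eventually_elim (auto simp: ac_def osc_domain_def)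
    ultimately show "borel_rep (?Om n) (\<lambda>x. u (S n) x - (c0 + prim v0 (fst x))) (\<lambda>z. indicator (?Om n) z * (u' n z - ac c0 v0 (fst z)))"
      by (auto simp: borel_rep_def)
  qed
  define bound where "bound n = 2 * (b + M) * (S n * C)
      + sqrt (b + M) * (2 * (C * column_domain.err b M (S n) (l n) (\<delta> n) + \<sigma> n) / b)" for n
  have le: "L2_norm (?Om n) (\<lambda>x. u (S n) x - (c0 + prim v0 (fst x))) \<le> bound n" for n
  proof -
    interpret C: column_domain b M "?g n"
      by (rule column[OF S])
    \<comment> \<open>The rescaled translates of the zero \<open>y0\<close> of G are zeros of the
      upper boundary and lie at distance l from each other.\<close>
    have grid: "?g n (y0 * S n powr \<alpha> + l n * of_int k) = 0" for k
    proof -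
      have "(y0 * S n powr \<alpha> + l n * of_int k) / S n powr \<alpha> = y0 + of_int k * L"
        using S0(1)[of n] by (simp add: l_def field_simps)
      then show ?thesis
        by (simp add: osc_def G_shift G_y0)
    qed
    have hh: "h n = (\<lambda>x. (LBINT y. f' n (x, y)) - fh x - ?J x * (b + ?g n x - (b + mean)) * ac c0 v0 x)"
      by (simp add: fun_eq_iff h_def F_def q_def)
    show ?thesis
      unfolding norm_eq
      unfolding bound_def \<sigma>_def hh Om_eq[OF S, symmetric]
    proof (rule C.convergence_estimate[where f = "f' n" and u = "u' n" and ?u1.0 = "u1 n" and ?u2.0 = "u2 n"
          and fh = fh and ?v0.0 = v0 and ?c0.0 = c0 and p = "b + mean" and ?x0.0 = "y0 * S n powr \<alpha>"])
      show "fh x = 0" "v0 x = 0" if "x \<notin> {0<..<1}" for x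
        using borel_repD(2)[OF fh that] v0(2)[OF that] by auto
      show "b * (LBINT x. v0 x * w x) + (b + mean) * (LBINT x. ac c0 v0 x * ac a w x) = (LBINT x. fh x * ac a w x)"
        if "sq_int w" "\<And>x. x \<notin> {0<..<1} \<Longrightarrow> w x = 0" for a w
        by (rule limit[OF that])
    qed (fact eq S0(1) C pos grid borel_repD(1)[OF fh] v0(1))+
  qed
  \<comment> \<open>Since l = L \<epsilon> \<delta>, the second term of \<open>err\<close> becomes L
    sqrt \<delta>.\<close>
  have err: "column_domain.err b M (S n) (l n) (\<delta> n)
      = sqrt (\<delta> n) + L * sqrt (\<delta> n) + 2 * sqrt (b + M) * l n + 2 * (b + M) * sqrt (b + M) * S n" for n
  proof -
    have "l n = L * (S n * \<delta> n)"
      using S0(1)[of n] by (simp add: l_def \<delta>_def powr_diff)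
    then have "l n / (S n * sqrt (\<delta> n)) = L * (\<delta> n / sqrt (\<delta> n))"
      using S0(1)[of n] by simp
    also have "\<delta> n / sqrt (\<delta> n) = sqrt (\<delta> n)"
      using pos(2)[of n] by (simp add: real_div_sqrt)
    finally show ?thesis
      by (simp add: column_domain.err_def[OF column[OF S[of n]]])
  qed
  have \<delta>_lim: "\<delta> \<longlonglongrightarrow> 0" and l_lim: "l \<longlonglongrightarrow> 0"
  proof -
    have "(\<lambda>n. S n powr \<beta>) \<longlonglongrightarrow> 0" if "\<beta> > 0" for \<beta>
      by (rule tendsto_zero_powrI[OF S0(3) tendsto_const]) (use S0(1) that in \<open>auto intro!: always_eventually less_imp_le\<close>)
    from this[of "\<alpha> - 1"] tendsto_mult_right[OF this[of \<alpha>], of L] show "\<delta> \<longlonglongrightarrow> 0" "l \<longlonglongrightarrow> 0"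
      using \<alpha> by (simp_all add: \<delta>_def[abs_def] l_def[abs_def])
  qed
  have "bound \<longlonglongrightarrow> 2 * (b + M) * (0 * C)
      + sqrt (b + M) * (2 * (C * (sqrt 0 + L * sqrt 0 + 2 * sqrt (b + M) * 0 + 2 * (b + M) * sqrt (b + M) * 0) + 0) / b)"
    unfolding bound_def err using b_pos by (intro tendsto_intros \<delta>_lim l_lim S0(3) \<sigma>_lim) auto
  then have "bound \<longlonglongrightarrow> 0"
    by simp
  then show "(\<lambda>n. L2_norm (?Om n) (\<lambda>x. u (S n) x - (c0 + prim v0 (fst x)))) \<longlonglongrightarrow> 0"
  proof (rule Lim_null_comparison[rotated])
    have "norm (L2_norm (?Om n) (\<lambda>x. u (S n) x - (c0 + prim v0 (fst x)))) \<le> bound n" for n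
      using le[of n] by (simp add: norm_eq l2_nonneg)
    then show "\<forall>\<^sub>F n in sequentially. norm (L2_norm (?Om n) (\<lambda>x. u (S n) x - (c0 + prim v0 (fst x)))) \<le> bound n"
      by simp
  qed
qed

text \<open>If the source depends on x alone, its column integral is the column length times g. The
  column length tends weakly to b + \<open>mean\<close>, so the weak limit of the column integrals
  is (b + \<open>mean\<close>) g.\<close>

lemma common_source:
  assumes weak: "L2_weakly_converges {0<..<1} (\<lambda>\<epsilon>. vertical_integral b G \<alpha> \<epsilon> (f \<epsilon>)) fhat (at_right 0)"
    and f_L2: "\<And>\<epsilon>. \<epsilon> \<in> {0<..<\<epsilon>0} \<Longrightarrow> f \<epsilon> \<in> L2 (osc_domain b G \<alpha> \<epsilon>)"
    and fg: "\<And>\<epsilon>. \<epsilon> \<in> {0<..<\<epsilon>0} \<Longrightarrow> AE x in lebesgue_on (osc_domain b G \<alpha> \<epsilon>). f \<epsilon> x = g (fst x)"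
    and fh: "borel_rep {0<..<1} fhat fh"
  shows "AE x in lborel. x \<in> {0<..<1} \<longrightarrow> fh x = (b + mean) * g x"
proof -
  let ?J = "indicator {0<..<1} :: real \<Rightarrow> real"
  define S :: "nat \<Rightarrow> real" where "S n = \<epsilon>0 / 2 * inverse (real (Suc n))" for n
  have S: "S n \<in> {0<..<\<epsilon>0}" for n
  proof -
    have "inverse (real (Suc n)) \<le> 1"
      by (simp add: field_simps)
    then have "S n \<le> \<epsilon>0 / 2 * 1"
      unfolding S_def using \<epsilon>0_pos by (intro mult_left_mono) auto
    moreover have "0 < S n"
      using \<epsilon>0_pos by (simp add: S_def)
    ultimately show ?thesis
      using \<epsilon>0_pos by simp
  qed
  have S_lim: "S \<longlonglongrightarrow> 0"
    using tendsto_mult_right[OF LIMSEQ_inverse_real_of_nat, of "\<epsilon>0 / 2"] by (simp add: S_def[abs_def] mult.commute)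
  let ?Om = "\<lambda>n. osc_domain b G \<alpha> (S n)" and ?g = "\<lambda>n. osc G \<alpha> (S n)"
  have Om_sets: "?Om n \<in> sets borel" for n
    by (rule borel_open[OF open_domain[OF S]])
  have "\<exists>f'. borel_rep (?Om n) (f (S n)) f'" for n
    using L2_borel_rep[OF Om_sets f_L2[OF S]] by metis
  then obtain f' where f': "\<And>n. borel_rep (?Om n) (f (S n)) (f' n)"
    by metis
  have f'g: "AE x in lborel. AE y in lborel. (x, y) \<in> ?Om n \<longrightarrow> f' n (x, y) = g x" for n
  proof -
    have "AE z in lborel. z \<in> ?Om n \<longrightarrow> f (S n) z = g (fst z)"
      using fg[OF S[of n]] by (simp add: AE_lebesgue_on_iff[OF Om_sets])
    then have "AE z in lborel. z \<in> ?Om n \<longrightarrow> f' n z = g (fst z)"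
      using borel_repD(3)[OF f'[of n]] by eventually_elim auto
    from AE_lborel2_slice[OF this] show ?thesis
      by simp
  qed
  interpret C0: column_domain b M "?g 0"
    by (rule column[OF S])
  have f'0: "sq_int (f' 0)" "\<And>z. z \<notin> C0.Om \<Longrightarrow> f' 0 z = 0"
    using borel_repD(1,2)[OF f'[of 0]] by (auto simp: Om_eq[OF S])
  \<comment> \<open>g is an arbitrary function; the strip mean of a Borel representative of the
    source provides an integrable version of it.\<close>
  define k where "k = C0.avg (f' 0)"
  have k: "integrable lborel k" "\<And>x. x \<notin> {0<..<1} \<Longrightarrow> k x = 0"
    unfolding k_def by (rule C0.avg_sq_int(3)[OF f'0] C0.avg_sq_int(2)[OF f'0]; assumption)+
  have km: "k \<in> borel_measurable borel"
    using k by auto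
  have gk: "AE x in lborel. x \<in> {0<..<1} \<longrightarrow> g x = k x"
    using f'g[of 0]
  proof eventually_elim
    case (elim x)
    show ?case
    proof
      assume x: "x \<in> {0<..<1}"
      have "(LBINT y. indicator {- b<..<0} y * f' 0 (x, y)) = (LBINT y. indicator {- b<..<0} y * g x)"
      proof (rule integral_cong_AE)
        show "AE y in lborel. indicator {- b<..<0} y * f' 0 (x, y) = indicator {- b<..<0} y * g x"
          using elim
        proof eventually_elim
          case (elim y)
          then show ?case
            using x G_nonneg[of "x / S 0 powr \<alpha>"] by (auto simp: osc_domain_def osc_def indicator_def)
        qed
      qed (use borel_measurable_slice(1)[OF sq_intD(1)[OF f'0(1)]] in auto)
      also have "\<dots> = b * g x"
        using b_pos by simp
      finally show "g x = k x"
        using b_pos by (simp add: k_def C0.avg_def)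
    qed
  qed
  have col: "AE x in lborel. (LBINT y. f' n (x, y)) = ?J x * (?g n x - mean) * k x + (b + mean) * k x" for n
    using f'g[of n] gk
  proof eventually_elim
    case (elim x)
    show ?case
    proof (cases "x \<in> {0<..<1}")
      case True
      have "(LBINT y. f' n (x, y)) = (LBINT y. indicator {- b<..<?g n x} y * k x)"
      proof (rule integral_cong_AE)
        show "AE y in lborel. f' n (x, y) = indicator {- b<..<?g n x} y * k x"
          using elim(1)
        proof eventually_elim
          case (elim y)
          then show ?case
            using True \<open>x \<in> {0<..<1} \<longrightarrow> g x = k x\<close> borel_repD(2)[OF f'[of n], of "(x, y)"]
            by (cases "(x, y) \<in> ?Om n") (auto simp: osc_domain_def indicator_def)
        qed
      qed (use borel_measurable_slice(1)[OF sq_intD(1)[OF borel_repD(1)[OF f']]] in auto)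
      also have "\<dots> = (b + ?g n x) * k x"
        using b_pos G_nonneg[of "x / S n powr \<alpha>"] by (simp add: osc_def)
      finally show ?thesis
        using True by (simp add: algebra_simps)
    next
      case False
      have "f' n (x, y) = 0" for y
        by (rule borel_repD(2)[OF f']) (use False in \<open>auto simp: osc_domain_def\<close>)
      then show ?thesis
        using False k(2) by simp
    qed
  qed
  have fhi: "integrable lborel fh"
    by (rule sq_int_integrable[OF borel_repD(1,2)[OF fh] unit_fmeasurable])
  \<comment> \<open>Two limits of one sequence of primitives. Since primitives determine the
    integrals over all intervals, this identifies the functions almost everywhere.\<close>
  have prim_eq: "prim fh x = (b + mean) * prim k x" for x
  proof (rule LIMSEQ_unique)
    show "(\<lambda>n. prim (\<lambda>x. LBINT y. f' n (x, y)) x) \<longlonglongrightarrow> prim fh x"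
      by (rule column_integral_weak_limit[OF weak fh S S_lim f'])
    have "prim (\<lambda>x. LBINT y. f' n (x, y)) x
        = (LBINT t. (?J t * (?g n t - mean)) * (indicator {..x} t * k t)) + (b + mean) * prim k x" for n
    proof -
      have qm: "(\<lambda>t. ?J t * (?g n t - mean)) \<in> borel_measurable borel"
        unfolding osc_def by measurable
      have "\<bar>?J t * (?g n t - mean)\<bar> \<le> M" for t
        using oscillation_abs_le[of "t / S n powr \<alpha>"] by (auto simp: osc_def indicator_def)
      then have qk: "integrable lborel (\<lambda>t. ?J t * (?g n t - mean) * k t)"
        using integrable_mult_bounded[OF k(1) qm, of M] by (simp add: mult.commute)
      have "prim (\<lambda>x. LBINT y. f' n (x, y)) x = prim (\<lambda>t. ?J t * (?g n t - mean) * k t + (b + mean) * k t) x"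
        by (rule prim_cong_AE[OF borel_measurable_slice(3)[OF sq_intD(1)[OF borel_repD(1)[OF f']]] _ col]) (use qk km in auto)
      also have "\<dots> = prim (\<lambda>t. ?J t * (?g n t - mean) * k t) x + (b + mean) * prim k x"
        using qk k(1) by (subst prim_add) (auto simp: prim_cmult)
      finally show ?thesis
        by (simp add: prim_def mult_ac)
    qed
    moreover have "(\<lambda>n. LBINT t. (?J t * (?g n t - mean)) * (indicator {..x} t * k t)) \<longlonglongrightarrow> 0"
      by (intro osc_weakly_null S S_lim integrable_indicator_mult k) simp
    ultimately show "(\<lambda>n. prim (\<lambda>x. LBINT y. f' n (x, y)) x) \<longlonglongrightarrow> (b + mean) * prim k x"
      using tendsto_add[OF _ tendsto_const, of _ 0 sequentially "(b + mean) * prim k x"] by simp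
  qed
  have "AE x in lborel. fh x - (b + mean) * k x = 0"
  proof (rule AE_zero_if_box_integrals_zero)
    show int: "integrable lborel (\<lambda>x. fh x - (b + mean) * k x)"
      using fhi k(1) by simp
    show "(LBINT x. (fh x - (b + mean) * k x) * indicator (box s t) x) = 0" for s t
    proof (cases "s \<le> t")
      case True
      have "(LBINT x. (fh x - (b + mean) * k x) * indicator (box s t) x)
          = (LBINT x. indicator {s<..t} x * (fh x - (b + mean) * k x))"
        using AE_lborel_singleton[of t] fhi k(1) by (intro integral_cong_AE) (auto simp: indicator_def box_real)
      also have "\<dots> = prim (\<lambda>x. fh x - (b + mean) * k x) t - prim (\<lambda>x. fh x - (b + mean) * k x) s"
        by (rule prim_increment[OF int True, symmetric])
      also have "\<dots> = 0"
        using fhi k(1) by (simp add: prim_diff prim_cmult prim_eq)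
      finally show ?thesis .
    qed (simp add: box_real)
  qed
  then show ?thesis
    using gk by eventually_elim auto
qed

end

section \<open>Areas of the cells and assembly of the result\<close>

lemma measure_under_graph:
  fixes G :: "real \<Rightarrow> real"
  assumes [measurable]: "G \<in> borel_measurable borel" and G: "\<And>y. 0 \<le> G y" "\<And>y. G y \<le> M" and "b > 0" "L > 0"
  shows "measure lebesgue {(y1, y2). 0 < y1 \<and> y1 < L \<and> - b < y2 \<and> y2 < G y1}
    = L * b + (LBINT t. indicator {0<..<L} t * G t)"
proof -
  define A where "A = {(y1, y2). 0 < y1 \<and> y1 < L \<and> - b < y2 \<and> y2 < G y1}"
  have A_eq: "A = {z. 0 < fst z \<and> fst z < L \<and> - b < snd z \<and> snd z < G (fst z)}"
    by (auto simp: A_def)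
  have A: "A \<in> sets borel"
    unfolding A_eq by measurable
  have "bounded A"
  proof (rule bounded_subset)
    show "bounded ({0..L} \<times> {- b..M})"
      by (intro bounded_Times bounded_closed_interval)
    show "A \<subseteq> {0..L} \<times> {- b..M}"
    proof
      show "z \<in> {0..L} \<times> {- b..M}" if "z \<in> A" for z
        using that G(2)[of "fst z"] by (auto simp: A_eq mem_Times_iff)
    qed
  qed
  then have int: "integrable lborel (indicator A :: real \<times> real \<Rightarrow> real)"
    using A emeasure_bounded_finite[of A] by (intro integrable_real_indicator) auto
  have Gi: "integrable lborel (\<lambda>t. indicator {0<..<L} t * G t)"
    by (rule integrable_mult_bounded[where B = M]) (use \<open>L > 0\<close> G in \<open>auto intro!: integrable_real_indicator\<close>)
  have "measure lebesgue A = measure lborel A"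
    using A by (simp add: measure_completion)
  also have "\<dots> = (LBINT z. indicator A z)"
    using A by simp
  also have "\<dots> = (LBINT x. LBINT y. indicator A (x, y))"
    by (rule lborel2_fst[OF int])
  also have "\<dots> = (LBINT x. b * indicator {0<..<L} x + indicator {0<..<L} x * G x)"
  proof (intro Bochner_Integration.integral_cong refl)
    fix x
    have "(LBINT y. indicat_real A (x, y)) = (LBINT y. indicator {0<..<L} x * indicator {- b<..<G x} y)"
      by (intro Bochner_Integration.integral_cong refl) (auto simp: A_eq indicator_def)
    also have "\<dots> = b * indicator {0<..<L} x + indicator {0<..<L} x * G x"
      using \<open>b > 0\<close> G(1)[of x] by (simp add: algebra_simps)
    finally show "(LBINT y. indicat_real A (x, y)) = b * indicator {0<..<L} x + indicator {0<..<L} x * G x" .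
  qed
  also have "\<dots> = L * b + (LBINT t. indicator {0<..<L} t * G t)"
    using Gi \<open>L > 0\<close> by (subst Bochner_Integration.integral_add) (auto intro!: integrable_mult_right integrable_real_indicator)
  finally show ?thesis
    by (simp add: A_def)
qed

theorem corollary2p3:
  fixes \<alpha> b L \<epsilon>0 C p d :: real
    and G fhat f :: "real \<Rightarrow> real"
    and f\<epsilon> u\<epsilon> :: "real \<Rightarrow> real \<times> real \<Rightarrow> real"
    and \<Omega> :: "real \<Rightarrow> (real \<times> real) set"
  assumes "\<alpha> > 1" and "b > 0" and "L > 0" and "\<epsilon>0 > 0"
    and periodic: "\<And>y. G (y + L) = G y"
    and min_zero: "\<And>y. 0 \<le> G y" "\<exists>y. G y = 0"
    and bounded: "bounded (range G)"
    and \<Omega>: "\<And>\<epsilon>. \<Omega> \<epsilon> = osc_domain b G \<alpha> \<epsilon>"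
    and domain: "\<And>\<epsilon>. \<epsilon> \<in> {0<..<\<epsilon>0} \<Longrightarrow> open (\<Omega> \<epsilon>) \<and> connected (\<Omega> \<epsilon>)"
    and f\<epsilon>_L2: "\<And>\<epsilon>. \<epsilon> \<in> {0<..<\<epsilon>0} \<Longrightarrow> f\<epsilon> \<epsilon> \<in> L2 (\<Omega> \<epsilon>)"
    and f\<epsilon>_bound: "\<And>\<epsilon>. \<epsilon> \<in> {0<..<\<epsilon>0} \<Longrightarrow> L2_norm (\<Omega> \<epsilon>) (f\<epsilon> \<epsilon>) \<le> C"
    and fhat: "L2_weakly_converges {0<..<1} (\<lambda>\<epsilon>. vertical_integral b G \<alpha> \<epsilon> (f\<epsilon> \<epsilon>)) fhat (at_right 0)"
    and u\<epsilon>: "\<And>\<epsilon>. \<epsilon> \<in> {0<..<\<epsilon>0} \<Longrightarrow> weak_solution_2D (\<Omega> \<epsilon>) \<epsilon> (f\<epsilon> \<epsilon>) (u\<epsilon> \<epsilon>)"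
    and p: "p = b + 1 / L * (LINT y|lebesgue_on {0..L}. G y)"
    and f: "f = (\<lambda>x. fhat x / p)"
    and d: "d = b / (b + 1 / L * (LINT y|lebesgue_on {0..L}. G y))"
  shows "(\<exists>u. weak_solution_1D d f u \<and>
            (\<forall>v. weak_solution_1D d f v \<longrightarrow> (AE x in lebesgue_on {0<..<1}. v x = u x)) \<and>
            ((\<lambda>\<epsilon>. L2_norm (\<Omega> \<epsilon>) (\<lambda>x. u\<epsilon> \<epsilon> x - u (fst x))) \<longlongrightarrow> 0) (at_right 0)) \<and>
         d = L * b / (L * b + (LINT y|lebesgue_on {0..L}. G y)) \<and>
         d = measure lebesgue {(y1, y2). 0 < y1 \<and> y1 < L \<and> -b < y2 \<and> y2 < (0::real)}
             / measure lebesgue {(y1, y2). 0 < y1 \<and> y1 < L \<and> -b < y2 \<and> y2 < G y1} \<and>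
         (\<forall>g. (\<forall>\<epsilon>\<in>{0<..<\<epsilon>0}. AE x in lebesgue_on (\<Omega> \<epsilon>). f\<epsilon> \<epsilon> x = g (fst x)) \<longrightarrow>
              (AE x in lebesgue_on {0<..<1}. g x = f x))"
proof -
  obtain y0 where y0: "G y0 = 0"
    using min_zero(2) by blast
  obtain M where M: "\<And>y. G y \<le> M"
    using bounded by (auto simp: bounded_iff abs_le_iff)
  interpret oscillating_boundary \<alpha> b L \<epsilon>0 M y0 G
    using assms(1-4) periodic min_zero(1) y0 M domain by unfold_locales (auto simp: \<Omega>)
  have cell: "(LINT y|lebesgue_on {0..L}. G y) = L * mean"
    by (rule integral_cell)
  have p_eq: "p = b + mean" and d_eq: "d = b / (b + mean)"
    using L_pos by (simp_all add: p d cell)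
  have p_pos: "0 < p"
    using b_pos mean_bounds(1) by (simp add: p_eq)
  have d_pos: "0 < d"
    using b_pos p_pos by (simp add: d_eq p_eq)
  have "fhat \<in> L2 {0<..<1}"
    using fhat by (simp add: L2_weakly_converges_def)
  then obtain fh where fh: "borel_rep {0<..<1} fhat fh"
    by (rule L2_borel_rep[rotated]) auto
  define f' where "f' x = 1 / p * fh x" for x
  have f': "sq_int f'" "\<And>x. x \<notin> {0<..<1} \<Longrightarrow> f' x = 0"
    using sq_int_cmult[OF borel_repD(1)[OF fh], of "1 / p"] borel_repD(2)[OF fh] by (auto simp: f'_def[abs_def])
  have "AE x in lborel. x \<in> {0<..<1} \<longrightarrow> f x = f' x"
    using borel_repD(3)[OF fh] by eventually_elim (simp add: f f'_def)
  then have f_rep: "borel_rep {0<..<1} f f'"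
    using f' by (simp add: borel_rep_def)
  obtain c v where N: "sq_int v" "\<forall>x. x \<notin> {0<..<1} \<longrightarrow> v x = 0"
    "\<forall>a w. sq_int w \<longrightarrow> (\<forall>x. x \<notin> {0<..<1} \<longrightarrow> w x = 0) \<longrightarrow>
       d * (LBINT x. v x * w x) + (LBINT x. ac c v x * ac a w x) = (LBINT x. f' x * ac a w x)"
    using neumann_solution[OF d_pos f'] by blast
  have v: "sq_int v" "\<And>x. x \<notin> {0<..<1} \<Longrightarrow> v x = 0"
    using N by auto
  have eq: "d * (LBINT x. v x * w x) + (LBINT x. ac c v x * ac a w x) = (LBINT x. f' x * ac a w x)"
    if "sq_int w" "\<And>x. x \<notin> {0<..<1} \<Longrightarrow> w x = 0" for a w
    using N(3) that by simp
  note sol = weak_solution_1D_ac[OF d_pos f_rep v eq]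
  \<comment> \<open>Multiplication by p turns the coefficient d into p d = b and the source f into
    \<open>fhat\<close>, the form required by \<open>homogenized_limit\<close>.\<close>
  have limit: "b * (LBINT x. v x * w x) + (b + mean) * (LBINT x. ac c v x * ac a w x) = (LBINT x. fh x * ac a w x)"
    if w: "sq_int w" "\<And>x. x \<notin> {0<..<1} \<Longrightarrow> w x = 0" for a w
  proof -
    have "(LBINT x. fh x * ac a w x) = p * (LBINT x. f' x * ac a w x)"
    proof -
      have "f' x * ac a w x = 1 / p * (fh x * ac a w x)" for x
        by (simp add: f'_def)
      then have "(LBINT x. f' x * ac a w x) = 1 / p * (LBINT x. fh x * ac a w x)"
        by (simp only: integral_mult_right_zero)
      then show ?thesis
        using p_pos by simp
    qed
    also have "(LBINT x. f' x * ac a w x) = d * (LBINT x. v x * w x) + (LBINT x. ac c v x * ac a w x)"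
      by (rule eq[OF w, symmetric])
    also have "p * \<dots> = p * d * (LBINT x. v x * w x) + p * (LBINT x. ac c v x * ac a w x)"
      by (simp add: distrib_left)
    also have "p * d = b"
      using p_pos by (simp add: d_eq p_eq)
    finally show ?thesis
      by (simp add: p_eq)
  qed
  have conv: "((\<lambda>\<epsilon>. L2_norm (\<Omega> \<epsilon>) (\<lambda>x. u\<epsilon> \<epsilon> x - (c + prim v (fst x)))) \<longlongrightarrow> 0) (at_right 0)"
    unfolding \<Omega>
    by (rule homogenized_limit[OF f\<epsilon>_L2[unfolded \<Omega>] f\<epsilon>_bound[unfolded \<Omega>] fhat u\<epsilon>[unfolded \<Omega>] fh v limit])
  have 1: "\<exists>u. weak_solution_1D d f u \<and>
            (\<forall>v. weak_solution_1D d f v \<longrightarrow> (AE x in lebesgue_on {0<..<1}. v x = u x)) \<and>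
            ((\<lambda>\<epsilon>. L2_norm (\<Omega> \<epsilon>) (\<lambda>x. u\<epsilon> \<epsilon> x - u (fst x))) \<longlongrightarrow> 0) (at_right 0)"
    using sol conv by (intro exI[of _ "\<lambda>x. c + prim v x"]) blast
  have 2: "d = L * b / (L * b + (LINT y|lebesgue_on {0..L}. G y))"
    unfolding cell d_eq using L_pos by (simp flip: distrib_left)
  have "measure lebesgue {(y1, y2). 0 < y1 \<and> y1 < L \<and> - b < y2 \<and> y2 < (0::real)} = L * b"
    using measure_under_graph[of "\<lambda>_. 0" 0 b L] b_pos L_pos by simp
  moreover have "measure lebesgue {(y1, y2). 0 < y1 \<and> y1 < L \<and> - b < y2 \<and> y2 < G y1} = L * b + L * mean"
    using measure_under_graph[OF G_borel G_nonneg G_le b_pos L_pos] by (simp add: integral_cell(2))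
  ultimately have 3: "d = measure lebesgue {(y1, y2). 0 < y1 \<and> y1 < L \<and> - b < y2 \<and> y2 < (0::real)}
             / measure lebesgue {(y1, y2). 0 < y1 \<and> y1 < L \<and> - b < y2 \<and> y2 < G y1}"
    using 2 by (simp add: cell)
  have 4: "AE x in lebesgue_on {0<..<1}. g x = f x"
    if g: "\<forall>\<epsilon>\<in>{0<..<\<epsilon>0}. AE x in lebesgue_on (\<Omega> \<epsilon>). f\<epsilon> \<epsilon> x = g (fst x)" for g
  proof -
    have "AE x in lborel. x \<in> {0<..<1} \<longrightarrow> fh x = (b + mean) * g x"
      by (rule common_source[OF fhat f\<epsilon>_L2[unfolded \<Omega>] g[unfolded \<Omega>, rule_format] fh])
    then have "AE x in lborel. x \<in> {0<..<1} \<longrightarrow> g x = f x"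
      using borel_repD(3)[OF fh] by eventually_elim (use p_pos in \<open>auto simp: f p_eq\<close>)
    then show ?thesis
      by (simp add: AE_lebesgue_on_iff)
  qed
  show ?thesis
    using 1 2 3 4 by blast
qed

end
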